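(* Let $c_1,\dots,c_s\in\mathbb{Z}\setminus\{0\}$ and suppose that $\sum_{i\in I}c_i=0$ for some non-empty $I\subseteq\{1,\dots,s\}$ with $|I|\ge 6$. Suppose in addition that at least two of the $c_i$ are positive and at least two are negative. Then the equation $$c_1x_1^2+\dots+c_sx_s^2=0$$ is partition regular over the positive integers, i.e. in every colouring of the positive integers with finitely many colours there is a solution in positive integers $x_1,\dots,x_s$ all of the same colour. *)

theory Defs
  imports Main
begin

text \<open>
  An equation in \<open>s\<close> unknowns is given by the predicate \<open>E\<close> saying that an assignment
  \<open>x\<close> of the unknowns \<open>x 1, \<dots>, x s\<close> satisfies it; values of \<open>x\<close> outside \<open>{1..s}\<close> are
  not meant to matter. Positive integers are the positive elements of \<^typ>\<open>nat\<close>. Colours are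
  natural numbers, which loses no generality as only finitely many are used; the colour
  of \<open>0\<close> plays no role. The \<open>x i\<close> need not be distinct.
\<close>

definition partition_regular :: "nat \<Rightarrow> ((nat \<Rightarrow> nat) \<Rightarrow> bool) \<Rightarrow> bool" where
  "partition_regular s E \<longleftrightarrow>
     (\<forall>\<chi> :: nat \<Rightarrow> nat. finite (\<chi> ` {0<..}) \<longrightarrow>
       (\<exists>x k. (\<forall>i\<in>{1..s}. x i > 0 \<and> \<chi> (x i) = k) \<and> E x))"

end

theory Submission
  imports Defs "HOL-Number_Theory.Number_Theory" "HOL-Computational_Algebra.Nth_Powers"
    "HOL-Computational_Algebra.Squarefree" "HOL-Library.Countable"
begin

text \<open>
  Induction on the number of colours. By van der Waerden there is a progression
  \<open>a + b d\<close> (\<open>|b| \<le> B\<close>) in one colour \<open>k\<close>. If some dilate \<open>{q, 2 q, \<dots>, N q}\<close> avoids \<open>k\<close>, it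
  is coloured with fewer colours and contains a solution. Otherwise every unknown outside \<open>I\<close> can
  be given the colour \<open>k\<close> as \<open>x\<^sub>j = t\<^sub>j D\<^sub>j m d\<close> with \<open>t\<^sub>j \<le> N\<close>, for weights \<open>D\<^sub>j\<close> fixed in advance,
  and setting \<open>x\<^sub>i = a + b\<^sub>i d\<close> for \<open>i \<in> I\<close> solves the equation provided that \<open>\<Sum> c\<^sub>i b\<^sub>i = 0\<close> and
  \<open>\<Sum> c\<^sub>i b\<^sub>i\<^sup>2 = - C m\<^sup>2\<close> (sums over \<open>I\<close>), where \<open>C = \<Sum> c\<^sub>j (t\<^sub>j D\<^sub>j)\<^sup>2\<close> (sum outside \<open>I\<close>). Modulo its radical
  \<open>(1, \<dots>, 1)\<close>, the form \<open>\<Sum> c\<^sub>i b\<^sub>i\<^sup>2\<close> on the hyperplane \<open>\<Sum> c\<^sub>i b\<^sub>i = 0\<close> has rank at least \<open>4\<close>, so together with \<open>C m\<^sup>2\<close> it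
  contains a form in five variables, indefinite for suitable \<open>D\<^sub>j\<close>, and Meyer's theorem applies.

  Meyer's theorem is derived from Legendre's theorem on \<open>z\<^sup>2 = a x\<^sup>2 + b y\<^sup>2\<close>: one looks for \<open>u\<close>
  represented by \<open>\<langle>a\<^sub>1, a\<^sub>2\<rangle>\<close> and \<open>w\<close> represented by \<open>\<langle>a\<^sub>3, a\<^sub>4\<rangle>\<close> and by \<open>- \<langle>a\<^sub>5, u\<rangle>\<close>. Choosing \<open>u\<close> such that
  \<open>u a\<^sub>3 a\<^sub>4 a\<^sub>5\<close> is not a square at any bad prime makes the conditions on \<open>w\<close> locally
  solvable. They are realised by a number with one further prime factor \<open>l\<close>, prescribed by
  quadratic characters, and the product formula for Hilbert symbols yields the condition at \<open>l\<close>.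
\<close>

section \<open>Characters and partial sums\<close>

text \<open>Why six: if \<open>I\<close> has p positive and n negative coefficients, the form on the
  hyperplane modulo (1, ..., 1) has signature (p - 1, n - 1), so six coefficients give rank 4. The
  extra term in C makes five variables, the least number for which indefiniteness alone guarantees a
  rational zero. The sign hypothesis enters in the same way. For C > 0, indefiniteness asks for two
  negative coefficients inside \<open>I\<close>; if there are fewer, some negative coefficient lies
  outside \<open>I\<close>, and a large weight on it keeps C <= 0. The case C < 0 is symmetric. The
  order of the choices is the main obstacle. The multipliers t, and with them C, are known only
  after the dilates by D m d have been tested for the colour k, so m has to be fixed before C. This
  works because t <= N leaves only finitely many values of C, for which one m can be found. All
  conditions on the auxiliary prime l are quadratic, so Dirichlet's theorem is needed for real
  characters only. The Hilbert symbols are never related to p-adic numbers: just their formulas,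
  bilinearity and reciprocity are used.\<close>

lemma sum_mult_antimono_bound:
  fixes f g :: "nat \<Rightarrow> real"
  assumes F: "\<And>m. m \<le> n \<Longrightarrow> \<bar>\<Sum>k<m. f k\<bar> \<le> K"
    and g: "\<And>k. k < n \<Longrightarrow> g (Suc k) \<le> g k" and g0: "g n \<ge> 0"
  shows "\<bar>\<Sum>k<n. f k * g k\<bar> \<le> K * g 0"
proof -
  define F where "F m = (\<Sum>k<m. f k)" for m
  have K: "K \<ge> 0" using F[of 0] by simp
  \<comment> \<open>Abel summation. The differences of \<open>g\<close> are nonnegative and
    telescope, so that only \<open>g 0\<close> survives in the bound.\<close>
  have eq: "(\<Sum>k<m. f k * g k) = F m * g m + (\<Sum>k<m. F (Suc k) * (g k - g (Suc k)))" for m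
    by (induction m) (simp_all add: F_def algebra_simps)
  have "\<bar>\<Sum>k<n. f k * g k\<bar> \<le> \<bar>F n * g n\<bar> + \<bar>\<Sum>k<n. F (Suc k) * (g k - g (Suc k))\<bar>"
    unfolding eq by (rule abs_triangle_ineq)
  also have "\<bar>F n * g n\<bar> \<le> K * g n"
    using F[of n] g0 by (simp add: F_def abs_mult mult_right_mono)
  also have "\<bar>\<Sum>k<n. F (Suc k) * (g k - g (Suc k))\<bar> \<le> (\<Sum>k<n. K * (g k - g (Suc k)))"
  proof (rule order_trans[OF sum_abs sum_mono])
    fix k assume "k \<in> {..<n}"
    then show "\<bar>F (Suc k) * (g k - g (Suc k))\<bar> \<le> K * (g k - g (Suc k))"
      using F[of "Suc k"] g[of k] by (simp add: F_def abs_mult mult_right_mono)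
  qed
  also have "(\<Sum>k<n. K * (g k - g (Suc k))) = K * (g 0 - g n)"
    by (simp only: sum_distrib_left[symmetric] sum_lessThan_telescope')
  finally show ?thesis by (simp add: algebra_simps)
qed

text \<open>The substitution n = d m. It serves the Lambert series, the factorisation of N! and the
  character sum weighted by ln n / n.\<close>

lemma sum_divisors_swap:
  fixes F :: "nat \<Rightarrow> nat \<Rightarrow> 'a :: comm_monoid_add"
  shows "(\<Sum>n=1..N. \<Sum>d | d dvd n. F d (n div d)) = (\<Sum>d=1..N. \<Sum>m=1..N div d. F d m)"
proof -
  have "(\<Sum>n=1..N. \<Sum>d | d dvd n. F d (n div d))
      = (\<Sum>(n,d)\<in>(SIGMA n:{1..N}. {d. d dvd n}). F d (n div d))"
    by (rule sum.Sigma) auto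
  also have "\<dots> = (\<Sum>(d,m)\<in>(SIGMA d:{1..N}. {1..N div d}). F d m)"
  proof (rule sum.reindex_bij_witness[where j = "\<lambda>(n,d). (d, n div d)" and i = "\<lambda>(d,m). (d * m, d)"])
    fix a assume "a \<in> (SIGMA d:{1..N}. {1..N div d})"
    then obtain d m where a: "a = (d, m)" "1 \<le> d" "1 \<le> m" "m \<le> N div d" by auto
    then have "d * m \<le> N" by (metis le_trans mult.commute mult_le_mono1 times_div_less_eq_dividend)
    with a show "(case case a of (d, m) \<Rightarrow> (d * m, d) of (n, d) \<Rightarrow> (d, n div d)) = a"
      "(case a of (d, m) \<Rightarrow> (d * m, d)) \<in> (SIGMA n:{1..N}. {d. d dvd n})" by auto
  next
    fix a assume "a \<in> (SIGMA n:{1..N}. {d. d dvd n})"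
    then obtain n d where a: "a = (n, d)" "1 \<le> n" "n \<le> N" "d dvd n" by auto
    then have "d \<le> N" "d \<ge> 1" "n div d \<ge> 1" "n div d \<le> N div d"
      using dvd_imp_le[of d n] dvd_div_eq_0_iff[of d n] by (auto simp: Suc_le_eq intro!: Nat.gr0I div_le_mono)
    with a show "(case case a of (n, d) \<Rightarrow> (d, n div d) of (d, m) \<Rightarrow> (d * m, d)) = a"
      "(case a of (n, d) \<Rightarrow> (d, n div d)) \<in> (SIGMA d:{1..N}. {1..N div d})"
      "(case (case a of (n, d) \<Rightarrow> (d, n div d)) of (d, m) \<Rightarrow> F d m) = (case a of (n, d) \<Rightarrow> F d (n div d))"
      by auto
  qed
  also have "\<dots> = (\<Sum>d=1..N. \<Sum>m=1..N div d. F d m)"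
    by (rule sum.Sigma[symmetric]) auto
  finally show ?thesis .
qed

text \<open>\<open>zero_iff\<close> refers to \<open>M\<close> and not to a conductor: all
  characters in play share one modulus, so their pointwise products stay in the locale.\<close>

locale real_character =
  fixes M :: nat and \<chi> :: "nat \<Rightarrow> real"
  assumes M_pos: "M > 0"
    and chi_mult: "\<chi> (m * n) = \<chi> m * \<chi> n"
    and periodic: "\<chi> (n + M) = \<chi> n"
    and zero_iff: "\<chi> n = 0 \<longleftrightarrow> \<not> coprime n M"
    and range: "\<chi> n \<in> {-1, 0, 1}"
begin

lemma chi_mod: "\<chi> (n mod M) = \<chi> n"
proof -
  have "\<chi> (r + q * M) = \<chi> r" for r q
    by (induction q) (simp_all add: add.assoc[symmetric] periodic, metis add.commute add.left_commute periodic)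
  from this[of "n mod M" "n div M"] show ?thesis by simp
qed

lemma abs_le_1: "\<bar>\<chi> n\<bar> \<le> 1"
  using range[of n] by auto

lemma chi_1 [simp]: "\<chi> (Suc 0) = 1"
  using chi_mult[of 1 1] zero_iff[of 1] range[of 1] by auto

end

locale nonprincipal_character = real_character +
  assumes nonprincipal: "\<exists>a. \<chi> a = -1"
begin

text \<open>Multiplication by a unit \<open>a\<close> with value -1 permutes the residues and
  negates the sum.\<close>

lemma sum_period: "(\<Sum>k<M. \<chi> k) = 0"
proof -
  obtain a where a: "\<chi> a = -1" using nonprincipal by blast
  then have cop: "coprime a M" using zero_iff[of a] by auto
  have inj: "inj_on (\<lambda>k. a * k mod M) {..<M}"
  proof (rule inj_onI)
    fix i j assume "i \<in> {..<M}" "j \<in> {..<M}" "a * i mod M = a * j mod M"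
    then show "i = j"
      using cong_mult_lcancel_nat[OF cop, of i j] by (simp add: cong_def)
  qed
  have "(\<lambda>k. a * k mod M) ` {..<M} = {..<M}"
    using M_pos by (intro endo_inj_surj inj) auto
  then have "(\<Sum>k<M. \<chi> k) = (\<Sum>k<M. \<chi> (a * k mod M))"
    using sum.reindex[OF inj, of \<chi>] by simp
  also have "\<dots> = - (\<Sum>k<M. \<chi> k)"
    by (simp add: chi_mod chi_mult a sum_negf)
  finally show ?thesis by simp
qed

lemma partial_sum_bound: "\<bar>\<Sum>k<n. \<chi> k\<bar> \<le> M"
proof -
  have step: "(\<Sum>k<n + M. \<chi> k) = (\<Sum>k<n. \<chi> k)" for n
  proof (induction n)
    case (Suc n)
    have "(\<Sum>k<Suc n + M. \<chi> k) = (\<Sum>k<n + M. \<chi> k) + \<chi> (n + M)" by simp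
    with Suc show ?case by (simp add: periodic)
  qed (simp add: sum_period)
  have eq: "(\<Sum>k<r + q * M. \<chi> k) = (\<Sum>k<r. \<chi> k)" for q r
  proof (induction q)
    case (Suc q)
    with step[of "r + q * M"] show ?case by (simp add: algebra_simps)
  qed simp
  have "\<bar>\<Sum>k<n mod M. \<chi> k\<bar> \<le> (\<Sum>k<n mod M. 1)"
    by (intro order_trans[OF sum_abs] sum_mono abs_le_1)
  also have "\<dots> \<le> M" using M_pos by (simp add: less_imp_le)
  finally show ?thesis using eq[of "n mod M" "n div M"] by simp
qed

lemma weighted_sum_bound:
  fixes g :: "nat \<Rightarrow> real"
  assumes "\<And>k. a \<le> k \<Longrightarrow> k < b \<Longrightarrow> g (Suc k) \<le> g k" and "g b \<ge> 0" and "a \<le> b"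
  shows "\<bar>\<Sum>k=a..<b. \<chi> k * g k\<bar> \<le> 2 * M * g a"
proof -
  have "\<bar>\<Sum>k<b-a. \<chi> (k + a) * g (k + a)\<bar> \<le> 2 * M * g (0 + a)"
  proof (rule sum_mult_antimono_bound)
    fix m
    \<comment> \<open>A block is a difference of two initial sums, hence the factor 2.\<close>
    have "(\<Sum>k<m. \<chi> (k + a)) = (\<Sum>k<a + m. \<chi> k) - (\<Sum>k<a. \<chi> k)"
      by (induction m) (simp_all add: add.commute)
    then show "\<bar>\<Sum>k<m. \<chi> (k + a)\<bar> \<le> 2 * M"
      using partial_sum_bound[of "a + m"] partial_sum_bound[of a] by simp
  qed (use assms in \<open>auto simp: less_diff_conv\<close>)
  also have "(\<Sum>k<b-a. \<chi> (k + a) * g (k + a)) = (\<Sum>k=a..<b. \<chi> k * g k)"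
    using sum.shift_bounds_nat_ivl[of "\<lambda>k. \<chi> k * g k" 0 a "b - a"] \<open>a \<le> b\<close>
    by (simp add: atLeast0LessThan)
  finally show ?thesis by simp
qed

text \<open>The L-series of \<chi> at 1. The term at 0 is harmless, division by zero being
  0.\<close>

definition L1 :: real where "L1 = (\<Sum>n. \<chi> n / n)"

lemma harmonic_block_bound:
  assumes "0 < a" "a \<le> b"
  shows "\<bar>\<Sum>k=a..<b. \<chi> k / k\<bar> \<le> 2 * M / a"
  using weighted_sum_bound[of a b "\<lambda>k. 1 / k"] assms by (simp add: frac_le)

lemma summable_harmonic: "summable (\<lambda>n. \<chi> n / n)"
proof (subst summable_Cauchy, intro allI impI)
  fix e :: real assume e: "e > 0"
  obtain N :: nat where N: "2 * M / e < N" using reals_Archimedean2 by blast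
  then have "N > 0" using e by (smt (verit, best) divide_nonneg_pos of_nat_0_le_iff of_nat_0_less_iff)
  show "\<exists>N. \<forall>m\<ge>N. \<forall>n. norm (\<Sum>k=m..<n. \<chi> k / k) < e"
  proof (intro exI[of _ N] allI impI)
    fix m n assume "N \<le> m"
    show "norm (\<Sum>k=m..<n. \<chi> k / k) < e"
    proof (cases "m \<le> n")
      case True
      have "norm (\<Sum>k=m..<n. \<chi> k / k) \<le> 2 * M / m"
        using harmonic_block_bound[of m n] True \<open>N > 0\<close> \<open>N \<le> m\<close> by simp
      also have "\<dots> \<le> 2 * M / N" using \<open>N > 0\<close> \<open>N \<le> m\<close> by (intro divide_left_mono) auto
      also have "\<dots> < e" using N e \<open>N > 0\<close> by (simp add: field_simps)
      finally show ?thesis .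
    qed (use e in simp)
  qed
qed

lemma harmonic_tail_bound:
  assumes "N > 0"
  shows "\<bar>L1 - (\<Sum>k<N. \<chi> k / k)\<bar> \<le> 2 * M / N"
proof -
  have "(\<lambda>n. \<Sum>k<n. \<chi> k / k) \<longlonglongrightarrow> L1"
    unfolding L1_def using summable_LIMSEQ[OF summable_harmonic] .
  then have "(\<lambda>n. \<bar>(\<Sum>k<n. \<chi> k / k) - (\<Sum>k<N. \<chi> k / k)\<bar>) \<longlonglongrightarrow> \<bar>L1 - (\<Sum>k<N. \<chi> k / k)\<bar>"
    by (intro tendsto_intros)
  moreover have "\<bar>(\<Sum>k<n. \<chi> k / k) - (\<Sum>k<N. \<chi> k / k)\<bar> \<le> 2 * M / N" if "n \<ge> N" for n
    using harmonic_block_bound[OF assms that] sum_diff_nat_ivl[of 0 N n "\<lambda>k. \<chi> k / k"] that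
    by (simp add: atLeast0LessThan)
  ultimately show ?thesis
    by (intro Lim_bounded[where M = N]) auto
qed

end

section \<open>Monotone Lambert coefficients and divisor sums of a real character\<close>

lemma geometric_sum_lower:
  fixes y :: real
  assumes "0 < y" "y \<le> 1"
  shows "real n * y ^ n \<le> y * (\<Sum>i<n. (y\<^sup>2) ^ i)"
proof (induction n rule: induct_nat_012)
  case (ge2 n)
  have "(\<Sum>i<Suc (Suc n). (y\<^sup>2) ^ i) = 1 + (\<Sum>i<Suc n. (y\<^sup>2) ^ Suc i)"
    by (simp only: sum.lessThan_Suc_shift) simp
  also have "(\<Sum>i<Suc n. (y\<^sup>2) ^ Suc i) = y\<^sup>2 * (\<Sum>i<n. (y\<^sup>2) ^ i) + (y\<^sup>2) ^ Suc n"
    by (simp add: sum_distrib_left)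
  finally have eq: "y * (\<Sum>i<Suc (Suc n). (y\<^sup>2) ^ i)
      = y\<^sup>2 * (y * (\<Sum>i<n. (y\<^sup>2) ^ i)) + y * (1 + (y\<^sup>2) ^ Suc n)"
    by (simp add: algebra_simps)
  \<comment> \<open>The claim is the inequality of arithmetic and geometric means for the odd powers
    of \<open>y\<close>, whose exponents average to \<open>n\<close>. The induction by two steps
    pairs the first term with the last.\<close>
  have "0 \<le> y * (1 - y ^ Suc n)\<^sup>2" using assms by simp
  then have "2 * y ^ Suc (Suc n) \<le> y * (1 + (y\<^sup>2) ^ Suc n)"
    by (simp add: power2_eq_square algebra_simps power_mult_distrib)
  moreover have "y\<^sup>2 * (n * y ^ n) \<le> y\<^sup>2 * (y * (\<Sum>i<n. (y\<^sup>2) ^ i))"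
    using ge2(1) by (intro mult_left_mono) auto
  ultimately show ?case unfolding eq by (simp add: power2_eq_square algebra_simps)
qed auto

text \<open>\<open>b n\<close> is the polar part of the Lambert term minus the term itself. With 1 -
  x^n = (1 - x) A n, monotonicity becomes n (n + 1) x^n <= A n * A (n + 1), which is the product of
  two instances of \<open>geometric_sum_lower\<close> at y = sqrt x.\<close>

lemma lambert_coeff_antimono:
  fixes x :: real
  assumes x: "0 < x" "x < 1" and n: "n > 0"
  defines "b \<equiv> \<lambda>n. 1 / (n * (1 - x)) - x ^ n / (1 - x ^ n)"
  shows "b (Suc n) \<le> b n" "b n \<ge> 0"
proof -
  define A where "A n = (\<Sum>i<n. x ^ i)" for n
  define y where "y = sqrt x"
  have y: "0 < y" "y \<le> 1" "y\<^sup>2 = x" using x by (auto simp: y_def)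
  have A: "1 - x ^ n = (1 - x) * A n" for n
    using one_diff_power_eq[of x n] by (simp add: A_def)
  have Apos: "A n > 0" if "n > 0" for n
    using x that by (auto simp: A_def intro!: sum_pos)
  have "real n * y ^ n * (real (Suc n) * y ^ Suc n) \<le> (y * A n) * (y * A (Suc n))"
  proof (rule mult_mono)
    show "real n * y ^ n \<le> y * A n" "real (Suc n) * y ^ Suc n \<le> y * A (Suc n)"
      using geometric_sum_lower[OF y(1,2)] y(3) unfolding A_def by metis+
    show "0 \<le> y * A n" using y(1) Apos[OF n] by simp
    show "0 \<le> real (Suc n) * y ^ Suc n" using y(1) by simp
  qed
  then have "real n * real (Suc n) * (y ^ n * y ^ n) * y \<le> y * (y * (A n * A (Suc n)))"
    by (simp add: algebra_simps)
  then have "real n * real (Suc n) * (y ^ n * y ^ n) \<le> y * (A n * A (Suc n))"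
    using y(1) by (simp add: mult.commute)
  also have "\<dots> \<le> 1 * (A n * A (Suc n))"
    using y Apos[OF n] Apos[of "Suc n"] by (intro mult_right_mono) auto
  also have "y ^ n * y ^ n = x ^ n"
    by (simp add: y(3)[symmetric] power2_eq_square power_mult_distrib)
  finally have key: "x ^ n * (real n * real (Suc n)) \<le> A n * A (Suc n)" by (simp add: mult_ac)
  have ASuc: "A (Suc n) = 1 + x * A n"
    unfolding A_def by (simp only: sum.lessThan_Suc_shift sum_distrib_left) simp
  have "x ^ n / A n - x ^ Suc n / A (Suc n) = x ^ n * (A (Suc n) - x * A n) / (A n * A (Suc n))"
    using Apos[OF n] Apos[of "Suc n"] by (simp add: field_simps)
  also have "\<dots> = x ^ n / (A n * A (Suc n))" by (simp add: ASuc)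
  also have "\<dots> \<le> 1 / (real n * real (Suc n))"
  proof -
    have "0 < A n * A (Suc n)" "0 < real n * real (Suc n)" using n Apos[OF n] Apos[of "Suc n"] by simp_all
    then show ?thesis using key by (simp add: divide_le_eq pos_le_divide_eq mult.commute)
  qed
  also have "\<dots> = 1 / n - 1 / Suc n"
    using n by (simp add: field_simps)
  finally have "1 / Suc n - x ^ Suc n / A (Suc n) \<le> 1 / n - x ^ n / A n" by simp
  moreover have beq: "b n = (1 / n - x ^ n / A n) / (1 - x)" for n
    by (simp add: b_def A diff_divide_distrib mult.commute)
  ultimately show "b (Suc n) \<le> b n" using x by (simp add: beq divide_right_mono)
  have "n * x ^ n = (\<Sum>i<n. x ^ n)" by simp
  also have "\<dots> \<le> A n"
    unfolding A_def using x by (intro sum_mono power_decreasing) auto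
  finally have "x ^ n / A n \<le> 1 / n" using n Apos[OF n] by (simp add: field_simps)
  then show "b n \<ge> 0" using x by (simp add: beq)
qed

lemma sum_divisors_coprime_mult:
  fixes f :: "nat \<Rightarrow> 'a :: comm_semiring_1"
  assumes "coprime a b" and f: "\<And>d e. f (d * e) = f d * f e"
  shows "(\<Sum>d | d dvd a * b. f d) = (\<Sum>d | d dvd a. f d) * (\<Sum>d | d dvd b. f d)"
proof -
  have eq: "(\<Sum>d | d dvd a. f d) * (\<Sum>d | d dvd b. f d) = (\<Sum>(d,e)\<in>{d. d dvd a} \<times> {e. e dvd b}. f (d * e))"
    by (simp add: sum_product sum.cartesian_product f)
  have split: "gcd (d * e) a = d \<and> gcd (d * e) b = e" if "d dvd a" "e dvd b" for d e
  proof -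
    have "coprime b d" "coprime a e"
      using coprime_divisors[OF that(1) dvd_refl assms(1)] coprime_divisors[OF dvd_refl that(2) assms(1)]
      by (simp_all add: coprime_commute)
    then show ?thesis
      using that by (simp add: gcd_mult_left_right_cancel gcd_mult_left_left_cancel)
  qed
  note eq
  also have "(\<Sum>(d,e)\<in>{d. d dvd a} \<times> {e. e dvd b}. f (d * e)) = (\<Sum>d | d dvd a * b. f d)"
  proof (rule sum.reindex_bij_witness[where j = "\<lambda>(d,e). d * e" and i = "\<lambda>d. (gcd d a, gcd d b)"])
    fix x assume "x \<in> {d. d dvd a} \<times> {e. e dvd b}"
    then obtain d e where x: "x = (d, e)" "d dvd a" "e dvd b" by auto
    then show "(gcd (case x of (d, e) \<Rightarrow> d * e) a, gcd (case x of (d, e) \<Rightarrow> d * e) b) = x"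
      "(case x of (d, e) \<Rightarrow> d * e) \<in> {d. d dvd a * b}"
      "f (case x of (d, e) \<Rightarrow> d * e) = (case x of (d, e) \<Rightarrow> f (d * e))"
      using split by (auto intro: mult_dvd_mono)
  next
    fix d assume d: "d \<in> {d. d dvd a * b}"
    then obtain d1 d2 where "d = d1 * d2" "d1 dvd a" "d2 dvd b"
      using division_decomp[of d a b] by auto
    then show "(case (gcd d a, gcd d b) of (d, e) \<Rightarrow> d * e) = d"
      using split[of d1 d2] by simp
  qed auto
  finally show ?thesis ..
qed

context real_character
begin

lemma chi_power: "\<chi> (n ^ k) = \<chi> n ^ k"
  by (induction k) (simp_all add: chi_mult)

text \<open>The sum is 1, k + 1 or an alternating sum of 1 and -1, according to the value 0, 1 or -1
  of \<open>\<chi> p\<close>.\<close>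

lemma divisor_sum_prime_power:
  assumes "prime p"
  shows "0 \<le> (\<Sum>d | d dvd p ^ k. \<chi> d)" and "even k \<Longrightarrow> 1 \<le> (\<Sum>d | d dvd p ^ k. \<chi> d)"
proof -
  have p: "p > 1" using assms prime_gt_1_nat by blast
  have "{d. d dvd p ^ k} = (\<lambda>i. p ^ i) ` {..k}"
    using assms divides_primepow_nat by auto
  moreover have "inj_on (\<lambda>i. p ^ i) {..k}" using p by (auto simp: inj_on_def)
  ultimately have eq: "(\<Sum>d | d dvd p ^ k. \<chi> d) = (\<Sum>i\<le>k. \<chi> p ^ i)"
    by (simp add: sum.reindex chi_power)
  have m1: "(\<Sum>i\<le>k. (-1 :: real) ^ i) = (if even k then 1 else 0)"
    by (induction k) auto
  have z: "(\<Sum>i\<le>k. (0 :: real) ^ i) = 1"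
    by (induction k) auto
  show "0 \<le> (\<Sum>d | d dvd p ^ k. \<chi> d)" "even k \<Longrightarrow> 1 \<le> (\<Sum>d | d dvd p ^ k. \<chi> d)"
    unfolding eq using range[of p] m1 z by auto
qed

text \<open>These sums are the coefficients of zeta(s) L(s, \<chi>). By multiplicativity prime
  powers suffice, and a square has only even exponents.\<close>

lemma divisor_sum_nonneg_square:
  assumes "n > 0"
  shows "0 \<le> (\<Sum>d | d dvd n. \<chi> d) \<and> ((\<exists>m. n = m\<^sup>2) \<longrightarrow> 1 \<le> (\<Sum>d | d dvd n. \<chi> d))"
  using assms
proof (induction n rule: less_induct)
  case (less n)
  show ?case
  proof (cases "n = 1")
    case False
    then obtain p where p: "prime p" "p dvd n" using prime_factor_nat by blast
    have "n \<noteq> 0" "\<not> is_unit p" using less.prems p(1) not_prime_unit by auto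
    then obtain k m where km: "n = p ^ k * m" "\<not> p dvd m"
      using multiplicity_decompose' by metis
    have "k > 0" using km p(2) by (cases k) auto
    then have m: "0 < m" "m < n"
      using km less.prems p(1) one_less_power[OF prime_gt_1_nat[OF p(1)], of k] by auto
    have cop: "coprime (p ^ k) m" using p(1) km(2) prime_imp_coprime by auto
    have f: "(\<Sum>d | d dvd n. \<chi> d) = (\<Sum>d | d dvd p ^ k. \<chi> d) * (\<Sum>d | d dvd m. \<chi> d)"
      unfolding km(1) by (rule sum_divisors_coprime_mult[OF cop chi_mult])
    have "1 \<le> (\<Sum>d | d dvd n. \<chi> d)" if sq: "n = a\<^sup>2" for a
    proof -
      have "is_nth_power 2 (p ^ k * m)" using sq km(1) by (auto simp: is_nth_power_def)
      then have "is_nth_power 2 (p ^ k)" "is_nth_power 2 m"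
        using is_nth_power_mult_coprime_natD[OF cop] less.prems km(1) by auto
      then have "even k" "\<exists>b. m = b\<^sup>2"
        using is_nth_power_prime_power_nat_iff[OF p(1), of 2 k] by (auto simp: is_nth_power_def)
      then have "1 * 1 \<le> (\<Sum>d | d dvd p ^ k. \<chi> d) * (\<Sum>d | d dvd m. \<chi> d)"
        using less.IH[OF m(2,1)] divisor_sum_prime_power[OF p(1), of k] by (intro mult_mono) auto
      then show ?thesis by (simp add: f)
    qed
    moreover have "0 \<le> (\<Sum>d | d dvd n. \<chi> d)"
      using less.IH[OF m(2,1)] divisor_sum_prime_power(1)[OF p(1)] by (simp add: f)
    ultimately show ?thesis by blast
  qed simp
qed

end

context nonprincipal_character
begin

text \<open>
  Monsky's argument. If \<open>L1\<close> vanished, then the Lambert series of \<open>\<chi>\<close> would stay bounded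
  near \<open>1\<close>, while its coefficients are nonnegative and at least \<open>1\<close> on the squares. Everything
  is done with partial sums up to \<open>N\<close>, with \<open>N \<longlongrightarrow> \<infinity>\<close> before \<open>x \<longlongrightarrow> 1\<close>.
\<close>

lemma lambert_partial_bound:
  fixes x :: real
  assumes x: "0 < x" "x < 1" and L: "L1 = 0" and N: "N > 0"
  shows "(\<Sum>n=1..N. (\<Sum>d | d dvd n. \<chi> d) * x ^ n)
     \<le> 2 * M + 2 * M / (Suc N * (1 - x)) + N * x ^ N / (1 - x)"
proof -
  define b where "b n = 1 / (real n * (1 - x)) - x ^ n / (1 - x ^ n)" for n
  have b: "b (Suc k) \<le> b k" "0 \<le> b k" if "0 < k" for k
    using lambert_coeff_antimono[OF x that] by (simp_all only: b_def)
  have "(\<Sum>n=1..N. (\<Sum>d | d dvd n. \<chi> d) * x ^ n) = (\<Sum>n=1..N. \<Sum>d | d dvd n. \<chi> d * x ^ (d * (n div d)))"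
    by (intro sum.cong) (simp_all add: sum_distrib_right)
  also have "\<dots> = (\<Sum>d=1..N. \<Sum>m=1..N div d. \<chi> d * x ^ (d * m))"
    by (rule sum_divisors_swap)
  \<comment> \<open>Completing each geometric series costs at most x^N / (1 - x), because d (N div d
    + 1) >= N.\<close>
  also have "\<dots> \<le> (\<Sum>d=1..N. \<chi> d * (x ^ d / (1 - x ^ d)) + x ^ N / (1 - x))"
  proof (rule sum_mono)
    fix d assume d: "d \<in> {1..N}"
    define K where "K = N div d"
    have xd: "0 < x ^ d" "x ^ d < 1" "x ^ d \<le> x"
      using x d power_decreasing[of 1 d x] by (auto simp: power_less_one_iff)
    have "(\<Sum>m=1..K. z ^ m) = (z - z ^ Suc K) / (1 - z)" if "z < 1" for z :: real
    proof (induction K)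
      case (Suc K)
      have "(\<Sum>m=1..Suc K. z ^ m) = (z - z ^ Suc K) / (1 - z) + z ^ Suc K" using Suc by simp
      also have "\<dots> = (z - z ^ Suc (Suc K)) / (1 - z)" using that by (simp add: field_simps)
      finally show ?case .
    qed simp
    from this[OF xd(2)] have eq: "(\<Sum>m=1..K. \<chi> d * x ^ (d * m))
       = \<chi> d * (x ^ d / (1 - x ^ d)) - \<chi> d * ((x ^ d) ^ Suc K / (1 - x ^ d))"
      by (simp add: sum_distrib_left[symmetric] diff_divide_distrib right_diff_distrib power_mult)
    have "N \<le> d * Suc K"
      using d dividend_less_times_div[of d N] by (simp add: K_def)
    then have "(x ^ d) ^ Suc K \<le> x ^ N"
      using x unfolding power_mult[symmetric] by (intro power_decreasing) auto
    then have "(x ^ d) ^ Suc K / (1 - x ^ d) \<le> x ^ N / (1 - x)"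
      using x xd by (intro frac_le) auto
    moreover have "- \<chi> d * ((x ^ d) ^ Suc K / (1 - x ^ d)) \<le> 1 * ((x ^ d) ^ Suc K / (1 - x ^ d))"
      using abs_le_1[of d] xd by (intro mult_right_mono) auto
    ultimately show "(\<Sum>m=1..N div d. \<chi> d * x ^ (d * m)) \<le> \<chi> d * (x ^ d / (1 - x ^ d)) + x ^ N / (1 - x)"
      using eq unfolding K_def by simp
  qed
  also have "\<dots> = (\<Sum>d=1..N. \<chi> d * (x ^ d / (1 - x ^ d))) + N * x ^ N / (1 - x)"
    by (simp add: sum.distrib)
  \<comment> \<open>Splitting off the polar part: its sum is a partial sum of the series for
    \<open>L1 = 0\<close>, hence small, and the rest has the decreasing coefficients
    \<open>b\<close> with \<open>b 1 = 1\<close>.\<close>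
  also have "(\<Sum>d=1..N. \<chi> d * (x ^ d / (1 - x ^ d)))
      = (\<Sum>d=1..N. \<chi> d / d) / (1 - x) - (\<Sum>d=1..N. \<chi> d * b d)"
    by (simp add: b_def sum_subtractf sum_divide_distrib right_diff_distrib)
  also have "\<dots> \<le> 2 * M / (Suc N * (1 - x)) + 2 * M"
  proof -
    have "(\<Sum>d=1..N. \<chi> d / d) = (\<Sum>d<Suc N. \<chi> d / d)"
      by (rule sum.mono_neutral_left) auto
    then have "\<bar>\<Sum>d=1..N. \<chi> d / d\<bar> \<le> 2 * M / Suc N"
      using harmonic_tail_bound[of "Suc N"] L by simp
    then have "(\<Sum>d=1..N. \<chi> d / d) / (1 - x) \<le> 2 * M / Suc N / (1 - x)"
      using x by (intro divide_right_mono) auto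
    moreover have "\<bar>\<Sum>d=1..<Suc N. \<chi> d * b d\<bar> \<le> 2 * M * b 1"
      by (rule weighted_sum_bound) (auto intro: b)
    moreover have "b 1 = 1" using x by (simp add: b_def field_simps)
    ultimately show ?thesis by (simp add: atLeastLessThanSuc_atLeastAtMost)
  qed
  finally show ?thesis by simp
qed

lemma L1_nonzero: "L1 \<noteq> 0"
proof
  assume L: "L1 = 0"
  \<comment> \<open>One square more than the bound 2 M permits once x tends to 1.\<close>
  define K where "K = Suc (2 * M)"
  have bound: "(\<Sum>k=1..K. x ^ (k\<^sup>2)) \<le> 2 * M" if x: "0 < x" "x < 1" for x :: real
  proof (rule tendsto_lowerbound)
    have "(\<lambda>N. real N * x ^ N) \<longlonglongrightarrow> 0" using powser_times_n_limit_0[of x] x by simp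
    then have "(\<lambda>N. real (2 * M) + 2 * M / (1 - x) * inverse (real (Suc N)) + (N * x ^ N) / (1 - x))
       \<longlonglongrightarrow> real (2 * M) + 2 * M / (1 - x) * 0 + 0 / (1 - x)"
      using x by (intro tendsto_intros LIMSEQ_inverse_real_of_nat) auto
    then show "(\<lambda>N. real (2 * M) + 2 * M / (Suc N * (1 - x)) + N * x ^ N / (1 - x)) \<longlonglongrightarrow> 2 * M"
      by (simp add: field_simps)
    show "\<forall>\<^sub>F N in sequentially. (\<Sum>k=1..K. x ^ (k\<^sup>2))
        \<le> real (2 * M) + 2 * M / (Suc N * (1 - x)) + N * x ^ N / (1 - x)"
    proof (rule eventually_sequentiallyI[of "K\<^sup>2"])
      fix N assume N: "K\<^sup>2 \<le> N"
      have "K\<^sup>2 > 0" by (simp add: K_def)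
      with N have "N > 0" by linarith
      have sub: "(\<lambda>k. k\<^sup>2) ` {1..K} \<subseteq> {1..N}"
      proof (rule image_subsetI)
        fix k assume k: "k \<in> {1..K}"
        then have "k\<^sup>2 \<le> K\<^sup>2" by (intro power_mono) auto
        then have "k\<^sup>2 \<le> N" using N by linarith
        then show "k\<^sup>2 \<in> {1..N}" using N k by (simp add: Suc_le_eq)
      qed
      have nn: "0 \<le> (\<Sum>d | d dvd n. \<chi> d)" if "n \<ge> 1" for n
        using divisor_sum_nonneg_square[of n] that by auto
      have "(\<Sum>k=1..K. x ^ (k\<^sup>2)) = (\<Sum>n\<in>(\<lambda>k. k\<^sup>2) ` {1..K}. x ^ n)"
        by (simp add: sum.reindex inj_on_def)
      also have "\<dots> \<le> (\<Sum>n\<in>(\<lambda>k. k\<^sup>2) ` {1..K}. (\<Sum>d | d dvd n. \<chi> d) * x ^ n)"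
      proof (rule sum_mono)
        fix n assume n: "n \<in> (\<lambda>k. k\<^sup>2) ` {1..K}"
        then have "1 \<le> (\<Sum>d | d dvd n. \<chi> d)"
          using divisor_sum_nonneg_square[of n] by force
        then have "1 * x ^ n \<le> (\<Sum>d | d dvd n. \<chi> d) * x ^ n"
          using x by (intro mult_right_mono) auto
        then show "x ^ n \<le> (\<Sum>d | d dvd n. \<chi> d) * x ^ n" by simp
      qed
      also have "\<dots> \<le> (\<Sum>n=1..N. (\<Sum>d | d dvd n. \<chi> d) * x ^ n)"
        by (rule sum_mono2[OF _ sub]) (use nn x in \<open>auto intro!: mult_nonneg_nonneg\<close>)
      also have "\<dots> \<le> real (2 * M) + 2 * M / (Suc N * (1 - x)) + N * x ^ N / (1 - x)"
        using lambert_partial_bound[OF x L \<open>N > 0\<close>] by simp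
      finally show "(\<Sum>k=1..K. x ^ (k\<^sup>2))
        \<le> real (2 * M) + 2 * M / (Suc N * (1 - x)) + N * x ^ N / (1 - x)" .
    qed
  qed simp
  have "(\<Sum>k=1..K. (1 :: real) ^ (k\<^sup>2)) \<le> 2 * M"
  proof (rule tendsto_upperbound)
    show "((\<lambda>x :: real. \<Sum>k=1..K. x ^ (k\<^sup>2)) \<longlongrightarrow> (\<Sum>k=1..K. 1 ^ (k\<^sup>2))) (at_left 1)"
      by (intro tendsto_intros)
    show "\<forall>\<^sub>F x :: real in at_left 1. (\<Sum>k=1..K. x ^ (k\<^sup>2)) \<le> 2 * M"
      using eventually_at_left_real[of 0 1] by (rule eventually_mono) (use bound in auto)
  qed auto
  then show False by (simp add: K_def)
qed

end

section \<open>Primes with prescribed values of real characters\<close>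

lemma ln_Suc_diff_le:
  assumes "n > 0" shows "ln (real (Suc n)) - ln n \<le> 1 / n"
proof -
  have "real (Suc n) / real n = 1 + 1 / real n" using assms by (simp add: field_simps)
  then have "ln (real (Suc n)) - ln n = ln (1 + 1 / real n)"
    using ln_div[of "real (Suc n)" "real n"] assms by simp
  also have "\<dots> \<le> 1 / n" by (intro ln_add_one_self_le_self) simp
  finally show ?thesis .
qed

lemma ln_fact_eq: "ln (fact N :: real) = (\<Sum>d=1..N. mangoldt d * real (N div d))"
proof -
  have "ln (fact N :: real) = (\<Sum>n=1..N. ln (real n))"
    unfolding fact_prod of_nat_prod by (subst ln_prod) auto
  also have "\<dots> = (\<Sum>n=1..N. \<Sum>d | d dvd n. mangoldt d)"
    by (intro sum.cong) (simp_all add: mangoldt_sum)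
  also have "\<dots> = (\<Sum>d=1..N. \<Sum>m=1..N div d. mangoldt d)"
    by (rule sum_divisors_swap)
  finally show ?thesis by (simp add: mult.commute)
qed

text \<open>Chebyshev's argument: in ln (2 n choose n) every d gets the nonnegative coefficient 2 n
  div d - 2 (n div d), which is 1 for n < d <= 2 n, and the binomial coefficient is at most
  4^n.\<close>

lemma mangoldt_sum_doubling: "(\<Sum>d=1..2*n. mangoldt d) - (\<Sum>d=1..n. mangoldt d) \<le> 2 * real n"
proof -
  have "(\<Sum>d=1..2*n. mangoldt d) - (\<Sum>d=1..n. mangoldt d) = (\<Sum>d=1..2*n. if n < d then mangoldt d else (0::real))"
  proof -
    have "(\<Sum>d=1..2*n. mangoldt d) = (\<Sum>d=1..2*n. if n < d then mangoldt d else (0::real)) + (\<Sum>d=1..2*n. if d \<le> n then mangoldt d else 0)"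
      unfolding sum.distrib[symmetric] by (intro sum.cong) auto
    also have "(\<Sum>d=1..2*n. if d \<le> n then mangoldt d else (0::real)) = (\<Sum>d=1..n. mangoldt d)"
      by (intro sum.mono_neutral_cong_right) auto
    finally show ?thesis by simp
  qed
  also have "\<dots> \<le> (\<Sum>d=1..2*n. mangoldt d * (real (2 * n div d) - 2 * real (n div d)))"
  proof (rule sum_mono)
    fix d assume d: "d \<in> {1..2*n}"
    have "2 * (n div d) \<le> 2 * n div d"
      using d by (simp add: less_eq_div_iff_mult_less_eq mult.assoc)
    then have 1: "0 \<le> real (2 * n div d) - 2 * real (n div d)"
      using of_nat_mono[where 'a = real] by fastforce
    have "1 \<le> real (2 * n div d) - 2 * real (n div d)" if "n < d"
      using that d by (simp add: Suc_le_eq div_greater_zero_iff)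
    with 1 show "(if n < d then mangoldt d else (0::real)) \<le> mangoldt d * (real (2 * n div d) - 2 * real (n div d))"
      using mangoldt_nonneg[of d] mult_left_mono[of 1 "real (2 * n div d) - 2 * real (n div d)" "mangoldt d"]
      by auto
  qed
  also have "\<dots> = (\<Sum>d=1..2*n. mangoldt d * real (2 * n div d)) - 2 * (\<Sum>d=1..2*n. mangoldt d * real (n div d))"
    by (simp add: right_diff_distrib sum_subtractf sum_distrib_left mult_ac)
  also have "(\<Sum>d=1..2*n. mangoldt d * real (n div d)) = (\<Sum>d=1..n. mangoldt d * real (n div d))"
    by (intro sum.mono_neutral_right) auto
  also have "(\<Sum>d=1..2*n. mangoldt d * real (2 * n div d)) - 2 * (\<Sum>d=1..n. mangoldt d * real (n div d))
      = ln (fact (2 * n)) - 2 * ln (fact n)"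
    by (simp only: ln_fact_eq)
  also have "\<dots> = ln (real ((2 * n) choose n))"
    by (simp add: binomial_fact ln_div ln_mult)
  also have "\<dots> \<le> ln (2 ^ (2 * n))"
    using binomial_le_pow2[of "2*n" n] by (subst ln_le_cancel_iff) (auto simp: zero_less_binomial_iff simp flip: of_nat_power of_nat_le_iff)
  also have "\<dots> = 2 * real n * ln 2" by (simp add: ln_realpow)
  also have "\<dots> \<le> 2 * real n * 1"
    using ln_add_one_self_le_self2[of 1] by (intro mult_left_mono) auto
  finally show ?thesis by simp
qed

lemma chebyshev_bound: "(\<Sum>d=1..n. mangoldt d) \<le> 6 * real n"
proof (induction n rule: less_induct)
  case (less n)
  show ?case
  proof (cases "n < 2")
    case True
    then consider "n = 0" | "n = 1" by linarith
    then show ?thesis by cases auto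
  next
    case False
    define m where "m = (n + 1) div 2"
    have m: "m < n" "n \<le> 2 * m" "2 * m \<le> n + 1" using False by (auto simp: m_def)
    have "(\<Sum>d=1..n. mangoldt d) \<le> (\<Sum>d=1..2*m. mangoldt d :: real)"
      using m(2) by (intro sum_mono2) (auto simp: mangoldt_nonneg)
    also have "\<dots> \<le> 6 * real m + 2 * real m"
      using mangoldt_sum_doubling[of m] less.IH[OF m(1)] by simp
    \<comment> \<open>8 m <= 4 (n + 1) <= 6 n holds for n >= 2; rounding the half up is what raises
      the constant.\<close>
    also have "\<dots> \<le> 6 * real n" using m(3) False by simp
    finally show ?thesis .
  qed
qed

text \<open>The weak Stirling bound for ln N!, compared with its expansion after dropping the
  rounding in \<open>N div d\<close>.\<close>

lemma mangoldt_harmonic_lower: 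
  assumes "N > 0" shows "ln N - 1 \<le> (\<Sum>d=1..N. mangoldt d / d)"
proof -
  have "N * ln N - N \<le> ln (fact N :: real)" if "N > 0" for N
    using that
  proof (induction N rule: nat_induct_non_zero)
    case (Suc n)
    have "n * (ln (real (Suc n)) - ln n) \<le> 1"
      using ln_Suc_diff_le[OF Suc.hyps(1)] Suc.hyps by (simp add: pos_le_divide_eq mult.commute)
    moreover have "ln (fact (Suc n) :: real) = ln (real (Suc n)) + ln (fact n)"
      unfolding fact_Suc by (subst ln_mult) auto
    ultimately show ?case using Suc.IH by (simp add: algebra_simps)
  qed simp
  from this[OF assms] have "N * (ln N - 1) \<le> (\<Sum>d=1..N. mangoldt d * real (N div d))"
    by (simp add: ln_fact_eq algebra_simps)
  also have "\<dots> \<le> (\<Sum>d=1..N. N * (mangoldt d / d))"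
  proof (rule sum_mono)
    fix d assume "d \<in> {1..N}"
    have "mangoldt d * real (N div d) \<le> mangoldt d * (N / d)"
      by (intro mult_left_mono of_nat_div_le_of_nat mangoldt_nonneg)
    then show "mangoldt d * real (N div d) \<le> N * (mangoldt d / d)" by (simp add: mult.commute)
  qed
  also have "\<dots> = N * (\<Sum>d=1..N. mangoldt d / d)" by (simp add: sum_distrib_left)
  finally show ?thesis using assms by simp
qed

lemma sum_ln_over_square_bound: "(\<Sum>n=2..N. ln (real n) / (real n * (real n - 1))) \<le> (2 :: real)"
proof (cases "N \<ge> 1")
  case True
  \<comment> \<open>A telescoping majorant modelled on the antiderivative -(1 + ln x) / x of ln x /
    x^2. The constant 2 matches (n + 1) / n <= 2.\<close>
  define g where "g n = (2 + ln (real n)) / n" for n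
  have "(\<Sum>n=2..N. ln (real n) / (real n * (real n - 1))) \<le> g 1 - g N"
    using True
  proof (induction N rule: nat_induct_at_least)
    case (Suc n)
    have n: "real n > 0" using Suc.hyps by simp
    have "Suc n * (ln (real (Suc n)) - ln n) \<le> Suc n * (1 / n)"
      using ln_Suc_diff_le[of n] Suc.hyps by (intro mult_left_mono) auto
    also have "\<dots> \<le> 2" using Suc.hyps by (simp add: field_simps)
    finally have "ln (real (Suc n)) \<le> Suc n * (2 + ln n) - n * (2 + ln (real (Suc n)))"
      by (simp add: algebra_simps)
    then have "ln (real (Suc n)) / (Suc n * n) \<le> (Suc n * (2 + ln n) - n * (2 + ln (real (Suc n)))) / (Suc n * n)"
      using n by (intro divide_right_mono) auto
    also have "\<dots> = g n - g (Suc n)"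
    proof -
      have "(x * a - y * b) / (x * y) = a / y - b / x" if "x \<noteq> 0" "y \<noteq> 0" for x y a b :: real
        using that by (simp add: diff_divide_distrib)
      note this[of "real (Suc n)" "real n"]
      then show ?thesis unfolding g_def of_nat_mult using n by (simp del: of_nat_Suc)
    qed
    finally show ?case using Suc by (simp add: distrib_right)
  qed simp
  also have "0 \<le> g N"
    unfolding g_def using True by (intro divide_nonneg_nonneg add_nonneg_nonneg ln_ge_zero) auto
  then have "g 1 - g N \<le> 2" by (simp add: g_def)
  finally show ?thesis .
qed simp

text \<open>The powers p^k with k >= 2 contribute at most ln p / (p (p - 1)) for each prime p. Hence
  von Mangoldt sums may be exchanged for sums over primes at bounded cost.\<close>

lemma nonprime_mangoldt_bound:
  "(\<Sum>d | d \<in> {1..N} \<and> \<not> prime d. mangoldt d / d) \<le> (2 :: real)"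
proof -
  let ?A = "{p \<in> {2..N}. prime p}"
  let ?I = "SIGMA p:?A. {2..N}"
  let ?h = "\<lambda>(p,k). p ^ k :: nat"
  have geom: "(\<Sum>k=2..N. z ^ k) \<le> z\<^sup>2 / (1 - z)" if "0 < z" "z < 1" for z :: real
  proof (cases "N \<ge> 1")
    case True
    then have "(\<Sum>k=2..N. z ^ k) = (z\<^sup>2 - z ^ Suc N) / (1 - z)"
    proof (induction N rule: nat_induct_at_least)
      case (Suc N)
      have "(\<Sum>k=2..Suc N. z ^ k) = (z\<^sup>2 - z ^ Suc N) / (1 - z) + z ^ Suc N" using Suc by simp
      also have "\<dots> = (z\<^sup>2 - z ^ Suc (Suc N)) / (1 - z)" using that by (simp add: field_simps)
      finally show ?case .
    qed (simp add: power2_eq_square)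
    also have "\<dots> \<le> z\<^sup>2 / (1 - z)" using that by (intro divide_right_mono) auto
    finally show ?thesis .
  qed (use that in simp)
  have "(\<Sum>d | d \<in> {1..N} \<and> \<not> prime d. mangoldt d / d)
      = (\<Sum>d | d \<in> {1..N} \<and> \<not> prime d \<and> primepow d. mangoldt d / d :: real)"
    by (intro sum.mono_neutral_right) (auto simp: mangoldt_def)
  also have "\<dots> \<le> (\<Sum>d\<in>?h ` ?I. mangoldt d / d)"
  proof (rule sum_mono2)
    show "{d. d \<in> {1..N} \<and> \<not> prime d \<and> primepow d} \<subseteq> ?h ` ?I"
    proof
      fix d assume "d \<in> {d. d \<in> {1..N} \<and> \<not> prime d \<and> primepow d}"
      then obtain p k where d: "d = p ^ k" "prime p" "k > 0" "p ^ k \<le> N" "\<not> prime (p ^ k)"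
        by (auto simp: primepow_def)
      from d have "k \<noteq> 1" by auto
      with d have k: "k \<ge> 2" by simp
      have p: "p \<ge> 2" using d(2) prime_ge_2_nat by blast
      have "k < p ^ k" using p by (intro power_gt_expt) auto
      moreover have "p \<le> p ^ k" using p d(3) self_le_power[of p k] by simp
      ultimately have "(p, k) \<in> ?I" using d p k by auto
      then show "d \<in> ?h ` ?I" using d(1) by (intro image_eqI[of _ _ "(p, k)"]) auto
    qed
  qed (auto simp: mangoldt_nonneg)
  also have "\<dots> \<le> (\<Sum>x\<in>?I. mangoldt (?h x) / (?h x))"
    by (rule order_trans[OF sum_image_le]) (auto simp: mangoldt_nonneg o_def)
  also have "\<dots> = (\<Sum>p\<in>?A. \<Sum>k=2..N. ln (real p) * (1 / p) ^ k)"
    by (subst sum.cartesian_product) (auto intro!: sum.cong simp: power_one_over)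
  also have "\<dots> \<le> (\<Sum>p\<in>?A. ln (real p) / (real p * (real p - 1)))"
  proof (rule sum_mono)
    fix p assume p: "p \<in> ?A"
    have "(\<Sum>k=2..N. ln (real p) * (1 / p) ^ k) = ln p * (\<Sum>k=2..N. (1 / p) ^ k)"
      by (simp add: sum_distrib_left)
    also have "\<dots> \<le> ln p * ((1 / p)\<^sup>2 / (1 - 1 / p))"
      using p by (intro mult_left_mono geom) auto
    also have "\<dots> = ln (real p) / (real p * (real p - 1))"
      using p by (simp add: power2_eq_square field_simps)
    finally show "(\<Sum>k=2..N. ln (real p) * (1 / p) ^ k) \<le> ln (real p) / (real p * (real p - 1))" .
  qed
  also have "\<dots> \<le> (\<Sum>p=2..N. ln (real p) / (real p * (real p - 1)))"
    by (intro sum_mono2) auto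
  also have "\<dots> \<le> 2" by (rule sum_ln_over_square_bound)
  finally show ?thesis .
qed

lemma bounded_mangoldt_imp_bounded_primes:
  fixes f :: "nat \<Rightarrow> real"
  assumes "\<And>n. \<bar>f n\<bar> \<le> 1"
  shows "\<bar>(\<Sum>d=1..N. f d * mangoldt d / d) - (\<Sum>p | p \<in> {1..N} \<and> prime p. f p * ln p / p)\<bar> \<le> 2"
proof -
  have "(\<Sum>d=1..N. f d * mangoldt d / d)
     = (\<Sum>d | d \<in> {1..N} \<and> prime d. f d * mangoldt d / d) + (\<Sum>d | d \<in> {1..N} \<and> \<not> prime d. f d * mangoldt d / d)"
    by (subst sum.union_disjoint[symmetric]) (auto intro!: sum.cong)
  also have "(\<Sum>d | d \<in> {1..N} \<and> prime d. f d * mangoldt d / d) = (\<Sum>p | p \<in> {1..N} \<and> prime p. f p * ln p / p)"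
    by (intro sum.cong) auto
  finally have "\<bar>(\<Sum>d=1..N. f d * mangoldt d / d) - (\<Sum>p | p \<in> {1..N} \<and> prime p. f p * ln p / p)\<bar>
     = \<bar>\<Sum>d | d \<in> {1..N} \<and> \<not> prime d. f d * mangoldt d / d\<bar>" by simp
  also have "\<dots> \<le> (\<Sum>d | d \<in> {1..N} \<and> \<not> prime d. mangoldt d / d)"
  proof (rule order_trans[OF sum_abs sum_mono])
    fix d
    have "\<bar>f d\<bar> * (mangoldt d / d) \<le> 1 * (mangoldt d / d)"
      using assms mangoldt_nonneg[of d] by (intro mult_right_mono) auto
    then show "\<bar>f d * mangoldt d / d\<bar> \<le> mangoldt d / d" by (simp add: abs_mult)
  qed
  also have "\<dots> \<le> 2" by (rule nonprime_mangoldt_bound)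
  finally show ?thesis .
qed

lemma primes_coprime_unbounded:
  fixes M :: nat
  assumes "M > 0"
  shows "\<exists>N. K < (\<Sum>p | p \<in> {1..N} \<and> prime p \<and> coprime p M. ln p / p)"
proof -
  define C where "C = (\<Sum>p | (p :: nat) dvd M. ln (real p) / p)"
  obtain N :: nat where N: "exp (K + C + 3) < N" using reals_Archimedean2 by blast
  then have N0: "N > 0" using exp_gt_zero[of "K + C + 3"] by linarith
  have "K + C + 3 < ln N" using N N0 by (metis exp_less_cancel_iff exp_ln of_nat_0_less_iff)
  moreover have "ln N - 1 \<le> (\<Sum>d=1..N. 1 * mangoldt d / d)"
    using mangoldt_harmonic_lower[OF N0] by simp
  moreover have "(\<Sum>d=1..N. 1 * mangoldt d / d) \<le> (\<Sum>p | p \<in> {1..N} \<and> prime p. 1 * ln p / p) + 2"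
    using bounded_mangoldt_imp_bounded_primes[of "\<lambda>_. 1" N] by simp
  moreover have "(\<Sum>p | p \<in> {1..N} \<and> prime p. 1 * ln p / p)
      = (\<Sum>p | p \<in> {1..N} \<and> prime p \<and> coprime p M. ln p / p) + (\<Sum>p | p \<in> {1..N} \<and> prime p \<and> p dvd M. ln p / p)"
    by (subst sum.union_disjoint[symmetric])
       (auto intro!: sum.cong simp: prime_imp_coprime coprime_absorb_left)
  moreover have "(\<Sum>p | p \<in> {1..N} \<and> prime p \<and> p dvd M. ln p / p) \<le> C"
    unfolding C_def using assms
    by (intro sum_mono2) (auto dest: dvd_pos_nat intro!: divide_nonneg_nonneg ln_ge_zero simp: Suc_le_eq)
  ultimately show ?thesis by (intro exI[of _ N]) linarith
qed

context nonprincipal_character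
begin

lemma chi_log_bounded: "\<exists>C. \<forall>N. \<bar>\<Sum>n=1..N. \<chi> n * (ln n / n)\<bar> \<le> C"
proof (intro exI allI)
  fix N :: nat
  define h where "h n = \<chi> n * (ln n / n)" for n :: nat
  \<comment> \<open>ln x / x decreases only from e on, so the terms at 1 and 2 are kept
    apart.\<close>
  have anti: "ln (Suc k) / Suc k \<le> ln k / k" if "k \<ge> 3" for k :: nat
  proof -
    have "k * (ln (real (Suc k)) - ln k) \<le> 1"
      using ln_Suc_diff_le[of k] that by (simp add: pos_le_divide_eq mult.commute)
    moreover have "exp 1 \<le> real k" using exp_le that by simp
    then have "1 \<le> ln (real k)" using that by (subst ln_ge_iff) auto
    ultimately have "k * ln (real (Suc k)) \<le> Suc k * ln k" by (simp add: algebra_simps)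
    then show ?thesis using that by (simp add: field_simps)
  qed
  have "\<bar>\<Sum>n=1..N. h n\<bar> \<le> \<bar>h 1\<bar> + \<bar>h 2\<bar> + 2 * M * (ln 3 / 3)"
  proof (cases "N \<ge> 3")
    case True
    have "{1..N} = {1, 2} \<union> {3..<Suc N}" using True by auto
    then have "(\<Sum>n=1..N. h n) = h 1 + h 2 + (\<Sum>n=3..<Suc N. h n)"
      by (simp add: sum.union_disjoint)
    moreover have "\<bar>\<Sum>n=3..<Suc N. h n\<bar> \<le> 2 * M * (ln (3::nat) / (3::nat))"
      unfolding h_def using True anti by (intro weighted_sum_bound) auto
    ultimately show ?thesis by simp
  next
    case False
    then consider "N = 0" | "N = 1" | "N = 2" by linarith
    then show ?thesis by cases (auto simp: numeral_2_eq_2 abs_triangle_ineq intro: add_nonneg_nonneg order_trans[OF abs_triangle_ineq])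
  qed
  then show "\<bar>\<Sum>n=1..N. \<chi> n * (ln n / n)\<bar> \<le> \<bar>h 1\<bar> + \<bar>h 2\<bar> + 2 * M * (ln 3 / 3)"
    by (simp add: h_def)
qed

text \<open>Expanding ln n over its divisors turns the bounded sum of \<chi>(n) ln n / n into terms
  \<open>\<chi> d * mangoldt d / d * H (N div d)\<close>, where \<open>H\<close> is close to
  \<open>L1\<close>. The error is O(d / N) and is summed by Chebyshev's bound; what remains can be
  divided by \<open>L1\<close>, which is nonzero.\<close>

lemma chi_mangoldt_bounded: "\<exists>C. \<forall>N. \<bar>\<Sum>d=1..N. \<chi> d * mangoldt d / d\<bar> \<le> C"
proof -
  obtain C where C: "\<And>N. \<bar>\<Sum>n=1..N. \<chi> n * (ln n / n)\<bar> \<le> C" using chi_log_bounded by blast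
  have "\<bar>\<Sum>d=1..N. \<chi> d * mangoldt d / d\<bar> \<le> (C + 12 * M) / \<bar>L1\<bar>" for N
  proof (cases "N > 0")
    case True
    define H where "H k = (\<Sum>m=1..k. \<chi> m / m)" for k
    have H: "\<bar>L1 - H k\<bar> \<le> 2 * M / Suc k" for k
    proof -
      have "H k = (\<Sum>m<Suc k. \<chi> m / m)" unfolding H_def by (rule sum.mono_neutral_left) auto
      then show ?thesis using harmonic_tail_bound[of "Suc k"] by simp
    qed
    have "(\<Sum>n=1..N. \<chi> n * (ln n / n)) = (\<Sum>n=1..N. \<Sum>d | d dvd n. \<chi> d * mangoldt d / d * (\<chi> (n div d) / (n div d)))"
    proof (rule sum.cong[OF refl])
      fix n assume n: "n \<in> {1..N}"
      have "\<chi> n * (ln n / n) = (\<Sum>d | d dvd n. \<chi> n / n * mangoldt d)"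
        unfolding sum_distrib_left[symmetric] using n mangoldt_sum[of n, where 'a = real] by simp
      also have "\<dots> = (\<Sum>d | d dvd n. \<chi> d * mangoldt d / d * (\<chi> (n div d) / (n div d)))"
      proof (rule sum.cong[OF refl], clarsimp)
        fix d assume "d dvd n"
        then obtain m where "n = d * m" by blast
        then show "\<chi> n * mangoldt d / n = \<chi> d * mangoldt d * \<chi> (n div d) / (d * real (n div d))"
          using n by (auto simp: chi_mult)
      qed
      finally show "\<chi> n * (ln n / n) = (\<Sum>d | d dvd n. \<chi> d * mangoldt d / d * (\<chi> (n div d) / (n div d)))" .
    qed
    also have "\<dots> = (\<Sum>d=1..N. \<Sum>m=1..N div d. \<chi> d * mangoldt d / d * (\<chi> m / m))"
      by (rule sum_divisors_swap)
    also have "\<dots> = (\<Sum>d=1..N. \<chi> d * mangoldt d / d * H (N div d))"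
      by (simp add: H_def sum_distrib_left)
    also have "\<dots> = (\<Sum>d=1..N. \<chi> d * mangoldt d / d) * L1 - (\<Sum>d=1..N. \<chi> d * mangoldt d / d * (L1 - H (N div d)))"
      by (simp only: right_diff_distrib sum_subtractf sum_distrib_right)
    finally have eq: "L1 * (\<Sum>d=1..N. \<chi> d * mangoldt d / d)
       = (\<Sum>n=1..N. \<chi> n * (ln n / n)) + (\<Sum>d=1..N. \<chi> d * mangoldt d / d * (L1 - H (N div d)))"
      by (simp only: mult.commute[of L1])
    have "\<bar>\<Sum>d=1..N. \<chi> d * mangoldt d / d * (L1 - H (N div d))\<bar> \<le> (\<Sum>d=1..N. mangoldt d * (2 * M / N))"
    proof (rule order_trans[OF sum_abs sum_mono])
      fix d assume d: "d \<in> {1..N}"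
      have "N \<le> d * Suc (N div d)" using d dividend_less_times_div[of d N] by simp
      then have "real N \<le> real d * real (Suc (N div d))" by (metis of_nat_le_iff of_nat_mult)
      then have "2 * M * real N \<le> 2 * M * (real d * real (Suc (N div d)))" by (intro mult_left_mono) auto
      then have "2 * M / real (Suc (N div d)) \<le> d * (2 * M / N)"
        using True by (simp add: divide_le_eq pos_le_divide_eq mult_ac del: of_nat_Suc)
      then have "\<bar>L1 - H (N div d)\<bar> \<le> d * (2 * M / N)" using H[of "N div d"] by linarith
      then have "\<bar>\<chi> d\<bar> * (mangoldt d / d) * \<bar>L1 - H (N div d)\<bar> \<le> 1 * (mangoldt d / d) * (d * (2 * M / N))"
        using abs_le_1[of d] by (intro mult_mono) (auto simp: mangoldt_nonneg)
      then show "\<bar>\<chi> d * mangoldt d / d * (L1 - H (N div d))\<bar> \<le> mangoldt d * (2 * M / N)"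
        using d by (simp add: abs_mult)
    qed
    also have "\<dots> = (\<Sum>d=1..N. mangoldt d) * (2 * M / N)" by (rule sum_distrib_right[symmetric])
    also have "\<dots> \<le> 6 * real N * (2 * M / N)" by (intro mult_right_mono chebyshev_bound) auto
    also have "\<dots> = 12 * M" using True by simp
    finally have "\<bar>L1 * (\<Sum>d=1..N. \<chi> d * mangoldt d / d)\<bar> \<le> C + 12 * M"
      unfolding eq using C[of N] by linarith
    then show ?thesis using L1_nonzero by (simp add: abs_mult field_simps)
  next
    case False
    then show ?thesis using C[of 0] by simp
  qed
  then show ?thesis by blast
qed

lemma chi_primes_bounded: "\<exists>C. \<forall>N. \<bar>\<Sum>p | p \<in> {1..N} \<and> prime p. \<chi> p * ln p / p\<bar> \<le> C"
proof -
  obtain C where C: "\<And>N. \<bar>\<Sum>d=1..N. \<chi> d * mangoldt d / d\<bar> \<le> C" using chi_mangoldt_bounded by blast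
  have "\<bar>\<Sum>p | p \<in> {1..N} \<and> prime p. \<chi> p * ln p / p\<bar> \<le> C + 2" for N
    using C[of N] bounded_mangoldt_imp_bounded_primes[of \<chi> N, OF abs_le_1] by linarith
  then show ?thesis by blast
qed

end

lemma real_character_prod:
  assumes "finite S" "S \<noteq> {}" "\<And>j. j \<in> S \<Longrightarrow> real_character M (X j)"
  shows "real_character M (\<lambda>n. \<Prod>j\<in>S. X j n)"
proof -
  obtain j where j: "j \<in> S" using assms(2) by blast
  have "(\<Prod>j\<in>S. X j n) \<in> {-1, 0, 1}" for n
    using assms(1,3)
  proof (induction S rule: finite_induct)
    case (insert j S)
    then show ?case using real_character.range[of M "X j" n] by auto
  qed simp
  then show ?thesis
    using assms j real_character.zero_iff[OF assms(3)]
    by unfold_locales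
       (auto simp: real_character.M_pos[OF assms(3)] real_character.chi_mult[OF assms(3)]
          real_character.periodic[OF assms(3)] prod.distrib[symmetric] cong: prod.cong)
qed

text \<open>
  Expanding \<open>\<Prod>\<^sub>j (1 + e\<^sub>j \<chi>\<^sub>j)\<close>: if it vanished at all primes, the divergent sum of
  \<open>ln p / p\<close> would be cancelled by finitely many bounded character sums.
\<close>

theorem prime_with_prescribed_characters:
  fixes X :: "'a \<Rightarrow> nat \<Rightarrow> real" and e :: "'a \<Rightarrow> real"
  assumes J: "finite J" and M: "M > 0" and X: "\<And>j. j \<in> J \<Longrightarrow> real_character M (X j)"
    and indep: "\<And>S. S \<subseteq> J \<Longrightarrow> S \<noteq> {} \<Longrightarrow> \<exists>a. (\<Prod>j\<in>S. X j a) = -1"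
    and e: "\<And>j. j \<in> J \<Longrightarrow> e j \<in> {-1, 1}"
  shows "\<exists>p. prime p \<and> coprime p M \<and> (\<forall>j\<in>J. X j p = e j)"
proof (rule ccontr)
  assume neg: "\<not> ?thesis"
  let ?P = "\<lambda>N. {p. p \<in> {1..N} \<and> prime p \<and> coprime p M}"
  have "\<exists>C. \<forall>N. \<bar>\<Sum>p\<in>?P N. (\<Prod>j\<in>S. X j p) * ln p / p\<bar> \<le> C" if S: "S \<in> Pow J - {{}}" for S
  proof -
    have fin: "finite S" using S J finite_subset by auto
    interpret nonprincipal_character M "\<lambda>n. \<Prod>j\<in>S. X j n"
      using real_character_prod[OF fin, of M X] X S indep[of S]
      by (auto simp: nonprincipal_character_def nonprincipal_character_axioms_def)
    have "(\<Sum>p\<in>?P N. (\<Prod>j\<in>S. X j p) * ln p / p) = (\<Sum>p | p \<in> {1..N} \<and> prime p. (\<Prod>j\<in>S. X j p) * ln p / p)" for N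
      using zero_iff by (intro sum.mono_neutral_left) auto
    then show ?thesis using chi_primes_bounded by simp
  qed
  then have "\<exists>C. \<forall>S\<in>Pow J - {{}}. \<forall>N. \<bar>\<Sum>p\<in>?P N. (\<Prod>j\<in>S. X j p) * ln p / p\<bar> \<le> C S"
    by (intro bchoice ballI)
  then obtain C where C: "\<And>S N. S \<in> Pow J - {{}} \<Longrightarrow> \<bar>\<Sum>p\<in>?P N. (\<Prod>j\<in>S. X j p) * ln p / p\<bar> \<le> C S"
    by blast
  have e_abs: "\<bar>\<Prod>j\<in>S. e j\<bar> = 1" if "S \<subseteq> J" for S
  proof -
    have "\<bar>e j\<bar> = 1" if "j \<in> J" for j using e[OF that] by auto
    then show ?thesis using that by (auto simp: abs_prod intro!: prod.neutral)
  qed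
  have "(\<Sum>p\<in>?P N. ln p / p) \<le> (\<Sum>S\<in>Pow J - {{}}. C S)" for N
  proof -
    have "ln p / p = - (\<Sum>S\<in>Pow J - {{}}. (\<Prod>j\<in>S. e j) * ((\<Prod>j\<in>S. X j p) * ln p / p))" if p: "p \<in> ?P N" for p
    proof -
      obtain j where j: "j \<in> J" "X j p \<noteq> e j" using neg p by auto
      have "X j p \<noteq> 0" using real_character.zero_iff[OF X[OF j(1)]] p by auto
      then have "e j * X j p = -1"
        using real_character.range[OF X[OF j(1)], of p] e[OF j(1)] j(2) by auto
      \<comment> \<open>The expansion of this product over subsets isolates the empty subset, whose
        term is 1; every other term involves a nonprincipal character.\<close>
      then have "(\<Prod>j\<in>J. e j * X j p + 1) = 0"
        by (intro prod_zero[OF J] bexI[OF _ j(1)]) simp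
      then have "(\<Sum>S\<in>Pow J. (\<Prod>j\<in>S. e j * X j p)) = 0" by (subst (asm) prod_add[OF J]) simp
      then have "1 + (\<Sum>S\<in>Pow J - {{}}. (\<Prod>j\<in>S. e j * X j p)) = 0"
        by (subst (asm) sum.remove[of _ "{}"]) (use J in auto)
      then have "1 = - (\<Sum>S\<in>Pow J - {{}}. (\<Prod>j\<in>S. e j) * (\<Prod>j\<in>S. X j p))" by (simp add: prod.distrib)
      then have "1 * (ln p / p) = - (\<Sum>S\<in>Pow J - {{}}. (\<Prod>j\<in>S. e j) * (\<Prod>j\<in>S. X j p)) * (ln p / p)"
        by (rule arg_cong[where f = "\<lambda>x. x * (ln p / p)"])
      then show ?thesis by (simp add: sum_distrib_right sum_divide_distrib mult.assoc)
    qed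
    then have "(\<Sum>p\<in>?P N. ln p / p) = (\<Sum>p\<in>?P N. - (\<Sum>S\<in>Pow J - {{}}. (\<Prod>j\<in>S. e j) * ((\<Prod>j\<in>S. X j p) * ln p / p)))"
      by (intro sum.cong) auto
    also have "\<dots> = - (\<Sum>S\<in>Pow J - {{}}. (\<Prod>j\<in>S. e j) * (\<Sum>p\<in>?P N. (\<Prod>j\<in>S. X j p) * ln p / p))"
      unfolding sum_negf sum.swap[of _ _ "?P N"] sum_distrib_left ..
    also have "\<dots> \<le> (\<Sum>S\<in>Pow J - {{}}. \<bar>(\<Prod>j\<in>S. e j) * (\<Sum>p\<in>?P N. (\<Prod>j\<in>S. X j p) * ln p / p)\<bar>)"
      by (rule order_trans[OF abs_ge_minus_self sum_abs])
    also have "\<dots> \<le> (\<Sum>S\<in>Pow J - {{}}. C S)"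
      using C e_abs by (intro sum_mono) (auto simp: abs_mult)
    finally show ?thesis .
  qed
  then show False using primes_coprime_unbounded[OF M, of "\<Sum>S\<in>Pow J - {{}}. C S"] by (meson not_less)
qed

section \<open>Quadratic residues and Hilbert symbols\<close>

lemma Legendre_QuadRes:
  assumes "\<not> int p dvd a"
  shows "Legendre a p = (if QuadRes p a then 1 else -1)"
  using assms by (simp add: Legendre_def cong_0_iff)

lemma sign_cong_iff:
  assumes "2 < (p :: nat)" "x \<in> {1, -1}" "y \<in> {1, -1 :: int}" "[x = y] (mod int p)"
  shows "x = y"
proof -
  have "int p dvd x - y" using assms(4) by (simp add: cong_iff_dvd_diff)
  moreover have "\<not> int p dvd 2" "\<not> int p dvd -2" using assms(1) zdvd_imp_le[of "int p" 2] by auto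
  ultimately show ?thesis using assms(2,3) by auto
qed

lemma QuadRes_mult:
  assumes p: "prime p" "2 < p" and ab: "\<not> int p dvd a" "\<not> int p dvd b"
  shows "QuadRes p (a * b) \<longleftrightarrow> (QuadRes p a \<longleftrightarrow> QuadRes p b)"
proof -
  have nd: "\<not> int p dvd a * b" using p ab by (simp add: prime_dvd_mult_iff)
  have "[Legendre (a * b) p = Legendre a p * Legendre b p] (mod int p)"
    using euler_criterion[OF p, of "a * b"] cong_mult[OF euler_criterion[OF p, of a] euler_criterion[OF p, of b]]
    by (simp add: power_mult_distrib) (metis cong_sym cong_trans)
  then have "Legendre (a * b) p = Legendre a p * Legendre b p"
    by (rule sign_cong_iff[OF p(2), rotated 2]) (simp_all add: Legendre_QuadRes ab nd)
  then show ?thesis by (simp add: Legendre_QuadRes ab nd split: if_splits)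
qed

lemma QuadRes_cong: "[a = b] (mod m) \<Longrightarrow> QuadRes m a \<longleftrightarrow> QuadRes m b"
  unfolding QuadRes_def by (meson cong_sym cong_trans)

lemma QuadRes_square [simp]: "QuadRes m (a\<^sup>2)" "QuadRes m (a * a)" "QuadRes m 1"
  unfolding QuadRes_def by (auto intro: exI[of _ a] exI[of _ 1] simp: power2_eq_square)

lemma QuadRes_minus_1:
  fixes p :: nat
  assumes p: "prime p" "2 < p"
  shows "QuadRes p (-1) \<longleftrightarrow> p mod 4 \<noteq> 3"
proof -
  have "\<not> int p dvd -1" using p by auto
  moreover have "Legendre (-1) p = (-1) ^ ((p - 1) div 2)"
    by (rule sign_cong_iff[OF p(2) _ _ euler_criterion[OF p]])
       (use \<open>\<not> int p dvd -1\<close> in \<open>auto simp: Legendre_QuadRes minus_one_power_iff\<close>)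
  ultimately have "QuadRes p (-1) \<longleftrightarrow> even ((p - 1) div 2)"
    by (simp add: Legendre_QuadRes minus_one_power_iff split: if_splits)
  moreover have "odd p" using p prime_odd_nat by simp
  ultimately show ?thesis by presburger
qed

text \<open>Gauss's lemma: the numbers 2 x with x <= (p - 1) / 2 are already reduced modulo p, and
  those with x > (p - 1) div 4 are the ones beyond (p - 1) / 2.\<close>

lemma QuadRes_2:
  fixes p :: nat
  assumes p: "prime p" "2 < p"
  shows "QuadRes p 2 \<longleftrightarrow> p mod 8 \<notin> {3, 5}"
proof -
  have odd: "odd p" using p prime_odd_nat by simp
  have nd: "\<not> int p dvd 2" using p(2) zdvd_imp_le[of "int p" 2] by auto
  interpret GAUSS p 2
    using p nd by unfold_locales (auto simp: cong_0_iff)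
  have "C = (\<lambda>x. x * 2) ` A"
    unfolding C_def B_def image_image A_def by (intro image_cong) (use odd p in auto)
  then have "E = (\<lambda>x. x * 2) ` {(int p - 1) div 4 <.. (int p - 1) div 2}"
    unfolding E_def A_def by (auto simp: image_iff)
  then have "card E = nat ((int p - 1) div 2 - (int p - 1) div 4)"
    by (simp add: card_image inj_on_def)
  moreover have "Legendre 2 p = (-1) ^ card E" by (rule gauss_lemma)
  ultimately have "QuadRes p 2 \<longleftrightarrow> even (nat ((int p - 1) div 2 - (int p - 1) div 4))"
    using nd by (simp add: Legendre_QuadRes minus_one_power_iff split: if_splits)
  also have "\<dots> \<longleftrightarrow> even ((int p - 1) div 2 - (int p - 1) div 4)"
    using p(2) by (intro even_nat_iff) linarith
  also have "\<dots> \<longleftrightarrow> int p mod 8 \<noteq> 3 \<and> int p mod 8 \<noteq> 5"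
  proof -
    define k r where "k = int p div 8" and "r = int p mod 8"
    have kr: "int p = 8 * k + r" by (simp add: k_def r_def)
    have "odd (8 * k + r)" using odd by (simp flip: kr)
    then have "odd r" by simp
    moreover have "0 \<le> r" "r < 8" by (simp_all add: r_def)
    ultimately have r: "r = 1 \<or> r = 3 \<or> r = 5 \<or> r = 7" by presburger
    have d2: "(8 * k + r - 1) div 2 = 4 * k + (r - 1) div 2"
      using div_mult_self1[of 2 "r - 1" "4 * k"] by (simp add: algebra_simps)
    have d4: "(8 * k + r - 1) div 4 = 2 * k + (r - 1) div 4"
      using div_mult_self1[of 4 "r - 1" "2 * k"] by (simp add: algebra_simps)
    show ?thesis using r unfolding kr d2 d4 by auto
  qed
  also have "\<dots> \<longleftrightarrow> p mod 8 \<notin> {3, 5}"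
    using zmod_int[of p 8] by auto
  finally show ?thesis .
qed

lemma QuadRes_reciprocity:
  assumes "prime p" "2 < p" "prime q" "2 < q" "p \<noteq> q"
  shows "(QuadRes q (int p) \<longleftrightarrow> QuadRes p (int q)) \<longleftrightarrow> \<not> (p mod 4 = 3 \<and> q mod 4 = 3)"
proof -
  have "\<not> int p dvd int q" "\<not> int q dvd int p"
    using assms primes_dvd_imp_eq by auto
  moreover have "odd p" "odd q" using assms prime_odd_nat by auto
  then have "even ((p - 1) div 2 * ((q - 1) div 2)) \<longleftrightarrow> \<not> (p mod 4 = 3 \<and> q mod 4 = 3)"
    by (simp only: even_mult_iff) presburger
  ultimately show ?thesis
    using Quadratic_Reciprocity[OF assms] by (auto simp: Legendre_QuadRes minus_one_power_iff split: if_splits)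
qed

text \<open>Otherwise squaring would map the nonzero residues onto themselves, hence injectively,
  although 1 and p - 1 have the same square.\<close>

lemma exists_nonresidue:
  fixes p :: nat
  assumes p: "prime p" "2 < p"
  shows "\<exists>r. \<not> p dvd r \<and> \<not> QuadRes p (int r)"
proof (rule ccontr)
  assume "\<not> ?thesis"
  then have all: "\<exists>y. [y\<^sup>2 = int r] (mod int p)" if "\<not> p dvd r" for r
    using that by (auto simp: QuadRes_def)
  let ?f = "\<lambda>x :: nat. x\<^sup>2 mod p"
  have "{1..<p} \<subseteq> ?f ` {1..<p}"
  proof
    fix r assume r: "r \<in> {1..<p}"
    then have "\<not> p dvd r" by (auto dest: dvd_imp_le)
    from all[OF this] obtain y where y: "[y\<^sup>2 = int r] (mod int p)" by blast
    define x where "x = nat (y mod int p)"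
    have x: "int x = y mod int p" "x < p" using p(2) by (auto simp: x_def nat_less_iff)
    have "[(int x)\<^sup>2 = int r] (mod int p)" using y unfolding x(1) cong_def by (simp add: power_mod)
    then have "x\<^sup>2 mod p = r" using r by (metis atLeastLessThan_iff cong_int_iff cong_def mod_less of_nat_power)
    moreover from this have "x \<noteq> 0" using r by (intro notI) simp
    ultimately show "r \<in> ?f ` {1..<p}" using x(2) by (intro image_eqI[of _ _ x]) auto
  qed
  then have "inj_on ?f {1..<p}"
    by (intro finite_surj_inj) auto
  moreover have "?f 1 = ?f (p - 1)"
  proof -
    have "[(int p - 1)\<^sup>2 = 1] (mod int p)"
      by (simp add: cong_iff_dvd_diff power2_eq_square algebra_simps)
    then have "[(p - 1)\<^sup>2 = 1] (mod p)"
      using p(2) by (subst cong_int_iff[symmetric]) (simp add: of_nat_diff)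
    then show ?thesis by (simp add: cong_def)
  qed
  ultimately have "1 = p - 1" using inj_onD[of ?f "{1..<p}" 1 "p - 1"] p(2) by auto
  then show False using p(2) by simp
qed

section \<open>Hilbert symbols on square classes\<close>

definition unit_part :: "nat \<Rightarrow> int \<Rightarrow> int" where
  "unit_part p a = a div int p ^ multiplicity (int p) a"

definition odd_val :: "nat \<Rightarrow> int \<Rightarrow> bool" where
  "odd_val p a \<longleftrightarrow> odd (multiplicity (int p) a)"

definition nonres :: "nat \<Rightarrow> int \<Rightarrow> bool" where
  "nonres p a \<longleftrightarrow> \<not> QuadRes (int p) (unit_part p a)"

text \<open>For the odd part u, \<open>bit4\<close> and \<open>bit8\<close> record when (-1)^((u -
  1) / 2) and (-1)^((u^2 - 1) / 8) are -1. Together with the parity of the valuation they determine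
  the 2-adic square class.\<close>

definition bit4 :: "int \<Rightarrow> bool" where
  "bit4 a \<longleftrightarrow> unit_part 2 a mod 4 = 3"

definition bit8 :: "int \<Rightarrow> bool" where
  "bit8 a \<longleftrightarrow> unit_part 2 a mod 8 \<in> {3, 5}"

text \<open>
  \<open>hilbert p a b\<close> means that the Hilbert symbol of \<open>a\<close> and \<open>b\<close> at \<open>p\<close> is \<open>-1\<close>, given by the
  explicit formulas. Square classes are recorded by bits (parity of the valuation and
  characters of the unit part), on which multiplication of integers is exclusive or, written \<open>\<noteq>\<close>.
\<close>

definition hilbert_odd :: "bool \<Rightarrow> bool \<Rightarrow> bool \<Rightarrow> bool \<Rightarrow> bool \<Rightarrow> bool" where
  "hilbert_odd q v s v' s' \<longleftrightarrow> (((v \<and> v' \<and> q) \<noteq> (v \<and> s')) \<noteq> (v' \<and> s))"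

definition hilbert_two :: "bool \<Rightarrow> bool \<Rightarrow> bool \<Rightarrow> bool \<Rightarrow> bool \<Rightarrow> bool \<Rightarrow> bool" where
  "hilbert_two v x y v' x' y' \<longleftrightarrow> (((x \<and> x') \<noteq> (v \<and> y')) \<noteq> (v' \<and> y))"

definition hilbert :: "nat \<Rightarrow> int \<Rightarrow> int \<Rightarrow> bool" where
  "hilbert p a b \<longleftrightarrow> (if p = 2
     then hilbert_two (odd_val 2 a) (bit4 a) (bit8 a) (odd_val 2 b) (bit4 b) (bit8 b)
     else hilbert_odd (p mod 4 = 3) (odd_val p a) (nonres p a) (odd_val p b) (nonres p b))"

definition hilbert_inf :: "int \<Rightarrow> int \<Rightarrow> bool" where
  "hilbert_inf a b \<longleftrightarrow> a < 0 \<and> b < 0"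

lemma unit_part_decompose:
  assumes "prime p" "a \<noteq> 0"
  shows "a = int p ^ multiplicity (int p) a * unit_part p a" "\<not> int p dvd unit_part p a" "unit_part p a \<noteq> 0"
proof -
  show "a = int p ^ multiplicity (int p) a * unit_part p a"
    by (simp add: unit_part_def multiplicity_dvd)
  show "\<not> int p dvd unit_part p a"
    unfolding unit_part_def by (rule multiplicity_decompose) (use assms in \<open>auto simp: not_prime_unit\<close>)
  then show "unit_part p a \<noteq> 0" by auto
qed

lemma unit_part_unique:
  assumes "prime p" "a = int p ^ k * u" "\<not> int p dvd u"
  shows "multiplicity (int p) a = k" "unit_part p a = u"
proof -
  show 1: "multiplicity (int p) a = k"
    by (rule multiplicity_decomposeI[OF assms(2,3)]) (use assms in auto)
  have "a div int p ^ k = u" using assms by (simp add: prime_gt_0_nat)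
  then show "unit_part p a = u" unfolding unit_part_def 1 .
qed

lemma unit_part_not_dvd:
  assumes "prime p" "\<not> int p dvd a"
  shows "unit_part p a = a" "odd_val p a \<longleftrightarrow> False"
  using unit_part_unique[OF assms(1), of a 0 a] assms(2) by (auto simp: odd_val_def)

lemma unit_part_mult:
  assumes "prime p" "a \<noteq> 0" "b \<noteq> 0"
  shows "unit_part p (a * b) = unit_part p a * unit_part p b"
    "multiplicity (int p) (a * b) = multiplicity (int p) a + multiplicity (int p) b"
proof -
  note a = unit_part_decompose[OF assms(1,2)] and b = unit_part_decompose[OF assms(1,3)]
  have "a * b = int p ^ (multiplicity (int p) a + multiplicity (int p) b) * (unit_part p a * unit_part p b)"
  proof -
    have "a * b = (int p ^ multiplicity (int p) a * unit_part p a) * (int p ^ multiplicity (int p) b * unit_part p b)"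
      by (rule arg_cong2[OF a(1) b(1)])
    then show ?thesis by (simp only: power_add mult_ac)
  qed
  moreover have "\<not> int p dvd unit_part p a * unit_part p b"
    using assms(1) a(2) b(2) by (simp add: prime_dvd_mult_iff)
  ultimately show "unit_part p (a * b) = unit_part p a * unit_part p b"
    "multiplicity (int p) (a * b) = multiplicity (int p) a + multiplicity (int p) b"
    using unit_part_unique[OF assms(1)] by blast+
qed

lemma odd_val_mult:
  assumes "prime p" "a \<noteq> 0" "b \<noteq> 0"
  shows "odd_val p (a * b) \<longleftrightarrow> (odd_val p a \<noteq> odd_val p b)"
  using unit_part_mult[OF assms] by (simp add: odd_val_def)

lemma nonres_mult:
  assumes "prime p" "p \<noteq> 2" "a \<noteq> 0" "b \<noteq> 0"
  shows "nonres p (a * b) \<longleftrightarrow> (nonres p a \<noteq> nonres p b)"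
proof -
  have "2 < p" using assms(1,2) prime_ge_2_nat[of p] by linarith
  then show ?thesis
    using QuadRes_mult[OF assms(1), of "unit_part p a" "unit_part p b"] unit_part_mult[OF assms(1,3,4)]
      unit_part_decompose[OF assms(1)] assms by (simp add: nonres_def)
qed

lemma odd_unit_part_2: "a \<noteq> 0 \<Longrightarrow> odd (unit_part 2 a)"
  using unit_part_decompose(2)[of 2 a] by simp

lemma bits_odd_mult:
  fixes a b :: int
  assumes "odd a" "odd b"
  shows "a * b mod 4 = 3 \<longleftrightarrow> (a mod 4 = 3) \<noteq> (b mod 4 = 3)"
    "a * b mod 8 \<in> {3, 5} \<longleftrightarrow> (a mod 8 \<in> {3, 5}) \<noteq> (b mod 8 \<in> {3, 5})"
proof -
  have mods: "a mod 4 \<in> {1, 3}" "b mod 4 \<in> {1, 3}" "a mod 8 \<in> {1, 3, 5, 7}" "b mod 8 \<in> {1, 3, 5, 7}"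
    using assms by (simp_all, presburger+)
  have "x * y mod 4 = 3 \<longleftrightarrow> (x = 3) \<noteq> (y = 3)" if "x \<in> {1, 3}" "y \<in> {1, 3}" for x y :: int
    using that by auto
  from this[OF mods(1,2)] show "a * b mod 4 = 3 \<longleftrightarrow> (a mod 4 = 3) \<noteq> (b mod 4 = 3)"
    by (simp only: mod_mult_eq)
  have "x * y mod 8 \<in> {3, 5} \<longleftrightarrow> (x \<in> {3, 5}) \<noteq> (y \<in> {3, 5})"
    if "x \<in> {1, 3, 5, 7}" "y \<in> {1, 3, 5, 7}" for x y :: int
    using that by (elim insertE emptyE) simp_all
  from this[OF mods(3,4)] show "a * b mod 8 \<in> {3, 5} \<longleftrightarrow> (a mod 8 \<in> {3, 5}) \<noteq> (b mod 8 \<in> {3, 5})"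
    unfolding mod_mult_eq .
qed

lemma bit4_mult: "a \<noteq> 0 \<Longrightarrow> b \<noteq> 0 \<Longrightarrow> bit4 (a * b) \<longleftrightarrow> (bit4 a \<noteq> bit4 b)"
  and bit8_mult: "a \<noteq> 0 \<Longrightarrow> b \<noteq> 0 \<Longrightarrow> bit8 (a * b) \<longleftrightarrow> (bit8 a \<noteq> bit8 b)"
  unfolding bit4_def bit8_def unit_part_mult(1)[OF two_is_prime_nat]
  by (rule bits_odd_mult; simp add: odd_unit_part_2)+

lemmas bits_mult = odd_val_mult nonres_mult bit4_mult bit8_mult

text \<open>On bits, both formulas are bilinear over the field with two elements.\<close>

lemma hilbert_mult:
  assumes "prime p" "a \<noteq> 0" "b \<noteq> 0" "c \<noteq> 0"
  shows "hilbert p (a * b) c \<longleftrightarrow> (hilbert p a c \<noteq> hilbert p b c)"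
  using assms by (cases "p = 2") (auto simp: hilbert_def hilbert_two_def hilbert_odd_def bits_mult)

lemma hilbert_sym: "hilbert p a b \<longleftrightarrow> hilbert p b a"
  by (auto simp: hilbert_def hilbert_two_def hilbert_odd_def)

lemma hilbert_square:
  assumes "prime p" "k \<noteq> 0" "a \<noteq> 0" "b \<noteq> 0"
  shows "hilbert p (k\<^sup>2 * a) b \<longleftrightarrow> hilbert p a b"
  using assms by (simp add: power2_eq_square hilbert_mult)

lemma hilbert_good_prime:
  assumes "prime p" "p \<noteq> 2" "\<not> odd_val p a" "\<not> odd_val p b"
  shows "\<not> hilbert p a b"
  using assms by (simp add: hilbert_def hilbert_odd_def)

section \<open>The product formula\<close>

definition sgn_bit :: "bool \<Rightarrow> int" where "sgn_bit b = (if b then -1 else 1)"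

lemma sgn_bit_xor: "sgn_bit (a \<noteq> b) = sgn_bit a * sgn_bit b"
  by (simp add: sgn_bit_def)

text \<open>\<open>S\<close> is meant to contain every odd prime at which the symbol can be -1; the
  places 2 and infinity have formulas of their own and are appended.\<close>

definition hilbert_product :: "nat set \<Rightarrow> int \<Rightarrow> int \<Rightarrow> int" where
  "hilbert_product S a b =
     (\<Prod>p\<in>S. sgn_bit (hilbert p a b)) * sgn_bit (hilbert 2 a b) * sgn_bit (hilbert_inf a b)"

lemma hilbert_product_mult:
  assumes S: "\<And>p. p \<in> S \<Longrightarrow> prime p" and "a \<noteq> 0" "b \<noteq> 0" "c \<noteq> 0"
  shows "hilbert_product S (a * b) c = hilbert_product S a c * hilbert_product S b c"
proof -
  have "sgn_bit (hilbert_inf (a * b) c) = sgn_bit (hilbert_inf a c) * sgn_bit (hilbert_inf b c)"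
    using assms by (auto simp: sgn_bit_def hilbert_inf_def mult_less_0_iff)
  moreover have "(\<Prod>p\<in>S. sgn_bit (hilbert p (a * b) c))
     = (\<Prod>p\<in>S. sgn_bit (hilbert p a c)) * (\<Prod>p\<in>S. sgn_bit (hilbert p b c))"
    using assms unfolding prod.distrib[symmetric] sgn_bit_xor[symmetric]
    by (intro prod.cong refl arg_cong[where f = sgn_bit] hilbert_mult) auto
  ultimately show ?thesis
    unfolding hilbert_product_def hilbert_mult[OF two_is_prime_nat assms(2-4)] sgn_bit_xor by simp
qed

lemma hilbert_product_sym: "hilbert_product S a b = hilbert_product S b a"
  unfolding hilbert_product_def by (simp add: hilbert_sym[of _ a] hilbert_inf_def conj_commute)

lemma bits_prime:
  assumes "prime p" "prime q"
  shows "odd_val q (int p) \<longleftrightarrow> p = q" "unit_part q (int p) = (if p = q then 1 else int p)"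
proof -
  have "odd_val q (int p) = (p = q) \<and> unit_part q (int p) = (if p = q then 1 else int p)"
  proof (cases "p = q")
    case True
    have "\<not> int q dvd 1" using assms(2) by (auto dest: not_prime_unit)
    then show ?thesis
      using True unit_part_unique[OF assms(2), of "int p" 1 1] by (simp add: odd_val_def)
  next
    case False
    then have "\<not> int q dvd int p" using assms primes_dvd_imp_eq by auto
    then show ?thesis using unit_part_not_dvd[OF assms(2)] False by simp
  qed
  then show "odd_val q (int p) \<longleftrightarrow> p = q" "unit_part q (int p) = (if p = q then 1 else int p)" by auto
qed

lemma bits_unit:
  assumes "prime q" "u \<in> {1, -1}"
  shows "odd_val q u \<longleftrightarrow> False" "unit_part q u = u"
proof -
  have "\<not> int q dvd u" using assms by (auto dest: not_prime_unit)
  then show "odd_val q u \<longleftrightarrow> False" "unit_part q u = u" using unit_part_not_dvd[OF assms(1)] by auto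
qed

context
  fixes S :: "nat set"
  assumes S: "finite S" "\<And>p. p \<in> S \<Longrightarrow> prime p" "2 \<notin> S"
begin

lemma S_gt_2: "p \<in> S \<Longrightarrow> 2 < p"
  using S prime_ge_2_nat[of p] by (cases "p = 2") force+

lemma hilbert_product_units:
  assumes "u \<in> {1, -1}" "v \<in> {1, -1}"
  shows "hilbert_product S u v = 1"
proof -
  have "\<not> hilbert p u v" if "p \<in> S" for p
    using hilbert_good_prime[of p u v] that S bits_unit assms by metis
  then have "(\<Prod>p\<in>S. sgn_bit (hilbert p u v)) = 1" by (simp add: sgn_bit_def)
  then show ?thesis
    using assms by (auto simp: hilbert_product_def hilbert_def hilbert_two_def hilbert_inf_def
       bits_unit bit4_def bit8_def sgn_bit_def)
qed

text \<open>For u = -1 and odd p the factors at p and at 2 cancel: the first supplementary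
  law.\<close>

lemma hilbert_product_unit_prime:
  assumes "u \<in> {1, -1}" "p \<in> insert 2 S"
  shows "hilbert_product S u (int p) = 1"
proof -
  have pp: "prime p" using assms(2) S by auto
  have h: "sgn_bit (hilbert q u (int p)) = (if q = p then sgn_bit (u = -1 \<and> p mod 4 = 3) else 1)" if "q \<in> S" for q
    using that S(2)[OF that] S_gt_2[OF that] assms(1) pp QuadRes_minus_1[of p]
    by (auto simp: hilbert_def hilbert_odd_def bits_unit bits_prime nonres_def sgn_bit_def)
  have "(\<Prod>q\<in>S. sgn_bit (hilbert q u (int p))) = (if p \<in> S then sgn_bit (u = -1 \<and> p mod 4 = 3) else 1)"
    using S(1) by (simp add: h)
  moreover have "int p mod 4 = 3 \<longleftrightarrow> p mod 4 = 3" using zmod_int[of p 4] by auto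
  ultimately show ?thesis
    using assms S(3) pp by (auto simp: hilbert_product_def hilbert_def hilbert_two_def hilbert_inf_def
       bits_unit bits_prime bit4_def bit8_def sgn_bit_def)
qed

text \<open>The prime 2 paired with an odd prime is the second supplementary law, two distinct odd
  primes are quadratic reciprocity, and for equal primes the formulas cancel by themselves.\<close>

lemma hilbert_product_primes:
  assumes "p \<in> insert 2 S" "p' \<in> insert 2 S"
  shows "hilbert_product S (int p) (int p') = 1"
proof -
  have pp: "prime p" "prime p'" using assms S by auto
  have m4: "int n mod 4 = 3 \<longleftrightarrow> n mod 4 = 3" and m8: "int n mod 8 \<in> {3, 5} \<longleftrightarrow> n mod 8 \<in> {3, 5}" for n
    using zmod_int[of n 4] zmod_int[of n 8] by auto
  have neg: "hilbert_inf (int p) (int p') = False" by (simp add: hilbert_inf_def)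
  consider (two) "p = 2" "p' = 2" | (left) "p = 2" "p' \<in> S" | (right) "p \<in> S" "p' = 2"
    | (eq) "p \<in> S" "p' = p" | (neq) "p \<in> S" "p' \<in> S" "p \<noteq> p'"
    using assms by blast
  then show ?thesis
  proof cases
    case two
    have "\<not> hilbert q 2 2" if "q \<in> S" for q
      using that S_gt_2[OF that] S(2)[OF that] bits_prime[of 2 q] by (simp add: hilbert_def hilbert_odd_def)
    then show ?thesis
      using two bits_prime[of 2 2]
      by (simp add: hilbert_product_def sgn_bit_def hilbert_inf_def hilbert_def hilbert_two_def bit4_def bit8_def)
  next
    case left
    have "sgn_bit (hilbert q 2 (int p')) = (if q = p' then sgn_bit (p' mod 8 \<in> {3, 5}) else 1)" if "q \<in> S" for q
      using that S_gt_2[OF that] S(2)[OF that] bits_prime[of 2 q] bits_prime[of p' q] QuadRes_2[of p'] pp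
      by (auto simp: hilbert_def hilbert_odd_def nonres_def sgn_bit_def)
    then have "(\<Prod>q\<in>S. sgn_bit (hilbert q 2 (int p'))) = sgn_bit (p' mod 8 \<in> {3, 5})"
      using S(1) left by simp
    then show ?thesis
      using left bits_prime[of 2 2] bits_prime[of p' 2] pp S_gt_2[OF left(2)] m8[of p']
      by (auto simp: hilbert_product_def sgn_bit_def hilbert_inf_def hilbert_def hilbert_two_def bit4_def bit8_def)
  next
    case right
    have "sgn_bit (hilbert q (int p) 2) = (if q = p then sgn_bit (p mod 8 \<in> {3, 5}) else 1)" if "q \<in> S" for q
      using that S_gt_2[OF that] S(2)[OF that] bits_prime[of 2 q] bits_prime[of p q] QuadRes_2[of p] pp
      by (auto simp: hilbert_def hilbert_odd_def nonres_def sgn_bit_def)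
    then have "(\<Prod>q\<in>S. sgn_bit (hilbert q (int p) 2)) = sgn_bit (p mod 8 \<in> {3, 5})"
      using S(1) right by simp
    then show ?thesis
      using right bits_prime[of 2 2] bits_prime[of p 2] pp S_gt_2[OF right(1)] m8[of p]
      by (auto simp: hilbert_product_def sgn_bit_def hilbert_inf_def hilbert_def hilbert_two_def bit4_def bit8_def)
  next
    case eq
    have "sgn_bit (hilbert q (int p) (int p)) = (if q = p then sgn_bit (p mod 4 = 3) else 1)" if "q \<in> S" for q
      using that S_gt_2[OF that] S(2)[OF that] bits_prime[of p q] pp
      by (auto simp: hilbert_def hilbert_odd_def nonres_def sgn_bit_def)
    then have "(\<Prod>q\<in>S. sgn_bit (hilbert q (int p) (int p))) = sgn_bit (p mod 4 = 3)"
      using S(1) eq by simp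
    then show ?thesis
      using eq bits_prime[of p 2] pp S_gt_2[OF eq(1)] m4[of p]
      by (auto simp: hilbert_product_def sgn_bit_def hilbert_inf_def hilbert_def hilbert_two_def bit4_def bit8_def)
  next
    case neq
    have gt: "2 < p" "2 < p'" using neq S_gt_2 by auto
    have "sgn_bit (hilbert q (int p) (int p'))
       = (if q = p then sgn_bit (\<not> QuadRes p (int p')) else 1) * (if q = p' then sgn_bit (\<not> QuadRes p' (int p)) else 1)"
      if "q \<in> S" for q
      using that S_gt_2[OF that] S(2)[OF that] bits_prime[of p q] bits_prime[of p' q] pp neq
      by (auto simp: hilbert_def hilbert_odd_def nonres_def sgn_bit_def)
    then have "(\<Prod>q\<in>S. sgn_bit (hilbert q (int p) (int p'))) = sgn_bit (\<not> QuadRes p (int p')) * sgn_bit (\<not> QuadRes p' (int p))"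
      using S(1) neq by (simp add: prod.distrib)
    moreover have "sgn_bit (hilbert 2 (int p) (int p')) = sgn_bit (p mod 4 = 3 \<and> p' mod 4 = 3)"
      using bits_prime[of p 2] bits_prime[of p' 2] pp gt m4[of p] m4[of p']
      by (auto simp: hilbert_def hilbert_two_def bit4_def bit8_def)
    ultimately show ?thesis
      using QuadRes_reciprocity[OF pp(1) gt(1) pp(2) gt(2) neq(3)]
      unfolding hilbert_product_def neg by (auto simp: sgn_bit_def)
  qed
qed

theorem hilbert_product_formula:
  assumes "a \<noteq> 0" "b \<noteq> 0"
    and "\<And>p. prime p \<Longrightarrow> p \<noteq> 2 \<Longrightarrow> int p dvd a * b \<Longrightarrow> p \<in> S"
  shows "hilbert_product S a b = 1"
proof -
  define supp where "supp x \<longleftrightarrow> x \<noteq> 0 \<and> (\<forall>p. prime p \<longrightarrow> int p dvd x \<longrightarrow> p \<in> insert 2 S)" for x :: int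
  \<comment> \<open>Bilinearity reduces the first argument to units and primes. The same induction,
    applied after exchanging the arguments, then reduces the second.\<close>
  have ind: "hilbert_product S x c = 1"
    if "supp x" "c \<noteq> 0" and base: "\<And>u. u \<in> {1, -1} \<Longrightarrow> hilbert_product S u c = 1"
      "\<And>p. p \<in> insert 2 S \<Longrightarrow> hilbert_product S (int p) c = 1" for x c
    using that(1)
  proof (induction x rule: prime_divisors_induct)
    case zero
    then show ?case by (simp add: supp_def)
  next
    case (unit x)
    then have "x = 1 \<or> x = -1" by (simp, arith)
    then show ?case using base(1)[of x] by auto
  next
    case (factor p x)
    have x: "supp x" using factor.prems by (auto simp: supp_def)
    obtain q where q: "p = int q" "prime q"
      using factor.hyps by (metis prime_int_iff' prime_nat_iff' int_nat_eq prime_ge_0_int prime_int_nat_transfer)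
    then have "q \<in> insert 2 S" using factor.prems by (auto simp: supp_def)
    then show ?case
      using hilbert_product_mult[where S = S and a = p and b = x and c = c, OF S(2)] factor.IH[OF x] base(2)[of q] q x that(2)
      by (simp add: supp_def prime_gt_0_nat)
  qed
  have supp: "supp a" "supp b"
    unfolding supp_def using assms by (metis dvd_mult dvd_mult2 insertCI)+
  have base: "hilbert_product S x c = 1" if x: "x = 1 \<or> x = -1 \<or> (\<exists>p \<in> insert 2 S. x = int p)" and c: "supp c" for x c
  proof (subst hilbert_product_sym, rule ind[OF c])
    show "x \<noteq> 0" using x S(2)[of 0] by auto
    show "hilbert_product S u x = 1" if "u \<in> {1, -1}" for u
      using that x hilbert_product_units[of u x] hilbert_product_unit_prime[of u] by blast
    show "hilbert_product S (int p) x = 1" if "p \<in> insert 2 S" for p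
      using that x hilbert_product_unit_prime[of x p] hilbert_product_primes[of p]
        hilbert_product_sym[of S x] by (metis insertCI)
  qed
  show ?thesis
  proof (rule ind[OF supp(1) assms(2)])
    show "hilbert_product S u b = 1" if "u \<in> {1, -1}" for u
      using base[OF _ supp(2), of u] that by blast
    show "hilbert_product S (int p) b = 1" if "p \<in> insert 2 S" for p
      using base[OF _ supp(2), of "int p"] that by blast
  qed
qed

end

section \<open>Legendre's theorem\<close>

text \<open>c^2 - a is the norm of c + sqrt a. Since p divides a at most once, either both entries
  are units, or one of them is a square modulo p, or p divides both exactly once and the unit parts
  are opposite modulo p.\<close>

lemma hilbert_norm:
  assumes p: "prime p" "p \<noteq> 2" and a: "a \<noteq> 0" "\<not> (int p)\<^sup>2 dvd a" and n: "c\<^sup>2 - a \<noteq> 0"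
  shows "\<not> hilbert p a (c\<^sup>2 - a)"
proof -
  have p2: "2 < p" using p prime_ge_2_nat[of p] by linarith
  have pp: "prime (int p)" using p by simp
  show ?thesis
  proof (cases "int p dvd a")
    case False
    note ua = unit_part_not_dvd[OF p(1) False]
    show ?thesis
    proof (cases "int p dvd c\<^sup>2 - a")
      case True
      then have "QuadRes p a" unfolding QuadRes_def by (auto simp: cong_iff_dvd_diff)
      then show ?thesis using ua p(2) by (simp add: hilbert_def hilbert_odd_def nonres_def)
    next
      case False
      then show ?thesis using ua unit_part_not_dvd[OF p(1) False] hilbert_good_prime[OF p] by blast
    qed
  next
    case True
    then obtain a' where a': "a = int p * a'" by blast
    with a(2) have nd: "\<not> int p dvd a'" by (auto simp: power2_eq_square)
    have ua: "odd_val p a" "unit_part p a = a'"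
      using unit_part_unique[OF p(1), of a 1 a'] a' nd by (simp_all add: odd_val_def)
    show ?thesis
    proof (cases "int p dvd c")
      case False
      have "\<not> int p dvd c\<^sup>2 - a"
      proof
        assume "int p dvd c\<^sup>2 - a"
        from dvd_add[OF this True] have "int p dvd c\<^sup>2" by simp
        then show False using False pp prime_dvd_power by blast
      qed
      note un = unit_part_not_dvd[OF p(1) this]
      have "QuadRes p (c\<^sup>2 - a)"
        unfolding QuadRes_def using True by (intro exI[of _ c]) (simp add: cong_iff_dvd_diff)
      then show ?thesis using ua un p(2) by (simp add: hilbert_def hilbert_odd_def nonres_def)
    next
      case True
      then obtain c' where c': "c = int p * c'" by blast
      define n' where "n' = int p * c'\<^sup>2 - a'"
      have n': "c\<^sup>2 - a = int p * n'" "\<not> int p dvd n'"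
        using nd by (simp_all add: n'_def c' a' power2_eq_square algebra_simps dvd_diff_right_iff)
      have un: "odd_val p (c\<^sup>2 - a)" "unit_part p (c\<^sup>2 - a) = n'"
        using unit_part_unique[OF p(1), of "c\<^sup>2 - a" 1 n'] n' by (simp_all add: odd_val_def)
      have "[n' = -1 * a'] (mod int p)" by (simp add: n'_def cong_iff_dvd_diff)
      then have "QuadRes p n' \<longleftrightarrow> QuadRes p (-1 * a')" by (rule QuadRes_cong)
      also have "\<dots> \<longleftrightarrow> (QuadRes p (-1) \<longleftrightarrow> QuadRes p a')"
        by (rule QuadRes_mult[OF p(1) p2]) (use nd p in \<open>auto dest: not_prime_unit\<close>)
      finally show ?thesis
        using ua un p(2) QuadRes_minus_1[OF p(1) p2] by (auto simp: hilbert_def hilbert_odd_def nonres_def)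
    qed
  qed
qed

lemma sqrt_mod_squarefree:
  fixes a b :: int
  assumes "squarefree b" "\<And>p. prime p \<Longrightarrow> p dvd b \<Longrightarrow> \<exists>c. p dvd c\<^sup>2 - a"
  shows "\<exists>c. b dvd c\<^sup>2 - a"
  using assms
proof (induction b rule: prime_divisors_induct)
  case (factor p x)
  have sq: "squarefree x" "\<not> p dvd x"
    using squarefree_multD(2)[OF factor.prems(1)] factor.hyps squarefreeD[OF factor.prems(1), of p]
    by (auto simp: power2_eq_square dest: not_prime_unit)
  then have cop: "coprime p x" using factor.hyps prime_imp_coprime by blast
  obtain c1 where c1: "p dvd c1\<^sup>2 - a" using factor.prems(2)[of p] factor.hyps by auto
  obtain c2 where c2: "x dvd c2\<^sup>2 - a" using factor.IH[OF sq(1)] factor.prems(2) by auto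
  obtain c where c: "[c = c1] (mod p)" "[c = c2] (mod x)"
    using binary_chinese_remainder_int[OF cop] by blast
  have "[c\<^sup>2 - a = c1\<^sup>2 - a] (mod p)" "[c\<^sup>2 - a = c2\<^sup>2 - a] (mod x)"
    using c by (auto intro: cong_diff cong_pow)
  then have "p dvd c\<^sup>2 - a" "x dvd c\<^sup>2 - a" using c1 c2 cong_dvd_iff by blast+
  then show ?case using divides_mult[OF _ _ cop] by blast
next
  case (unit x)
  then show ?case by (blast intro: unit_imp_dvd)
qed simp

lemma small_sqrt_mod:
  fixes a b :: int
  assumes "b dvd c\<^sup>2 - a" "b \<noteq> 0"
  shows "\<exists>c. b dvd c\<^sup>2 - a \<and> 2 * \<bar>c\<bar> \<le> \<bar>b\<bar>"
proof -
  define r where "r = c mod \<bar>b\<bar>"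
  have r: "0 \<le> r" "r < \<bar>b\<bar>" using assms(2) by (simp_all add: r_def)
  have "\<bar>b\<bar> dvd c - r" unfolding r_def by (simp add: minus_mod_eq_mult_div)
  then have cr: "b dvd c - r" by simp
  define c' where "c' = (if 2 * r \<le> \<bar>b\<bar> then r else r - \<bar>b\<bar>)"
  have "b dvd r - c'" by (simp add: c'_def)
  with cr have "b dvd c - c'" using dvd_add[of b "c - r" "r - c'"] by simp
  then have "b dvd (c - c') * (c + c')" by simp
  with assms(1) have "b dvd (c\<^sup>2 - a) - (c - c') * (c + c')" by (rule dvd_diff)
  moreover have "(c\<^sup>2 - a) - (c - c') * (c + c') = c'\<^sup>2 - a"
    by (simp add: power2_eq_square algebra_simps)
  ultimately have "b dvd c'\<^sup>2 - a" by metis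
  moreover have "2 * \<bar>c'\<bar> \<le> \<bar>b\<bar>" using r by (auto simp: c'_def)
  ultimately show ?thesis by blast
qed

definition conic_solvable :: "int \<Rightarrow> int \<Rightarrow> bool" where
  "conic_solvable a b \<longleftrightarrow> (\<exists>x y z. (x, y, z) \<noteq> (0, 0, 0) \<and> z\<^sup>2 = a * x\<^sup>2 + b * y\<^sup>2)"

lemma conic_solvable_sym: "conic_solvable a b \<Longrightarrow> conic_solvable b a"
  unfolding conic_solvable_def by (metis add.commute prod.inject)

lemma conic_solvable_square:
  assumes "conic_solvable a b" "k \<noteq> 0"
  shows "conic_solvable (k\<^sup>2 * a) b"
proof -
  obtain x y z where xyz: "(x, y, z) \<noteq> (0, 0, 0)" "z\<^sup>2 = a * x\<^sup>2 + b * y\<^sup>2"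
    using assms(1) unfolding conic_solvable_def by blast
  have "(k * z)\<^sup>2 = k\<^sup>2 * a * x\<^sup>2 + b * (k * y)\<^sup>2"
    by (simp add: power_mult_distrib xyz(2) algebra_simps)
  then show ?thesis
    unfolding conic_solvable_def using xyz(1) assms(2) by (intro exI[of _ x] exI[of _ "k * y"] exI[of _ "k * z"]) auto
qed

text \<open>
  Multiplication by \<open>c + sqrt a\<close> turns a norm \<open>b' y\<^sup>2\<close> into \<open>b (b' y)\<^sup>2\<close>, as \<open>b b' = c\<^sup>2 - a\<close>.
\<close>

lemma conic_solvable_descent:
  assumes "conic_solvable a b'" "c\<^sup>2 - a = b * b'" "b' \<noteq> 0"
  shows "conic_solvable a b"
proof -
  obtain x y z where xyz: "(x, y, z) \<noteq> (0, 0, 0)" "z\<^sup>2 = a * x\<^sup>2 + b' * y\<^sup>2"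
    using assms(1) unfolding conic_solvable_def by blast
  show ?thesis
  proof (cases "y = 0")
    case True
    then show ?thesis unfolding conic_solvable_def using xyz by (intro exI[of _ x] exI[of _ 0] exI[of _ z]) auto
  next
    case False
    have "(c * z + a * x)\<^sup>2 - a * (z + c * x)\<^sup>2 = (c\<^sup>2 - a) * (z\<^sup>2 - a * x\<^sup>2)"
      by (simp add: power2_eq_square algebra_simps)
    also have "\<dots> = b * (b' * y)\<^sup>2"
      using assms(2) xyz(2) by (simp add: power2_eq_square)
    finally have "(c * z + a * x)\<^sup>2 = a * (z + c * x)\<^sup>2 + b * (b' * y)\<^sup>2" by simp
    then show ?thesis
      unfolding conic_solvable_def using False assms(3)
      by (intro exI[of _ "z + c * x"] exI[of _ "b' * y"] exI[of _ "c * z + a * x"]) auto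
  qed
qed

text \<open>The symbol at 2 is left out because the product formula determines it from the
  others.\<close>

definition conic_locally_solvable :: "int \<Rightarrow> int \<Rightarrow> bool" where
  "conic_locally_solvable a b \<longleftrightarrow> \<not> hilbert_inf a b \<and> (\<forall>p. prime p \<longrightarrow> p \<noteq> 2 \<longrightarrow> \<not> hilbert p a b)"

lemma conic_locally_solvable_sym: "conic_locally_solvable a b \<Longrightarrow> conic_locally_solvable b a"
  by (auto simp: conic_locally_solvable_def hilbert_sym[of _ a] hilbert_inf_def)

text \<open>Descent on |a| + |b|. Square factors are removed first. For squarefree entries the local
  conditions make a a square modulo b, so c^2 - a = b d with smaller d; since c^2 - a is a norm,
  bilinearity carries the local conditions from b to d.\<close>

theorem legendre:
  assumes "a \<noteq> 0" "b \<noteq> 0" "conic_locally_solvable a b"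
  shows "conic_solvable a b"
  using assms
proof (induction "nat (\<bar>a\<bar> + \<bar>b\<bar>)" arbitrary: a b rule: less_induct)
  case less
  define P where "P a b \<longleftrightarrow> a \<noteq> 0 \<and> b \<noteq> 0 \<and> conic_locally_solvable a b" for a b
  have P_sym: "P b a" if "P a b" for a b using that conic_locally_solvable_sym by (auto simp: P_def)
  have IH: "conic_solvable a' b'" if "P a' b'" "\<bar>a'\<bar> + \<bar>b'\<bar> < \<bar>a\<bar> + \<bar>b\<bar>" for a' b'
    using less.hyps[of a' b'] that by (auto simp: P_def)
  have nonsq: "conic_solvable a' b'" if ab: "P a' b'" "\<bar>a'\<bar> + \<bar>b'\<bar> = \<bar>a\<bar> + \<bar>b\<bar>" "\<not> squarefree a'" for a' b'
  proof -
    obtain k d where k: "a' = k\<^sup>2 * d" "\<not> k dvd 1"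
      using not_squarefreeE[OF ab(3)] by (metis dvdE)
    have nz: "k \<noteq> 0" "d \<noteq> 0" using k ab(1) by (auto simp: P_def)
    then have "\<bar>k\<bar> \<ge> 2" using k(2) by auto
    then have "k\<^sup>2 > 1" using power_mono[of 2 "\<bar>k\<bar>" 2] by simp
    then have "\<bar>d\<bar> < \<bar>a'\<bar>" using nz k(1) by (simp add: abs_mult)
    moreover have "P d b'"
      using ab(1) nz hilbert_square[of _ k d b'] unfolding P_def conic_locally_solvable_def k(1)
      by (auto simp: hilbert_inf_def mult_less_0_iff zero_less_mult_iff)
    ultimately show ?thesis using IH[of d b'] ab(2) conic_solvable_square[OF _ nz(1)] k(1) by auto
  qed
  have sqf: "conic_solvable a' b'"
    if ab: "P a' b'" "\<bar>a'\<bar> + \<bar>b'\<bar> = \<bar>a\<bar> + \<bar>b\<bar>" "squarefree a'" "squarefree b'" "\<bar>a'\<bar> \<le> \<bar>b'\<bar>" for a' b'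
  proof (cases "\<bar>b'\<bar> = 1")
    case True
    then have "a' = 1 \<or> b' = 1"
      using ab by (auto simp: P_def conic_locally_solvable_def hilbert_inf_def)
    then show ?thesis
      unfolding conic_solvable_def
      by (elim disjE) (rule exI[of _ 1], rule exI[of _ 0], rule exI[of _ 1], simp,
          rule exI[of _ 0], rule exI[of _ 1], rule exI[of _ 1], simp)
  next
    case False
    have nz: "a' \<noteq> 0" "b' \<noteq> 0" using ab(1) by (auto simp: P_def)
    then have b2: "\<bar>b'\<bar> \<ge> 2" using False by linarith
    have "\<exists>c. p dvd c\<^sup>2 - a'" if p: "prime p" "p dvd b'" for p
    proof -
      obtain q where q: "p = int q" "prime q"
        using p(1) by (metis nat_0_le prime_ge_0_int prime_int_nat_transfer)
      show ?thesis
      proof (cases "q = 2 \<or> p dvd a'")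
        case True
        \<comment> \<open>Modulo 2 every integer is a square, so the omitted symbol at 2 causes no
          obstruction.\<close>
        then have "p dvd 0\<^sup>2 - a' \<or> p dvd 1\<^sup>2 - a'" using q by auto
        then show ?thesis by blast
      next
        case False
        have "\<not> p\<^sup>2 dvd b'" using squarefreeD[OF ab(4), of p] p(1) not_prime_unit by blast
        then obtain b1 where b1: "b' = int q ^ 1 * b1" "\<not> int q dvd b1"
          using p(2) q(1) by (auto simp: power2_eq_square)
        have "odd_val q b'" using unit_part_unique[OF q(2) b1] by (simp add: odd_val_def)
        moreover have "\<not> hilbert q a' b'"
          using ab(1) False q by (auto simp: P_def conic_locally_solvable_def)
        ultimately have "QuadRes q a'"
          using unit_part_not_dvd[OF q(2), of a'] False q(1) by (simp add: hilbert_def hilbert_odd_def nonres_def)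
        then show ?thesis using q(1) by (auto simp: QuadRes_def cong_iff_dvd_diff)
      qed
    qed
    then obtain c where c: "b' dvd c\<^sup>2 - a'" "2 * \<bar>c\<bar> \<le> \<bar>b'\<bar>"
      using sqrt_mod_squarefree[OF ab(4)] small_sqrt_mod[OF _ nz(2)] by metis
    then obtain d where d: "c\<^sup>2 - a' = b' * d" by blast
    show ?thesis
    proof (cases "d = 0")
      case True
      then have "c\<^sup>2 = a' * 1\<^sup>2 + b' * 0\<^sup>2" using d by simp
      then show ?thesis unfolding conic_solvable_def by (intro exI[of _ 1] exI[of _ 0] exI[of _ c]) auto
    next
      case False
      have "4 * c\<^sup>2 \<le> b'\<^sup>2" using power_mono[OF c(2), of 2] by (simp add: power_mult_distrib)
      moreover have "\<bar>b' * d\<bar> \<le> c\<^sup>2 + \<bar>a'\<bar>"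
        unfolding d[symmetric] using abs_triangle_ineq4[of "c\<^sup>2" a'] by simp
      ultimately have "4 * \<bar>b' * d\<bar> \<le> b'\<^sup>2 + 4 * \<bar>b'\<bar>" using ab(5) by linarith
      then have "\<bar>b'\<bar> * (4 * \<bar>d\<bar>) \<le> \<bar>b'\<bar> * (\<bar>b'\<bar> + 4)"
        by (simp add: abs_mult power2_eq_square algebra_simps)
      then have "4 * \<bar>d\<bar> \<le> \<bar>b'\<bar> + 4" using nz(2) by simp
      \<comment> \<open>|b| + 4 < 4 |b| as soon as |b| >= 2, which is why |b| = 1 was treated
        separately.\<close>
      then have less: "\<bar>d\<bar> < \<bar>b'\<bar>" using b2 by linarith
      have "\<not> hilbert q a' d" if q: "prime q" "q \<noteq> 2" for q
      proof -
        have "\<not> (int q)\<^sup>2 dvd a'" using squarefreeD[OF ab(3), of "int q"] q(1) not_prime_unit prime_nat_int_transfer by blast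
        then have "\<not> hilbert q a' (b' * d)"
          using hilbert_norm[OF q nz(1), of c] False nz d by simp
        moreover have "\<not> hilbert q a' b'" using ab(1) q by (auto simp: P_def conic_locally_solvable_def)
        ultimately show ?thesis
          using hilbert_mult[OF q(1) nz(2) False nz(1)] by (simp add: hilbert_sym[of _ a'])
      qed
      moreover have "\<not> hilbert_inf a' d"
      proof
        assume neg: "hilbert_inf a' d"
        then have "b' > 0" using ab(1) nz(2) by (auto simp: P_def conic_locally_solvable_def hilbert_inf_def)
        then have "b' * d < 0" using neg by (simp add: hilbert_inf_def mult_less_0_iff)
        moreover have "c\<^sup>2 - a' > 0" using neg zero_le_power2[of c] unfolding hilbert_inf_def by linarith
        ultimately show False using d by simp
      qed
      ultimately have "P a' d" using nz False by (auto simp: P_def conic_locally_solvable_def)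
      then have "conic_solvable a' d" using IH[of a' d] less ab(2) by linarith
      then show ?thesis using conic_solvable_descent[OF _ d False] by blast
    qed
  qed
  have "P a b" "P b a" using less.prems P_sym by (auto simp: P_def)
  then show ?case
    using nonsq[of a b] nonsq[of b a] sqf[of a b] sqf[of b a] conic_solvable_sym
    by (metis add.commute linear)
qed

section \<open>Meyer's theorem\<close>

lemma prime_with_prescribed_residues:
  assumes T: "finite T" "\<And>p. p \<in> T \<Longrightarrow> prime p" "2 \<notin> T"
  shows "\<exists>l. prime l \<and> l \<noteq> 2 \<and> l \<notin> T \<and> (\<forall>p\<in>T. \<not> QuadRes (int p) (int l) \<longleftrightarrow> f p)
     \<and> (int l mod 4 = 3 \<longleftrightarrow> x) \<and> (int l mod 8 \<in> {3, 5} \<longleftrightarrow> y)"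
proof -
  define M where "M = 8 * \<Prod>T"
  \<comment> \<open>The indices 4 and 8 are not prime and so are free to name the two characters at
    2.\<close>
  define B where "B j n = (if j = 4 then int n mod 4 = 3 else if j = 8 then int n mod 8 \<in> {3, 5}
     else \<not> QuadRes (int j) (int n))" for j n :: nat
  define X where "X j n = (if coprime n M then if B j n then -1 else 1 else 0 :: real)" for j n :: nat
  define J where "J = {4, 8} \<union> T"
  define e where "e j = (if (if j = 4 then x else if j = 8 then y else f j) then -1 else 1 :: real)" for j :: nat
  have gt2: "2 < p" if "p \<in> T" for p
    using T(3) that prime_ge_2_nat[OF T(2)[OF that]] by (cases "p = 2") auto
  have nT: "4 \<notin> T" "8 \<notin> T"
    using prime_odd_nat[OF T(2) gt2] by fastforce+
  have M: "M > 0" using T prime_gt_0_nat by (auto simp: M_def intro!: prod_pos)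
  have dvdM: "p dvd M" if "p \<in> T" for p using T(1) that by (simp add: M_def dvd_prod_eqI)
  have copM: "coprime n M \<longleftrightarrow> odd n \<and> (\<forall>p\<in>T. \<not> p dvd n)" for n
  proof -
    have "coprime n 8 \<longleftrightarrow> odd n"
      using coprime_power_right_iff[of n 2 3] by simp
    moreover have "coprime n (\<Prod>T) \<longleftrightarrow> (\<forall>p\<in>T. \<not> p dvd n)"
    proof
      assume "coprime n (\<Prod>T)"
      then show "\<forall>p\<in>T. \<not> p dvd n"
        using T(1,2) by (metis coprime_common_divisor_nat dvd_prod_eqI not_prime_1 nat_dvd_1_iff_1)
    next
      assume "\<forall>p\<in>T. \<not> p dvd n"
      then show "coprime n (\<Prod>T)"
        using T(2) by (intro prod_coprime_right) (metis coprime_commute prime_imp_coprime)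
    qed
    ultimately show ?thesis by (simp add: M_def)
  qed
  have char: "real_character M (X j)" if j: "j \<in> J" for j
  proof
    show "M > 0" by (rule M)
  next
    fix m n
    show "X j (m * n) = X j m * X j n"
    proof (cases "coprime m M \<and> coprime n M")
      case True
      have odd: "odd m" "odd n" using True copM by auto
      have "B j (m * n) \<longleftrightarrow> (B j m \<noteq> B j n)"
      proof (cases "j \<in> T")
        case jT: True
        then have "\<not> int j dvd int m" "\<not> int j dvd int n" using True copM by auto
        then show ?thesis
          using QuadRes_mult[OF T(2)[OF jT] gt2[OF jT]] jT nT by (auto simp: B_def)
      next
        case False
        then show ?thesis using j bits_odd_mult[of "int m" "int n"] odd by (auto simp: B_def J_def)
      qed
      with True show ?thesis by (simp add: X_def)
    qed (auto simp: X_def)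
  next
    fix n
    have "B j (n + M) = B j n"
    proof (cases "j \<in> T")
      case jT: True
      have "[int (n + M) = int n] (mod int j)" using dvdM[OF jT] by (simp add: cong_iff_dvd_diff)
      then show ?thesis using jT nT QuadRes_cong by (auto simp: B_def)
    next
      case False
      have "int (n + M) mod 8 = int n mod 8" "int (n + M) mod 4 = int n mod 4"
        by (simp_all add: M_def mod_add_cong flip: mod_add_right_eq)
      then show ?thesis using False j by (auto simp: B_def J_def)
    qed
    moreover have "coprime (n + M) M \<longleftrightarrow> coprime n M"
      unfolding coprime_iff_gcd_eq_1 gcd_add1 ..
    ultimately show "X j (n + M) = X j n" by (simp only: X_def)
  qed (auto simp: X_def)
  have indep: "\<exists>a. (\<Prod>j\<in>S. X j a) = -1" if S: "S \<subseteq> J" "S \<noteq> {}" for S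
  proof -
    have "\<exists>r. \<forall>p\<in>T. \<not> p dvd r p \<and> \<not> QuadRes (int p) (int (r p))"
      using exists_nonresidue T(2) gt2 by (intro bchoice) blast
    then obtain r where r: "\<And>p. p \<in> T \<Longrightarrow> \<not> p dvd r p \<and> \<not> QuadRes (int p) (int (r p))" by blast
    have "\<exists>j0. j0 \<in> S \<and> (j0 \<in> T \<or> S \<inter> T = {} \<and> (j0 = 4 \<or> j0 = 8 \<and> 4 \<notin> S))"
      using S unfolding J_def by blast
    then obtain j0 where j0: "j0 \<in> S" "j0 \<in> T \<or> S \<inter> T = {} \<and> (j0 = 4 \<or> j0 = 8 \<and> 4 \<notin> S)"
      by blast
    \<comment> \<open>Residues for which, within \<open>S\<close>, only the character
      \<open>j0\<close> takes the value -1: 7 is 3 modulo 4 but gives 1 under the character modulo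
      8, and 5 does the opposite.\<close>
    define u where "u i = (if i = 8 then (if j0 = 4 then 7 else if j0 = 8 then 5 else 1)
       else if i = j0 then r i else 1 :: nat)" for i
    have "coprime i j" if "i \<in> insert 8 T" "j \<in> insert 8 T" "i \<noteq> j" for i j
    proof -
      have c8: "coprime 8 p" if "p \<in> T" for p
        using coprime_power_left_iff[of 2 3 p] T(2)[OF that] gt2[OF that] primes_coprime[of 2 p] by simp
      show ?thesis
        using that c8 primes_coprime[of i j] T(2) by (auto simp: coprime_commute)
    qed
    then obtain a where a: "\<And>i. i \<in> insert 8 T \<Longrightarrow> [a = u i] (mod i)"
      using chinese_remainder_nat[of "insert 8 T" id u] T(1) by auto
    have a8: "a mod 8 = u 8" using a[of 8] by (auto simp: cong_def u_def)
    then have a8': "int a mod 8 = int (u 8)" by (metis of_nat_numeral zmod_int)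
    have "int a mod 8 mod 4 = int a mod 4" by (simp add: mod_mod_cancel)
    then have a4: "int a mod 4 = int (u 8) mod 4" using a8' by simp
    have "odd (a mod 8)" unfolding a8 by (simp add: u_def)
    then have "odd a" by presburger
    moreover have aT: "\<not> p dvd a \<and> (QuadRes (int p) (int a) \<longleftrightarrow> p \<noteq> j0)" if "p \<in> T" for p
    proof -
      have c: "[a = u p] (mod p)" using a that by blast
      have up: "u p = (if p = j0 then r p else 1)" using that nT by (auto simp: u_def)
      have "p dvd a \<longleftrightarrow> p dvd u p" using c cong_dvd_iff by blast
      moreover have "QuadRes (int p) (int a) \<longleftrightarrow> QuadRes (int p) (int (u p))"
        using c by (intro QuadRes_cong) (simp add: cong_int_iff)
      ultimately show ?thesis using up r[OF that] gt2[OF that] by auto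
    qed
    ultimately have cop: "coprime a M" using copM by blast
    have "B j a \<longleftrightarrow> j = j0" if "j \<in> S" for j
    proof (cases "j \<in> T")
      case True
      then show ?thesis using aT nT by (auto simp: B_def)
    next
      case False
      then have "j = 4 \<or> j = 8" using that S(1) by (auto simp: J_def)
      then show ?thesis
        using j0(2) that nT False a8' a4 unfolding B_def u_def by (elim disjE) (auto split: if_splits)
    qed
    then have "(\<Prod>j\<in>S. X j a) = (\<Prod>j\<in>S. if j = j0 then -1 else 1)"
      by (intro prod.cong refl) (simp add: X_def cop)
    also have "\<dots> = -1" using j0(1) S(1) T(1) by (subst prod.delta) (auto simp: J_def intro: finite_subset)
    finally show ?thesis by blast
  qed
  have "\<exists>l. prime l \<and> coprime l M \<and> (\<forall>j\<in>J. X j l = e j)"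
    by (rule prime_with_prescribed_characters[OF _ M char indep]) (auto simp: J_def T(1) e_def)
  then obtain l where l: "prime l" "coprime l M" "\<And>j. j \<in> J \<Longrightarrow> X j l = e j" by blast
  have "B j l \<longleftrightarrow> e j = -1" if "j \<in> J" for j
    using l(2) l(3)[OF that] by (auto simp: X_def split: if_splits)
  then have B: "\<And>j. j \<in> J \<Longrightarrow> B j l \<longleftrightarrow> (if j = 4 then x else if j = 8 then y else f j)"
    by (auto simp: e_def split: if_splits)
  have "l \<noteq> 2" "l \<notin> T" using l(2) copM by auto
  moreover have "\<not> QuadRes (int p) (int l) \<longleftrightarrow> f p" if "p \<in> T" for p
    using B[of p] that nT by (auto simp: J_def B_def split: if_splits)
  moreover have "int l mod 4 = 3 \<longleftrightarrow> x" "int l mod 8 \<in> {3, 5} \<longleftrightarrow> y"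
    using B[of 4] B[of 8] by (simp_all add: J_def B_def)
  ultimately show ?thesis using l(1) by blast
qed

text \<open>The sign and a product of primes from {2} and \<open>T\<close> settle sign and
  valuations. The unit characters are then corrected by one prime \<open>l\<close>, chosen so that
  its characters are the differences between the desired and the present ones.\<close>

lemma integer_with_prescribed_classes:
  assumes T: "finite T" "\<And>p. p \<in> T \<Longrightarrow> prime p" "2 \<notin> T"
  shows "\<exists>w l. w \<noteq> 0 \<and> prime l \<and> l \<noteq> 2 \<and> l \<notin> T \<and> (\<forall>p\<in>T. (odd_val p w \<longleftrightarrow> V p) \<and> (nonres p w \<longleftrightarrow> N p))
     \<and> (odd_val 2 w \<longleftrightarrow> v2) \<and> (bit4 w \<longleftrightarrow> x) \<and> (bit8 w \<longleftrightarrow> y) \<and> (w < 0 \<longleftrightarrow> neg)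
     \<and> odd_val l w \<and> (\<forall>p. prime p \<longrightarrow> int p dvd w \<longrightarrow> p \<in> {2, l} \<union> T)"
proof -
  define W where "W p = (if p = 2 then v2 else V p)" for p
  define w1 where "w1 = (\<Prod>p\<in>insert 2 T. if W p then int p else 1)"
  define w0 where "w0 = (if neg then -1 else 1) * w1"
  have prime: "prime p" if "p \<in> insert 2 T" for p using that T(2) by auto
  have pos: "p > 0" if "p \<in> insert 2 T" for p using prime_gt_0_nat[OF prime[OF that]] .
  have w1: "w1 > 0" unfolding w1_def using prime prime_gt_0_nat by (intro prod_pos) auto
  have w0: "w0 \<noteq> 0" using w1 by (simp add: w0_def)
  have val: "odd_val q (\<Prod>p\<in>F. if W p then int p else 1) \<longleftrightarrow> q \<in> F \<and> W q"
    if "finite F" "F \<subseteq> insert 2 T" "prime q" for F q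
    using that
  proof (induction F rule: finite_induct)
    case empty
    then show ?case using bits_unit(1)[of q 1] by simp
  next
    case (insert p F)
    define Z where "Z = (\<Prod>p\<in>F. if W p then int p else 1)"
    have "Z > 0" unfolding Z_def using insert.prems(1) pos by (intro prod_pos) auto
    moreover have "odd_val q Z \<longleftrightarrow> q \<in> F \<and> W q" unfolding Z_def using insert by blast
    moreover have "prime p" "p > 0" using insert.prems(1) pos prime by auto
    moreover have "(\<Prod>p\<in>insert p F. if W p then int p else 1) = (if W p then int p else 1) * Z"
      using insert.hyps by (simp add: Z_def)
    ultimately show ?case
      using insert.hyps insert.prems(2) bits_prime(1)[of p q] odd_val_mult[of q "int p" Z] by auto
  qed
  have "odd_val q w0 \<longleftrightarrow> odd_val q w1" if "prime q" for q
    using odd_val_mult[OF that, of "-1" w1] bits_unit(1)[OF that, of "-1"] w1 by (auto simp: w0_def)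
  then have val0: "odd_val q w0 \<longleftrightarrow> q \<in> insert 2 T \<and> W q" if "prime q" for q
    using val[of "insert 2 T" q] that T(1) unfolding w1_def by auto
  have dvd0: "p \<in> insert 2 T" if p: "prime p" "int p dvd w0" for p
  proof -
    have "int p dvd w1" using p(2) by (auto simp: w0_def split: if_splits)
    then obtain q where q: "q \<in> insert 2 T" "int p dvd (if W q then int q else 1)"
      using T(1) p(1) prime_dvd_prod_iff[of "insert 2 T" "int p"] unfolding w1_def by auto
    then have "int p dvd int q" using p(1) by (auto split: if_splits)
    then have "p = q" using primes_dvd_imp_eq[OF p(1) prime[OF q(1)]] by simp
    with q(1) show ?thesis by simp
  qed
  obtain l where l: "prime l" "l \<noteq> 2" "l \<notin> T"
    "\<And>p. p \<in> T \<Longrightarrow> \<not> QuadRes (int p) (int l) \<longleftrightarrow> (N p \<noteq> nonres p w0)"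
    "int l mod 4 = 3 \<longleftrightarrow> (x \<noteq> bit4 w0)" "int l mod 8 \<in> {3, 5} \<longleftrightarrow> (y \<noteq> bit8 w0)"
    using prime_with_prescribed_residues[OF T, of "\<lambda>p. N p \<noteq> nonres p w0" "x \<noteq> bit4 w0" "y \<noteq> bit8 w0"] by blast
  have l0: "int l \<noteq> 0" "int l > 0" using prime_gt_0_nat[OF l(1)] by auto
  define w where "w = w0 * int l"
  have "odd_val p w \<longleftrightarrow> (p \<in> insert 2 T \<and> W p) \<noteq> (p = l)" if "prime p" for p
    using odd_val_mult[OF that w0 l0(1)] val0[OF that] bits_prime(1)[OF l(1) that] by (auto simp: w_def)
  moreover have "nonres p w \<longleftrightarrow> N p" if "p \<in> T" for p
  proof -
    have "p \<noteq> 2" "p \<noteq> l" using that T(3) l(3) by auto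
    then show ?thesis
      using nonres_mult[OF T(2)[OF that] _ w0 l0(1)] bits_prime(2)[OF l(1) T(2)[OF that]] l(4)[OF that]
      by (auto simp: w_def nonres_def[of p "int l"])
  qed
  moreover have "bit4 w \<longleftrightarrow> x" "bit8 w \<longleftrightarrow> y"
    using bit4_mult[OF w0 l0(1)] bit8_mult[OF w0 l0(1)] l bits_prime(2)[OF l(1) two_is_prime_nat]
    by (auto simp: w_def bit4_def[of "int l"] bit8_def[of "int l"])
  moreover have "w < 0 \<longleftrightarrow> neg" using w1 l0 by (auto simp: w_def w0_def mult_less_0_iff)
  moreover have "p \<in> {2, l} \<union> T" if "prime p" "int p dvd w" for p
  proof -
    have "int p dvd w0 \<or> int p dvd int l" using that by (simp add: w_def prime_dvd_mult_iff)
    then show ?thesis using dvd0[OF that(1)] primes_dvd_imp_eq[OF that(1) l(1)] by auto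
  qed
  ultimately show ?thesis
    using w0 l l0 T(2,3) by (intro exI[of _ w] exI[of _ l]) (auto simp: w_def W_def)
qed

text \<open>The condition cuts out an affine hyperplane of the square classes, or all of them when
  the class (mv, mn) is trivial. Either way at least two classes remain, so one can be avoided;
  likewise at 2.\<close>

lemma avoid_class_odd:
  fixes av an :: bool
  shows "\<exists>V N. \<not> hilbert_odd q (av \<noteq> V) (an \<noteq> N) mv mn \<and> (V, N) \<noteq> (cv, cn)"
  unfolding hilbert_odd_def ex_bool_eq
  by (cases q; cases av; cases an; cases mv; cases mn; cases cv; cases cn) simp_all

lemma avoid_class_two:
  fixes av ax ay :: bool
  shows "\<exists>V X Y. \<not> hilbert_two (av \<noteq> V) (ax \<noteq> X) (ay \<noteq> Y) mv mx my \<and> (V, X, Y) \<noteq> (cv, cx, cy)"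
  unfolding hilbert_two_def ex_bool_eq
  by (cases av; cases ax; cases ay; cases mv; cases mx; cases my; cases cv; cases cx) simp_all

text \<open>
  Nondegeneracy of the local symbols: on the square classes, the functionals given by distinct
  classes \<open>m \<noteq> n\<close> are independent, unless one of them is zero and imposes no condition.
\<close>

lemma common_class_odd:
  fixes av an bv bn :: bool
  assumes "(mv, mn) \<noteq> (nv, nn)"
  shows "\<exists>V N. \<not> hilbert_odd q (av \<noteq> V) (an \<noteq> N) mv mn \<and> \<not> hilbert_odd q (bv \<noteq> V) (bn \<noteq> N) nv nn"
  using assms unfolding hilbert_odd_def ex_bool_eq
  by (cases q; cases mv; cases mn; cases nv; cases nn; cases av; cases an; cases bv) auto

lemma common_class_two:
  fixes av ax ay bv bx by' :: bool
  assumes "(mv, mx, my) \<noteq> (nv, nx, ny)"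
  shows "\<exists>V X Y. \<not> hilbert_two (av \<noteq> V) (ax \<noteq> X) (ay \<noteq> Y) mv mx my
     \<and> \<not> hilbert_two (bv \<noteq> V) (bx \<noteq> X) (by' \<noteq> Y) nv nx ny"
proof -
  have trivial: "(v, x, y) \<noteq> (False, False, False) \<or> \<not> hilbert_two a b c v x y" for a b c v x y
    by (auto simp: hilbert_two_def)
  \<comment> \<open>Distinct linear functionals attain every pair of values, except that a zero
    functional attains only \<open>False\<close>; by \<open>trivial\<close> no other value is then
    asked for.\<close>
  have indep: "\<exists>V X Y. (((X \<and> mx) \<noteq> (V \<and> my)) \<noteq> (mv \<and> Y)) = e \<and> (((X \<and> nx) \<noteq> (V \<and> ny)) \<noteq> (nv \<and> Y)) = f"
    if "(mv, mx, my) \<noteq> (False, False, False) \<or> \<not> e" "(nv, nx, ny) \<noteq> (False, False, False) \<or> \<not> f" for e f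
    using assms that unfolding ex_bool_eq
    by (cases mv; cases mx; cases my; cases nv; cases nx; cases ny) auto
  from indep[OF trivial[of mv mx my av ax ay] trivial[of nv nx ny bv bx by']]
  obtain V X Y where VXY: "(((X \<and> mx) \<noteq> (V \<and> my)) \<noteq> (mv \<and> Y)) = hilbert_two av ax ay mv mx my"
    "(((X \<and> nx) \<noteq> (V \<and> ny)) \<noteq> (nv \<and> Y)) = hilbert_two bv bx by' nv nx ny"
    by (elim exE conjE)
  have e: "hilbert_two (a \<noteq> V) (b \<noteq> X) (c \<noteq> Y) v x y
      \<longleftrightarrow> hilbert_two a b c v x y \<noteq> (((X \<and> x) \<noteq> (V \<and> y)) \<noteq> (v \<and> Y))" for a b c v x y
    unfolding hilbert_two_def by (cases v; cases x; cases y; cases V; cases X; cases Y; cases a; cases b; simp)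
  have "\<not> hilbert_two (av \<noteq> V) (ax \<noteq> X) (ay \<noteq> Y) mv mx my"
    "\<not> hilbert_two (bv \<noteq> V) (bx \<noteq> X) (by' \<noteq> Y) nv nx ny"
    unfolding e VXY by simp_all
  then show ?thesis by blast
qed

text \<open>Outside 2, \<open>T\<close> and \<open>l\<close> all entries are units, so the product
  formula has a single unknown factor, the one at \<open>l\<close>.\<close>

lemma conic_locally_solvable_except_one:
  assumes T: "finite T" "\<And>p. p \<in> T \<Longrightarrow> prime p" "2 \<notin> T" and l: "prime l" "l \<noteq> 2" "l \<notin> T"
    and nz: "A \<noteq> 0" "m \<noteq> 0" "w \<noteq> 0"
    and dvd: "\<And>p. prime p \<Longrightarrow> p \<noteq> 2 \<Longrightarrow> int p dvd A * m \<Longrightarrow> p \<in> T"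
      "\<And>p. prime p \<Longrightarrow> int p dvd w \<Longrightarrow> p \<in> {2, l} \<union> T"
    and loc: "\<And>p. p \<in> insert 2 T \<Longrightarrow> \<not> hilbert p (A * w) m" "\<not> hilbert_inf (A * w) m"
  shows "conic_locally_solvable (A * w) m"
proof -
  have S: "finite (insert l T)" "\<And>p. p \<in> insert l T \<Longrightarrow> prime p" "2 \<notin> insert l T"
    using T l by auto
  have prod: "hilbert_product (insert l T) (A * w) m = 1"
  proof (rule hilbert_product_formula[OF S])
    fix p assume p: "prime p" "p \<noteq> 2" "int p dvd A * w * m"
    then have "int p dvd A * m \<or> int p dvd w" by (auto simp: prime_dvd_mult_iff)
    then show "p \<in> insert l T" using dvd p by blast
  qed (use nz in auto)
  have "(\<Prod>p\<in>T. sgn_bit (hilbert p (A * w) m)) = 1"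
    using loc(1) by (simp add: sgn_bit_def)
  then have "(\<Prod>p\<in>insert l T. sgn_bit (hilbert p (A * w) m)) = sgn_bit (hilbert l (A * w) m)"
    using T(1) l(3) by simp
  then have hl: "\<not> hilbert l (A * w) m"
    using prod loc by (auto simp: hilbert_product_def sgn_bit_def split: if_splits)
  have "\<not> hilbert p (A * w) m" if p: "prime p" "p \<noteq> 2" for p
  proof (cases "p \<in> insert l T")
    case True
    then show ?thesis using hl loc(1) by auto
  next
    case False
    then have "\<not> int p dvd A * m" "\<not> int p dvd w" using dvd p by blast+
    then have "\<not> int p dvd A * w" "\<not> int p dvd m" using p(1) by (auto simp: prime_dvd_mult_iff)
    then show ?thesis using hilbert_good_prime[OF p] unit_part_not_dvd[OF p(1)] by blast
  qed
  then show ?thesis using loc(2) by (simp add: conic_locally_solvable_def)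
qed

definition odd_class :: "nat \<Rightarrow> int \<Rightarrow> bool \<times> bool" where
  "odd_class p a = (odd_val p a, nonres p a)"

definition two_class :: "int \<Rightarrow> bool \<times> bool \<times> bool" where
  "two_class a = (odd_val 2 a, bit4 a, bit8 a)"

text \<open>This supplies u in Meyer's theorem, with \<open>c = a3 * a4 * a5\<close>. The new prime
  \<open>l\<close> and its odd valuation are reported because \<open>l\<close> becomes a bad prime
  for the choice of w.\<close>

lemma conic_slot_avoiding:
  assumes T: "finite T" "\<And>p. p \<in> T \<Longrightarrow> prime p" "2 \<notin> T"
    and nz: "A \<noteq> 0" "m \<noteq> 0"
    and dvd: "\<And>p. prime p \<Longrightarrow> p \<noteq> 2 \<Longrightarrow> int p dvd A * m \<Longrightarrow> p \<in> T"
    and neg: "\<not> ((A < 0 \<longleftrightarrow> \<not> neg) \<and> m < 0)"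
  shows "\<exists>u l. u \<noteq> 0 \<and> prime l \<and> l \<noteq> 2 \<and> l \<notin> T \<and> conic_locally_solvable (A * u) m
     \<and> (\<forall>p\<in>T. odd_class p u \<noteq> odd_class p c) \<and> two_class u \<noteq> two_class c \<and> (u < 0 \<longleftrightarrow> neg)
     \<and> odd_val l u \<and> (\<forall>p. prime p \<longrightarrow> int p dvd u \<longrightarrow> p \<in> {2, l} \<union> T)"
proof -
  have "\<forall>p. \<exists>VN. \<not> hilbert_odd (p mod 4 = 3) (odd_val p A \<noteq> fst VN) (nonres p A \<noteq> snd VN) (odd_val p m) (nonres p m)
      \<and> VN \<noteq> odd_class p c"
    unfolding odd_class_def split_paired_Ex fst_conv snd_conv using avoid_class_odd by blast
  then obtain VN where VN: "\<And>p. \<not> hilbert_odd (p mod 4 = 3) (odd_val p A \<noteq> fst (VN p)) (nonres p A \<noteq> snd (VN p)) (odd_val p m) (nonres p m)"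
      "\<And>p. VN p \<noteq> odd_class p c" by metis
  obtain v x y where 2: "\<not> hilbert_two (odd_val 2 A \<noteq> v) (bit4 A \<noteq> x) (bit8 A \<noteq> y) (odd_val 2 m) (bit4 m) (bit8 m)"
      "(v, x, y) \<noteq> two_class c"
    using avoid_class_two unfolding two_class_def by blast
  obtain u l where u: "u \<noteq> 0" and l: "prime l" "l \<noteq> 2" "l \<notin> T"
    and cls: "\<And>p. p \<in> T \<Longrightarrow> odd_val p u = fst (VN p) \<and> nonres p u = snd (VN p)" "odd_val 2 u = v" "bit4 u = x" "bit8 u = y"
    and rest: "u < 0 \<longleftrightarrow> neg" "odd_val l u" "\<And>p. prime p \<Longrightarrow> int p dvd u \<Longrightarrow> p \<in> {2, l} \<union> T"
    using integer_with_prescribed_classes[OF T, of "\<lambda>p. fst (VN p)" "\<lambda>p. snd (VN p)" v x y neg] by blast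
  have "\<not> hilbert p (A * u) m" if "p \<in> insert 2 T" for p
  proof (cases "p = 2")
    case True
    then show ?thesis using 2(1) cls nz u by (simp add: hilbert_def bits_mult)
  next
    case False
    then have "p \<in> T" "prime p" using that T by auto
    then show ?thesis using VN(1)[of p] cls(1)[of p] nz u False by (simp add: hilbert_def bits_mult)
  qed
  moreover have "\<not> hilbert_inf (A * u) m"
    using neg rest(1) nz u by (auto simp: hilbert_inf_def mult_less_0_iff)
  ultimately have "conic_locally_solvable (A * u) m"
    using conic_locally_solvable_except_one[OF T l nz u dvd rest(3)] by blast
  moreover have "odd_class p u \<noteq> odd_class p c" if "p \<in> T" for p
    using VN(2)[of p] cls(1)[OF that] by (auto simp: odd_class_def prod_eq_iff)
  moreover have "two_class u \<noteq> two_class c" using 2(2) cls by (simp add: two_class_def)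
  ultimately show ?thesis using u l rest by blast
qed

text \<open>This supplies w in Meyer's theorem. The class conditions on \<open>m\<close> and
  \<open>n\<close> make the two requirements on w compatible at each bad prime.\<close>

lemma common_conic_slot:
  assumes T: "finite T" "\<And>p. p \<in> T \<Longrightarrow> prime p" "2 \<notin> T"
    and nz: "A \<noteq> 0" "m \<noteq> 0" "B \<noteq> 0" "n \<noteq> 0"
    and dvd: "\<And>p. prime p \<Longrightarrow> p \<noteq> 2 \<Longrightarrow> int p dvd A * m \<Longrightarrow> p \<in> T"
      "\<And>p. prime p \<Longrightarrow> p \<noteq> 2 \<Longrightarrow> int p dvd B * n \<Longrightarrow> p \<in> T"
    and indep: "\<And>p. p \<in> T \<Longrightarrow> odd_class p m \<noteq> odd_class p n" "two_class m \<noteq> two_class n"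
    and neg: "\<not> ((A < 0 \<longleftrightarrow> \<not> neg) \<and> m < 0)" "\<not> ((B < 0 \<longleftrightarrow> \<not> neg) \<and> n < 0)"
  shows "\<exists>w. w \<noteq> 0 \<and> conic_locally_solvable (A * w) m \<and> conic_locally_solvable (B * w) n"
proof -
  let ?H = "\<lambda>A m p VN. \<not> hilbert_odd (p mod 4 = 3) (odd_val p A \<noteq> fst VN) (nonres p A \<noteq> snd VN) (odd_val p m) (nonres p m)"
  have "\<forall>p\<in>T. \<exists>VN. ?H A m p VN \<and> ?H B n p VN"
    unfolding split_paired_Ex fst_conv snd_conv using common_class_odd indep(1) unfolding odd_class_def by blast
  then obtain VN where VN: "\<And>p. p \<in> T \<Longrightarrow> ?H A m p (VN p) \<and> ?H B n p (VN p)" by metis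
  obtain v x y where 2: "\<not> hilbert_two (odd_val 2 A \<noteq> v) (bit4 A \<noteq> x) (bit8 A \<noteq> y) (odd_val 2 m) (bit4 m) (bit8 m)"
      "\<not> hilbert_two (odd_val 2 B \<noteq> v) (bit4 B \<noteq> x) (bit8 B \<noteq> y) (odd_val 2 n) (bit4 n) (bit8 n)"
    using common_class_two[OF indep(2)[unfolded two_class_def]] by blast
  obtain w l where w: "w \<noteq> 0" and l: "prime l" "l \<noteq> 2" "l \<notin> T"
    and cls: "\<And>p. p \<in> T \<Longrightarrow> odd_val p w = fst (VN p) \<and> nonres p w = snd (VN p)" "odd_val 2 w = v" "bit4 w = x" "bit8 w = y"
    and rest: "w < 0 \<longleftrightarrow> neg" "\<And>p. prime p \<Longrightarrow> int p dvd w \<Longrightarrow> p \<in> {2, l} \<union> T"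
    using integer_with_prescribed_classes[OF T, of "\<lambda>p. fst (VN p)" "\<lambda>p. snd (VN p)" v x y neg] by blast
  have "\<not> hilbert p (A * w) m \<and> \<not> hilbert p (B * w) n" if "p \<in> insert 2 T" for p
  proof (cases "p = 2")
    case True
    then show ?thesis using 2 cls nz w by (simp add: hilbert_def bits_mult)
  next
    case False
    then have "p \<in> T" "prime p" using that T by auto
    then show ?thesis using VN[of p] cls(1)[of p] nz w False by (simp add: hilbert_def bits_mult)
  qed
  moreover have "\<not> hilbert_inf (A * w) m" "\<not> hilbert_inf (B * w) n"
    using neg rest(1) nz w by (auto simp: hilbert_inf_def mult_less_0_iff)
  ultimately have "conic_locally_solvable (A * w) m" "conic_locally_solvable (B * w) n"
    using conic_locally_solvable_except_one[OF T l nz(1,2) w dvd(1) rest(2)]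
      conic_locally_solvable_except_one[OF T l nz(3,4) w dvd(2) rest(2)] by blast+
  then show ?thesis using w by blast
qed

text \<open>Multiplication of the representation by \<open>a\<close> turns it into (a x)^2 = a u z^2
  - a b y^2.\<close>

lemma conic_represents:
  assumes "conic_solvable (a * u) (- (a * b))" "a \<noteq> 0"
  shows "\<exists>x y z. (x, y, z) \<noteq> (0, 0, 0) \<and> a * x\<^sup>2 + b * y\<^sup>2 = u * z\<^sup>2"
proof -
  obtain x y z where xyz: "(x, y, z) \<noteq> (0, 0, 0)" "z\<^sup>2 = a * u * x\<^sup>2 + - (a * b) * y\<^sup>2"
    using assms(1) unfolding conic_solvable_def by blast
  have "a * z\<^sup>2 + b * (a * y)\<^sup>2 = u * (a * x)\<^sup>2"
    unfolding xyz(2) by (simp add: power2_eq_square algebra_simps)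
  then show ?thesis using xyz(1) assms(2) by (intro exI[of _ z] exI[of _ "a * y"] exI[of _ "a * x"]) auto
qed

theorem meyer:
  fixes a1 a2 a3 a4 a5 :: int
  assumes nz: "a1 \<noteq> 0" "a2 \<noteq> 0" "a3 \<noteq> 0" "a4 \<noteq> 0" "a5 \<noteq> 0"
    and indef: "\<not> (a1 > 0 \<and> a2 > 0 \<and> a3 > 0 \<and> a4 > 0 \<and> a5 > 0)"
      "\<not> (a1 < 0 \<and> a2 < 0 \<and> a3 < 0 \<and> a4 < 0 \<and> a5 < 0)"
  shows "\<exists>x1 x2 x3 x4 x5. (x1, x2, x3, x4, x5) \<noteq> (0, 0, 0, 0, 0)
    \<and> a1 * x1\<^sup>2 + a2 * x2\<^sup>2 + a3 * x3\<^sup>2 + a4 * x4\<^sup>2 + a5 * x5\<^sup>2 = 0"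
proof -
  define T where "T = {p. prime p \<and> p \<noteq> 2 \<and> int p dvd a1 * a2 * a3 * a4 * a5}"
  have "T \<subseteq> {..nat \<bar>a1 * a2 * a3 * a4 * a5\<bar>}"
  proof
    fix p assume "p \<in> T"
    then have "int p dvd a1 * a2 * a3 * a4 * a5" by (simp add: T_def)
    then have "\<bar>int p\<bar> \<le> \<bar>a1 * a2 * a3 * a4 * a5\<bar>" by (rule dvd_imp_le_int[rotated]) (use nz in simp)
    then show "p \<in> {..nat \<bar>a1 * a2 * a3 * a4 * a5\<bar>}" by simp
  qed
  then have T: "finite T" "\<And>p. p \<in> T \<Longrightarrow> prime p" "2 \<notin> T"
    by (auto simp: T_def intro: finite_subset)
  have inT: "p \<in> T" if "prime p" "p \<noteq> 2" "int p dvd a1 \<or> int p dvd a2 \<or> int p dvd a3 \<or> int p dvd a4 \<or> int p dvd a5" for p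
    using that by (auto simp: T_def)
  \<comment> \<open>The sign of u. When a3, a4, a5 agree in sign, u must have the opposite one, and
    indefiniteness ensures that a1 or a2 has it too. Otherwise the sign of a1 will do.\<close>
  define neg where "neg \<longleftrightarrow> (if (a3 < 0 \<longleftrightarrow> a4 < 0) \<and> (a3 < 0 \<longleftrightarrow> a5 < 0) then \<not> a3 < 0 else a1 < 0)"
  have neg1: "\<not> ((a1 < 0 \<longleftrightarrow> \<not> neg) \<and> - (a1 * a2) < 0)"
    using nz indef by (auto simp: neg_def zero_less_mult_iff)
  have nz12: "- (a1 * a2) \<noteq> 0" using nz by simp
  have dvd12: "p \<in> T" if "prime p" "p \<noteq> 2" "int p dvd a1 * - (a1 * a2)" for p
    using that inT[of p] by (auto simp: prime_dvd_mult_iff)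
  obtain u l where u: "u \<noteq> 0" "prime l" "l \<noteq> 2" "l \<notin> T" "conic_locally_solvable (a1 * u) (- (a1 * a2))"
      "\<And>p. p \<in> T \<Longrightarrow> odd_class p u \<noteq> odd_class p (a3 * a4 * a5)" "two_class u \<noteq> two_class (a3 * a4 * a5)"
      "u < 0 \<longleftrightarrow> neg" "odd_val l u" "\<And>p. prime p \<Longrightarrow> int p dvd u \<Longrightarrow> p \<in> {2, l} \<union> T"
    using conic_slot_avoiding[OF T nz(1) nz12 dvd12 neg1, of "a3 * a4 * a5"] by blast
  have dvd: "p \<in> insert l T"
    if "prime p" "p \<noteq> 2" "int p dvd a3 * - (a3 * a4) \<or> int p dvd - a5 * - (a5 * u)" for p
    using that u(10)[of p] inT[of p] by (auto simp: prime_dvd_mult_iff)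
  have bit_iff: "f (- (a3 * a4)) = f (- (a5 * u)) \<longleftrightarrow> f u = f (a3 * a4 * a5)"
    if f: "\<And>x y. x \<noteq> 0 \<Longrightarrow> y \<noteq> 0 \<Longrightarrow> f (x * y) \<longleftrightarrow> (f x \<noteq> f y)" for f :: "int \<Rightarrow> bool"
    using f[of "-1" "a3 * a4"] f[of a3 a4] f[of "-1" "a5 * u"] f[of a5 u] f[of "a3 * a4" a5] nz u(1)
    by (cases "f (-1)"; cases "f a3"; cases "f a4"; cases "f a5"; cases "f u"; simp)
  \<comment> \<open>At primes of \<open>T\<close> this is the avoidance of the class of a3 a4 a5. At
    \<open>l\<close> the first entry is a unit and the second has odd valuation, so no choice was
    necessary.\<close>
  have cls: "odd_class p (- (a3 * a4)) \<noteq> odd_class p (- (a5 * u))" if p: "p \<in> insert l T" for p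
  proof (cases "p = l")
    case True
    have good: "\<not> odd_val l z" if "\<not> int l dvd z" for z
      using unit_part_not_dvd(2)[OF u(2) that] by blast
    have "\<not> int l dvd - (a3 * a4)" "\<not> int l dvd - a5"
      using inT[OF u(2,3)] u(2,4) by (auto simp: prime_dvd_mult_iff)
    then have "\<not> odd_val l (- (a3 * a4))" "\<not> odd_val l (- a5)"
      using good by blast+
    moreover have "odd_val l (- a5 * u)"
      using u(9) odd_val_mult[OF u(2), of "- a5" u] nz u(1) calculation(2) by simp
    ultimately show ?thesis using True by (simp add: odd_class_def)
  next
    case False
    then have pT: "p \<in> T" "prime p" "p \<noteq> 2" using p T by auto
    then show ?thesis
      using u(6)[OF pT(1)] bit_iff[OF odd_val_mult[OF pT(2)]] bit_iff[OF nonres_mult[OF pT(2,3)]]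
      unfolding odd_class_def prod.inject by blast
  qed
  have cls2: "two_class (- (a3 * a4)) \<noteq> two_class (- (a5 * u))"
    using u(7) bit_iff[OF odd_val_mult[OF two_is_prime_nat]] bit_iff[OF bit4_mult] bit_iff[OF bit8_mult]
    unfolding two_class_def prod.inject by blast
  have neg2: "\<exists>neg'. \<not> ((a3 < 0 \<longleftrightarrow> \<not> neg') \<and> - (a3 * a4) < 0) \<and> \<not> ((- a5 < 0 \<longleftrightarrow> \<not> neg') \<and> - (a5 * u) < 0)"
    using nz u(1,8) unfolding neg_def ex_bool_eq by (auto simp: zero_less_mult_iff split: if_splits)
  obtain w where w: "w \<noteq> 0" "conic_locally_solvable (a3 * w) (- (a3 * a4))" "conic_locally_solvable (- a5 * w) (- (a5 * u))"
  proof -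
    obtain neg' where "\<not> ((a3 < 0 \<longleftrightarrow> \<not> neg') \<and> - (a3 * a4) < 0)" "\<not> ((- a5 < 0 \<longleftrightarrow> \<not> neg') \<and> - (a5 * u) < 0)"
      using neg2 by blast
    moreover have "finite (insert l T)" "\<And>p. p \<in> insert l T \<Longrightarrow> prime p" "2 \<notin> insert l T" using T u by auto
    moreover have "- (a3 * a4) \<noteq> 0" "- a5 \<noteq> 0" "- (a5 * u) \<noteq> 0" using nz u(1) by simp_all
    ultimately show ?thesis
      using common_conic_slot[of "insert l T" a3 "- (a3 * a4)" "- a5" "- (a5 * u)" neg'] nz(3) dvd cls cls2 that
      by blast
  qed
  obtain x1 x2 x3 where x: "(x1, x2, x3) \<noteq> (0, 0, 0)" "a1 * x1\<^sup>2 + a2 * x2\<^sup>2 = u * x3\<^sup>2"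
    using conic_represents[OF legendre[OF _ _ u(5)]] nz u(1) by auto
  obtain y1 y2 y3 where y: "(y1, y2, y3) \<noteq> (0, 0, 0)" "a3 * y1\<^sup>2 + a4 * y2\<^sup>2 = w * y3\<^sup>2"
    using conic_represents[OF legendre[OF _ _ w(2)]] nz w(1) by auto
  have "- (a5 * u) = - (- a5 * - u)" by simp
  then obtain z1 z2 z3 where z: "(z1, z2, z3) \<noteq> (0, 0, 0)" "- a5 * z1\<^sup>2 + - u * z2\<^sup>2 = w * z3\<^sup>2"
    using conic_represents[of "- a5" w "- u"] legendre[OF _ _ w(3)] nz u(1) w(1) by auto
  \<comment> \<open>If \<open>x3\<close> or \<open>y3\<close> vanishes, a binary subform already has
    a zero. Otherwise the representations of multiples of u and w by square factors are scaled to
    fit u z2^2 + w z3^2 + a5 z1^2 = 0.\<close>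
  consider "x3 = 0" | "y3 = 0" | "x3 \<noteq> 0" "y3 \<noteq> 0" by blast
  then show ?thesis
  proof cases
    case 1
    then show ?thesis using x
      by (intro exI[of _ x1] exI[of _ x2] exI[of _ 0]) auto
  next
    case 2
    then show ?thesis using y
      by (intro exI[of _ 0] exI[of _ y1] exI[of _ y2]) (auto intro!: exI[of _ "0::int"])
  next
    case 3
    have "a1 * (z2 * y3 * x1)\<^sup>2 + a2 * (z2 * y3 * x2)\<^sup>2 + a3 * (z3 * x3 * y1)\<^sup>2 + a4 * (z3 * x3 * y2)\<^sup>2 + a5 * (z1 * x3 * y3)\<^sup>2
      = (z2 * y3)\<^sup>2 * (a1 * x1\<^sup>2 + a2 * x2\<^sup>2) + (z3 * x3)\<^sup>2 * (a3 * y1\<^sup>2 + a4 * y2\<^sup>2) + a5 * (z1 * x3 * y3)\<^sup>2"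
      by (simp add: power_mult_distrib algebra_simps)
    also have "\<dots> = (x3 * y3)\<^sup>2 * (u * z2\<^sup>2 + w * z3\<^sup>2 + a5 * z1\<^sup>2)"
      unfolding x(2) y(2) by (simp add: power_mult_distrib algebra_simps)
    also have "u * z2\<^sup>2 + w * z3\<^sup>2 + a5 * z1\<^sup>2 = 0" using z(2) by simp
    finally have eq: "a1 * (z2 * y3 * x1)\<^sup>2 + a2 * (z2 * y3 * x2)\<^sup>2 + a3 * (z3 * x3 * y1)\<^sup>2 + a4 * (z3 * x3 * y2)\<^sup>2 + a5 * (z1 * x3 * y3)\<^sup>2 = 0"
      by simp
    have "x1 \<noteq> 0 \<or> x2 \<noteq> 0" using x(2) 3 u(1) by auto
    moreover have "y1 \<noteq> 0 \<or> y2 \<noteq> 0" using y(2) 3 w(1) by auto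
    ultimately have "(z2 * y3 * x1, z2 * y3 * x2, z3 * x3 * y1, z3 * x3 * y2, z1 * x3 * y3) \<noteq> (0, 0, 0, 0, 0)"
      using z(1) 3 by auto
    with eq show ?thesis by blast
  qed
qed

text \<open>An isotropic quaternary form represents everything, so the last coordinate can be made nonzero.\<close>

lemma isotropic_represents:
  fixes a b c d e x y z t :: int
  assumes "a * x\<^sup>2 + b * y\<^sup>2 + c * z\<^sup>2 + d * t\<^sup>2 = 0" "x \<noteq> 0" "a \<noteq> 0"
  shows "\<exists>x y z t s. s \<noteq> 0 \<and> a * x\<^sup>2 + b * y\<^sup>2 + c * z\<^sup>2 + d * t\<^sup>2 + e * s\<^sup>2 = 0"
proof -
  \<comment> \<open>For the isotropic vector v and the first unit vector, k v + s e1 has value 2 a x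
    k s + a s^2. Taking s = 2 a x makes this (k + a) s^2, which dictates k.\<close>
  define s k where "s = 2 * a * x" and "k = - e - a"
  have "a * (k * x + s)\<^sup>2 + b * (k * y)\<^sup>2 + c * (k * z)\<^sup>2 + d * (k * t)\<^sup>2 + e * s\<^sup>2
     = k\<^sup>2 * (a * x\<^sup>2 + b * y\<^sup>2 + c * z\<^sup>2 + d * t\<^sup>2) + (k * (2 * a * x) * s + a * s\<^sup>2 + e * s\<^sup>2)"
    by (simp add: power2_eq_square algebra_simps)
  also have "2 * a * x = s" by (simp add: s_def)
  also have "k\<^sup>2 * (a * x\<^sup>2 + b * y\<^sup>2 + c * z\<^sup>2 + d * t\<^sup>2) + (k * s * s + a * s\<^sup>2 + e * s\<^sup>2) = 0"
    unfolding assms(1) by (simp add: k_def power2_eq_square algebra_simps)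
  finally show ?thesis using assms(2,3) by (intro exI[of _ "k * x + s"] exI exI[of _ s] conjI) (auto simp: s_def)
qed

lemma meyer_last_nonzero:
  fixes a1 a2 a3 a4 a5 :: int
  assumes nz: "a1 \<noteq> 0" "a2 \<noteq> 0" "a3 \<noteq> 0" "a4 \<noteq> 0" "a5 \<noteq> 0"
    and indef: "\<not> (a1 > 0 \<and> a2 > 0 \<and> a3 > 0 \<and> a4 > 0 \<and> a5 > 0)"
      "\<not> (a1 < 0 \<and> a2 < 0 \<and> a3 < 0 \<and> a4 < 0 \<and> a5 < 0)"
  shows "\<exists>x1 x2 x3 x4 x5. x5 \<noteq> 0 \<and> a1 * x1\<^sup>2 + a2 * x2\<^sup>2 + a3 * x3\<^sup>2 + a4 * x4\<^sup>2 + a5 * x5\<^sup>2 = 0"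
proof -
  obtain x1 x2 x3 x4 x5 where x: "(x1, x2, x3, x4, x5) \<noteq> (0, 0, 0, 0, 0)"
    "a1 * x1\<^sup>2 + a2 * x2\<^sup>2 + a3 * x3\<^sup>2 + a4 * x4\<^sup>2 + a5 * x5\<^sup>2 = 0"
    using meyer[OF assms] by blast
  consider "x5 \<noteq> 0" | "x5 = 0" "x1 \<noteq> 0" | "x5 = 0" "x2 \<noteq> 0" | "x5 = 0" "x3 \<noteq> 0" | "x5 = 0" "x4 \<noteq> 0"
    using x(1) by auto
  then show ?thesis
  proof cases
    case 1 then show ?thesis using x(2) by blast
  next
    case 2 then show ?thesis using isotropic_represents[of a1 x1 a2 x2 a3 x3 a4 x4 a5] x(2) nz by auto
  next
    case 3
    then obtain y2 y1 y3 y4 s where "s \<noteq> 0" "a2 * y2\<^sup>2 + a1 * y1\<^sup>2 + a3 * y3\<^sup>2 + a4 * y4\<^sup>2 + a5 * s\<^sup>2 = 0"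
      using isotropic_represents[of a2 x2 a1 x1 a3 x3 a4 x4 a5] x(2) nz by auto
    then have "s \<noteq> 0 \<and> a1 * y1\<^sup>2 + a2 * y2\<^sup>2 + a3 * y3\<^sup>2 + a4 * y4\<^sup>2 + a5 * s\<^sup>2 = 0" by simp
    then show ?thesis by blast
  next
    case 4
    then obtain y3 y1 y2 y4 s where "s \<noteq> 0" "a3 * y3\<^sup>2 + a1 * y1\<^sup>2 + a2 * y2\<^sup>2 + a4 * y4\<^sup>2 + a5 * s\<^sup>2 = 0"
      using isotropic_represents[of a3 x3 a1 x1 a2 x2 a4 x4 a5] x(2) nz by auto
    then have "s \<noteq> 0 \<and> a1 * y1\<^sup>2 + a2 * y2\<^sup>2 + a3 * y3\<^sup>2 + a4 * y4\<^sup>2 + a5 * s\<^sup>2 = 0" by simp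
    then show ?thesis by blast
  next
    case 5
    then obtain y4 y1 y2 y3 s where "s \<noteq> 0" "a4 * y4\<^sup>2 + a1 * y1\<^sup>2 + a2 * y2\<^sup>2 + a3 * y3\<^sup>2 + a5 * s\<^sup>2 = 0"
      using isotropic_represents[of a4 x4 a1 x1 a2 x2 a3 x3 a5] x(2) nz by auto
    then have "s \<noteq> 0 \<and> a1 * y1\<^sup>2 + a2 * y2\<^sup>2 + a3 * y3\<^sup>2 + a4 * y4\<^sup>2 + a5 * s\<^sup>2 = 0" by simp
    then show ?thesis by blast
  qed
qed

section \<open>Van der Waerden's theorem\<close>

text \<open>The bound \<open>d \<le> N\<close> is not implied when k = 0. It keeps the next term a +
  (k + 1) d below 2 N, as colour focusing requires.\<close>

definition van_der_waerden :: "nat \<Rightarrow> nat \<Rightarrow> nat \<Rightarrow> bool" where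
  "van_der_waerden k r N \<longleftrightarrow> (\<forall>f :: nat \<Rightarrow> nat. card (f ` {..<N}) \<le> r \<longrightarrow>
     (\<exists>a d. 0 < d \<and> d \<le> N \<and> a + k * d < N \<and> (\<forall>i\<le>k. f (a + i * d) = f a)))"

text \<open>
  Colour focusing: \<open>A j, A j + D j, \<dots>, A j + k D j\<close> for \<open>j < s\<close> are monochromatic in \<open>s\<close>
  distinct colours, and all have the same next term \<open>\<phi>\<close>.
\<close>

definition focused :: "nat \<Rightarrow> nat \<Rightarrow> (nat \<Rightarrow> nat) \<Rightarrow> nat \<Rightarrow> (nat \<Rightarrow> nat) \<Rightarrow> (nat \<Rightarrow> nat) \<Rightarrow> bool" where
  "focused k s f \<phi> A D \<longleftrightarrow> (\<forall>j<s. 0 < D j \<and> A j + Suc k * D j = \<phi> \<and> (\<forall>i\<le>k. f (A j + i * D j) = f (A j)))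
     \<and> inj_on (\<lambda>j. f (A j)) {..<s}"

text \<open>Each old progression is spread diagonally over the blocks with step d N + D j, the
  copies of the focus form a progression with step d N in a new colour, and all of them meet in
  block a + (k + 1) d.\<close>

lemma focused_extend:
  assumes foc: "focused k s (\<lambda>x. f (a * N + x)) \<phi> A D" and "d > 0" "\<phi> < N" "N > 0"
    and block: "\<And>i x. i \<le> k \<Longrightarrow> x < N \<Longrightarrow> f ((a + i * d) * N + x) = f (a * N + x)"
    and new: "\<And>j. j < s \<Longrightarrow> f (a * N + A j) \<noteq> f (a * N + \<phi>)"
  shows "focused k (Suc s) f ((a + Suc k * d) * N + \<phi>)
    (\<lambda>j. if j < s then a * N + A j else a * N + \<phi>) (\<lambda>j. if j < s then d * N + D j else d * N)"
proof -
  have old: "f (a * N + A j + i * (d * N + D j)) = f (a * N + A j)"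
    "0 < D j" "A j + Suc k * D j = \<phi>" if "j < s" "i \<le> k" for i j
  proof -
    show j: "0 < D j" "A j + Suc k * D j = \<phi>" using foc that by (auto simp: focused_def)
    have "i * D j \<le> Suc k * D j" using that by (intro mult_le_mono) auto
    then have lt: "A j + i * D j < N" using j(2) \<open>\<phi> < N\<close> by linarith
    have "f (a * N + A j + i * (d * N + D j)) = f ((a + i * d) * N + (A j + i * D j))"
      by (rule arg_cong[where f = f]) (simp add: algebra_simps)
    also have "\<dots> = f (a * N + (A j + i * D j))" using block[OF that(2) lt] .
    also have "\<dots> = f (a * N + A j)" using foc that by (auto simp: focused_def)
    finally show "f (a * N + A j + i * (d * N + D j)) = f (a * N + A j)" .
  qed
  have eqs: "a * N + A j + Suc k * (d * N + D j) = (a + Suc k * d) * N + \<phi>" if "j < s" for j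
  proof -
    have "a * N + A j + Suc k * (d * N + D j) = (a + Suc k * d) * N + (A j + Suc k * D j)"
      by (simp add: algebra_simps)
    then show ?thesis using old(3)[OF that, of 0] by simp
  qed
  have last: "f (a * N + \<phi> + i * (d * N)) = f (a * N + \<phi>)" if "i \<le> k" for i
  proof -
    have "a * N + \<phi> + i * (d * N) = (a + i * d) * N + \<phi>" by (simp add: algebra_simps)
    then show ?thesis using block[OF that \<open>\<phi> < N\<close>] by (simp only:)
  qed
  have inj: "inj_on (\<lambda>j. f (if j < s then a * N + A j else a * N + \<phi>)) {..<Suc s}"
  proof (rule inj_onI)
    fix i j assume ij: "i \<in> {..<Suc s}" "j \<in> {..<Suc s}"
      "f (if i < s then a * N + A i else a * N + \<phi>) = f (if j < s then a * N + A j else a * N + \<phi>)"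
    have inj: "inj_on (\<lambda>j. f (a * N + A j)) {..<s}" using foc by (simp add: focused_def)
    consider "i < s" "j < s" | "i < s" "j = s" | "i = s" "j < s" | "i = s" "j = s"
      using ij(1,2) by force
    then show "i = j"
    proof cases
      case 1
      then show ?thesis using ij(3) inj_onD[OF inj, of i j] by simp
    next
      case 2
      then show ?thesis using ij(3) new[of i] by simp
    next
      case 3
      then show ?thesis using ij(3) new[of j] by simp
    qed simp
  qed
  have eq_last: "a * N + \<phi> + Suc k * (d * N) = (a + Suc k * d) * N + \<phi>" by (simp add: algebra_simps)
  show ?thesis
    unfolding focused_def
  proof (intro conjI allI impI inj)
    fix j assume "j < Suc s"
    show "0 < (if j < s then d * N + D j else d * N)" using assms by simp
    show "(if j < s then a * N + A j else a * N + \<phi>) + Suc k * (if j < s then d * N + D j else d * N)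
       = (a + Suc k * d) * N + \<phi>" using eqs eq_last by simp
    fix i assume "i \<le> k"
    then show "f ((if j < s then a * N + A j else a * N + \<phi>) + i * (if j < s then d * N + D j else d * N))
      = f (if j < s then a * N + A j else a * N + \<phi>)" using old(1)[of j i] last[of i] by simp
  qed
qed

text \<open>Induction on \<open>s\<close>. The hypothesis is applied to whole blocks of length N,
  which show up to r^N colour patterns; hence \<open>IH\<close> has to cover every number of
  colours.\<close>

lemma focusing:
  assumes IH: "\<And>r. \<exists>N. van_der_waerden k r N"
  shows "\<exists>N>0. \<forall>f :: nat \<Rightarrow> nat. card (f ` {..<N}) \<le> r \<longrightarrow>
     (\<exists>a d. 0 < d \<and> a + Suc k * d < N \<and> (\<forall>i\<le>Suc k. f (a + i * d) = f a))
     \<or> (\<exists>\<phi> A D. \<phi> < N \<and> focused k s f \<phi> A D)"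
proof (induction s)
  case 0
  show ?case by (intro exI[of _ 1]) (auto simp: focused_def)
next
  case (Suc s)
  obtain N where N: "N > 0" and focN: "\<And>f :: nat \<Rightarrow> nat. card (f ` {..<N}) \<le> r \<Longrightarrow>
     (\<exists>a d. 0 < d \<and> a + Suc k * d < N \<and> (\<forall>i\<le>Suc k. f (a + i * d) = f a))
     \<or> (\<exists>\<phi> A D. \<phi> < N \<and> focused k s f \<phi> A D)" using Suc by blast
  obtain W where W: "van_der_waerden k (r ^ N) W" using IH by blast
  \<comment> \<open>The monochromatic blocks lie among the first W, while the new focus lies in
    block a + (k + 1) d, which is below 2 W.\<close>
  define N2 where "N2 = 2 * W * N + N"
  show ?case
  proof (intro exI[of _ N2] conjI allI impI)
    show "N2 > 0" using N by (simp add: N2_def)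
  next
    fix f :: "nat \<Rightarrow> nat" assume f: "card (f ` {..<N2}) \<le> r"
    define g where "g i = to_nat (map (\<lambda>x. f (i * N + x)) [0..<N])" for i
    have in_range: "i * N + x < N2" if "i < 2 * W" "x < N" for i x
    proof -
      have "i * N \<le> 2 * W * N" using that by (intro mult_le_mono1) simp
      then show ?thesis using that(2) unfolding N2_def by linarith
    qed
    have "g ` {..<W} \<subseteq> to_nat ` {xs. set xs \<subseteq> f ` {..<N2} \<and> length xs = N}"
      using in_range by (force simp: g_def)
    then have "card (g ` {..<W}) \<le> card (to_nat ` {xs. set xs \<subseteq> f ` {..<N2} \<and> length xs = N})"
      by (intro card_mono finite_imageI finite_lists_length_eq) auto
    also have "\<dots> \<le> card {xs. set xs \<subseteq> f ` {..<N2} \<and> length xs = N}"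
      by (intro card_image_le finite_lists_length_eq) auto
    also have "\<dots> = card (f ` {..<N2}) ^ N" by (rule card_lists_length_eq) simp
    also have "\<dots> \<le> r ^ N" using f by (intro power_mono) auto
    finally obtain a d where ad: "0 < d" "d \<le> W" "a + k * d < W" "\<And>i. i \<le> k \<Longrightarrow> g (a + i * d) = g a"
      using W unfolding van_der_waerden_def by blast
    have block: "f ((a + i * d) * N + x) = f (a * N + x)" if "i \<le> k" "x < N" for i x
    proof -
      have "map (\<lambda>x. f ((a + i * d) * N + x)) [0..<N] = map (\<lambda>x. f (a * N + x)) [0..<N]"
        using ad(4)[OF that(1)] unfolding g_def by (simp only: inj_eq[OF inj_to_nat])
      then show ?thesis using that(2) by (simp only: map_eq_conv set_upt) (auto simp: algebra_simps)
    qed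
    let ?f = "\<lambda>x. f (a * N + x)"
    have aW: "a < 2 * W" "a + Suc k * d < 2 * W" using ad by (simp_all add: trans_less_add1)
    have "?f ` {..<N} \<subseteq> f ` {..<N2}" using in_range[OF aW(1)] by auto
    then have "card (?f ` {..<N}) \<le> r" using f card_mono[of "f ` {..<N2}" "?f ` {..<N}"] by simp
    from focN[OF this]
    show "(\<exists>a d. 0 < d \<and> a + Suc k * d < N2 \<and> (\<forall>i\<le>Suc k. f (a + i * d) = f a))
     \<or> (\<exists>\<phi> A D. \<phi> < N2 \<and> focused k (Suc s) f \<phi> A D)"
    proof (elim disjE exE conjE)
      fix b e assume be: "0 < e" "b + Suc k * e < N" "\<forall>i\<le>Suc k. ?f (b + i * e) = ?f b"
      have "a * N + (b + Suc k * e) < N2" using in_range[OF aW(1) be(2)] .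
      then show ?thesis using be by (intro disjI1 exI[of _ "a * N + b"] exI[of _ e]) (auto simp: add.assoc)
    next
      fix \<phi> A D assume foc: "\<phi> < N" "focused k s ?f \<phi> A D"
      show ?thesis
      proof (cases "\<exists>j<s. ?f (A j) = ?f \<phi>")
        case True
        then obtain j where j: "j < s" "?f (A j) = ?f \<phi>" by blast
        have D: "0 < D j" "A j + Suc k * D j = \<phi>" "\<And>i. i \<le> k \<Longrightarrow> ?f (A j + i * D j) = ?f (A j)"
          using foc(2) j(1) by (auto simp: focused_def)
        have "?f (A j + i * D j) = ?f (A j)" if "i \<le> Suc k" for i
          using D(2) D(3)[of i] j(2) that by (cases "i = Suc k") auto
        moreover have "a * N + (A j + Suc k * D j) < N2" using in_range[OF aW(1)] D(2) foc(1) by simp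
        ultimately show ?thesis using D(1)
          by (intro disjI1 exI[of _ "a * N + A j"] exI[of _ "D j"]) (auto simp: add.assoc)
      next
        case False
        then show ?thesis
          using focused_extend[OF foc(2) ad(1) foc(1) N block] in_range[OF aW(2) foc(1)] by blast
      qed
    qed
  qed
qed

theorem van_der_waerden: "\<exists>N. van_der_waerden k r N"
proof (induction k arbitrary: r)
  case 0
  show ?case unfolding van_der_waerden_def by (intro exI[of _ 1]) (auto intro!: exI[of _ 0] exI[of _ "Suc 0"])
next
  case (Suc k)
  obtain N where N: "\<And>f :: nat \<Rightarrow> nat. card (f ` {..<N}) \<le> r \<Longrightarrow>
     (\<exists>a d. 0 < d \<and> a + Suc k * d < N \<and> (\<forall>i\<le>Suc k. f (a + i * d) = f a))
     \<or> (\<exists>\<phi> A D. \<phi> < N \<and> focused k (Suc r) f \<phi> A D)"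
    using focusing[OF Suc, of r "Suc r"] by blast
  \<comment> \<open>Pigeonhole: r + 1 focused progressions would use r + 1 colours.\<close>
  have "\<not> (\<phi> < N \<and> focused k (Suc r) f \<phi> A D)" if f: "card (f ` {..<N}) \<le> r" for f :: "nat \<Rightarrow> nat" and \<phi> A D
  proof
    assume foc: "\<phi> < N \<and> focused k (Suc r) f \<phi> A D"
    have "(\<lambda>j. f (A j)) ` {..<Suc r} \<subseteq> f ` {..<N}"
    proof (rule image_subsetI)
      fix j assume "j \<in> {..<Suc r}"
      then have "A j + Suc k * D j = \<phi>" using foc by (auto simp: focused_def)
      then have "A j < N" using foc by linarith
      then show "f (A j) \<in> f ` {..<N}" by simp
    qed
    then have "card ((\<lambda>j. f (A j)) ` {..<Suc r}) \<le> card (f ` {..<N})" by (intro card_mono) auto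
    moreover have "card ((\<lambda>j. f (A j)) ` {..<Suc r}) = Suc r"
      using foc by (subst card_image) (auto simp: focused_def)
    ultimately show False using f by simp
  qed
  then have "\<exists>a d. 0 < d \<and> a + Suc k * d < N \<and> (\<forall>i\<le>Suc k. f (a + i * d) = f a)"
    if "card (f ` {..<N}) \<le> r" for f :: "nat \<Rightarrow> nat" using N[OF that] that by blast
  moreover have "d \<le> N" if "a + Suc k * d < N" for a d using that by (simp add: algebra_simps)
  ultimately show ?case unfolding van_der_waerden_def by meson
qed

section \<open>Balanced vectors\<close>

text \<open>The indicator vector of \<open>I1\<close> is isotropic, lies in the hyperplane and is
  not orthogonal to the vector c_k e_i - c_i e_k of the hyperplane. Together they represent every
  value up to squares, without Meyer's theorem.\<close>

lemma balanced_vector_zero_subsum: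
  fixes c :: "nat \<Rightarrow> int"
  assumes I: "finite I" and nz: "\<And>i. i \<in> I \<Longrightarrow> c i \<noteq> 0" and sum0: "(\<Sum>i\<in>I. c i) = 0"
    and I1: "I1 \<subset> I" "I1 \<noteq> {}" "(\<Sum>i\<in>I1. c i) = 0"
  shows "\<exists>b m. m > 0 \<and> (\<Sum>i\<in>I. c i * b i) = 0 \<and> (\<Sum>i\<in>I. c i * (b i)\<^sup>2) + C * m\<^sup>2 = 0"
proof -
  obtain i k where ik: "i \<in> I1" "k \<in> I" "k \<notin> I1" using I1 by blast
  then have "i \<in> I" "i \<noteq> k" using I1 by auto
  \<comment> \<open>\<open>b\<close> is \<alpha> times the indicator plus \<beta> times the other
    vector. As 2 c_i c_k is twice their inner product, taking it for \<beta> makes the value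
    \<beta>^2 times an expression linear in \<alpha>.\<close>
  define \<beta> \<alpha> where "\<beta> = 2 * c i * c k" and "\<alpha> = - C - (c i * (c k)\<^sup>2 + c k * (c i)\<^sup>2)"
  define b where "b j = (if j \<in> I1 then \<alpha> else 0) + (if j = i then \<beta> * c k else 0) - (if j = k then \<beta> * c i else 0)" for j
  have I1_sum: "(\<Sum>j\<in>I. if j \<in> I1 then x * c j else 0) = 0" for x
  proof -
    have "(\<Sum>j\<in>I. if j \<in> I1 then x * c j else 0) = (\<Sum>j\<in>I1. x * c j)"
      using I I1(1) by (intro sum.mono_neutral_cong_right) auto
    then show ?thesis using I1(3) by (simp add: sum_distrib_left[symmetric])
  qed
  have "(\<Sum>j\<in>I. c j * b j) = (\<Sum>j\<in>I. (if j \<in> I1 then \<alpha> * c j else 0) + (if j = i then c i * \<beta> * c k else 0)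
      - (if j = k then c k * \<beta> * c i else 0))"
    by (intro sum.cong) (auto simp: b_def algebra_simps)
  also have "\<dots> = 0"
    using I \<open>i \<in> I\<close> ik(2) by (simp add: sum.distrib sum_subtractf I1_sum)
  finally have lin: "(\<Sum>j\<in>I. c j * b j) = 0" .
  have "(\<Sum>j\<in>I. c j * (b j)\<^sup>2) = (\<Sum>j\<in>I. (if j \<in> I1 then \<alpha>\<^sup>2 * c j else 0)
      + (if j = i then c i * (2 * \<alpha> * \<beta> * c k + \<beta>\<^sup>2 * (c k)\<^sup>2) else 0) + (if j = k then c k * (\<beta>\<^sup>2 * (c i)\<^sup>2) else 0))"
    using ik(1,3) by (intro sum.cong) (auto simp: b_def power2_eq_square algebra_simps)
  also have "\<dots> = c i * (2 * \<alpha> * \<beta> * c k + \<beta>\<^sup>2 * (c k)\<^sup>2) + c k * (\<beta>\<^sup>2 * (c i)\<^sup>2)"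
    using I \<open>i \<in> I\<close> ik(2) by (simp add: sum.distrib I1_sum)
  also have "\<dots> = \<alpha> * (2 * c i * c k) * \<beta> + \<beta>\<^sup>2 * (c i * (c k)\<^sup>2 + c k * (c i)\<^sup>2)"
    by (simp add: algebra_simps)
  also have "\<dots> = \<beta>\<^sup>2 * (\<alpha> + (c i * (c k)\<^sup>2 + c k * (c i)\<^sup>2))"
    unfolding \<beta>_def[symmetric] by (simp add: power2_eq_square algebra_simps)
  also have "\<dots> = - (C * \<bar>\<beta>\<bar>\<^sup>2)" by (simp add: \<alpha>_def)
  finally have "(\<Sum>j\<in>I. c j * (b j)\<^sup>2) + C * \<bar>\<beta>\<bar>\<^sup>2 = 0" by simp
  moreover have "\<bar>\<beta>\<bar> > 0" using nz \<open>i \<in> I\<close> ik by (simp add: \<beta>_def)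
  ultimately show ?thesis using lin by blast
qed

text \<open>
  The vectors \<open>(c\<^sub>k\<^sub>+\<^sub>1, \<dots>, c\<^sub>k\<^sub>+\<^sub>1, - \<sigma>\<^sub>k, 0, \<dots>)\<close> with \<open>\<sigma>\<^sub>k = c\<^sub>1 + \<dots> + c\<^sub>k\<close> are orthogonal
  to each other and to \<open>(1, \<dots>, 1)\<close> for the form \<open>\<Sum> c\<^sub>i x\<^sub>i\<^sup>2\<close>, with values \<open>\<sigma>\<^sub>k \<sigma>\<^sub>k\<^sub>+\<^sub>1 c\<^sub>k\<^sub>+\<^sub>1\<close>.
  The two identities below add one such vector at a time.
\<close>

lemma orthogonal_step:
  fixes s c x y :: int
  shows "s * (x + y * c) + c * (x - y * s) = (s + c) * x"
    and "s * (x + y * c)\<^sup>2 + c * (x - y * s)\<^sup>2 = (s + c) * x\<^sup>2 + s * (s + c) * c * y\<^sup>2"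
  by (simp_all add: power2_eq_square algebra_simps)

text \<open>If no proper part of \<open>I\<close> has sum 0, the partial sums along five indices are
  nonzero, so four orthogonal vectors with nonzero values exist and Meyer's theorem applies to these
  values and \<open>C\<close>.\<close>

lemma balanced_vector:
  fixes c :: "nat \<Rightarrow> int"
  assumes I: "finite I" "card I \<ge> 6" and nz: "\<And>i. i \<in> I \<Longrightarrow> c i \<noteq> 0" and sum0: "(\<Sum>i\<in>I. c i) = 0"
    and C: "C > 0 \<Longrightarrow> card {i \<in> I. c i < 0} \<ge> 2" "C < 0 \<Longrightarrow> card {i \<in> I. c i > 0} \<ge> 2"
  shows "\<exists>b m. m > 0 \<and> (\<Sum>i\<in>I. c i * b i) = 0 \<and> (\<Sum>i\<in>I. c i * (b i)\<^sup>2) + C * m\<^sup>2 = 0"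
proof (cases "C = 0 \<or> (\<exists>I1. I1 \<subset> I \<and> I1 \<noteq> {} \<and> (\<Sum>i\<in>I1. c i) = 0)")
  case True
  then show ?thesis
  proof
    assume "C = 0"
    then show ?thesis by (intro exI[of _ "\<lambda>_. 0"] exI[of _ 1]) simp
  next
    assume "\<exists>I1. I1 \<subset> I \<and> I1 \<noteq> {} \<and> (\<Sum>i\<in>I1. c i) = 0"
    then show ?thesis using balanced_vector_zero_subsum[OF I(1) nz sum0] by blast
  qed
next
  case False
  \<comment> \<open>Starting with two coefficients of sign opposite to \<open>C\<close> gives the
    first diagonal entry \<open>c i1 * s2 * c i2\<close> that sign, hence indefiniteness.\<close>
  have "\<exists>i1 i2. i1 \<in> I \<and> i2 \<in> I \<and> i1 \<noteq> i2 \<and> (C > 0 \<longrightarrow> c i1 < 0 \<and> c i2 < 0) \<and> (C < 0 \<longrightarrow> c i1 > 0 \<and> c i2 > 0)"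
  proof -
    have two: "\<exists>i1 i2. i1 \<in> X \<and> i2 \<in> X \<and> i1 \<noteq> i2" if X: "card X \<ge> 2" for X :: "nat set"
    proof -
      obtain i1 where i1: "i1 \<in> X" using X by fastforce
      then have "card (X - {i1}) \<ge> 1" using X by (simp add: card_Diff_singleton)
      then have "X - {i1} \<noteq> {}" by force
      then show ?thesis using i1 by blast
    qed
    show ?thesis
    proof (cases "C > 0")
      case True
      obtain i1 i2 where "i1 \<in> I" "c i1 < 0" "i2 \<in> I" "c i2 < 0" "i1 \<noteq> i2"
        using two[OF C(1)[OF True]] by blast
      with True show ?thesis by (intro exI[of _ i1] exI[of _ i2]) simp
    next
      case False
      with \<open>\<not> (C = 0 \<or> _)\<close> have "C < 0" by auto
      obtain i1 i2 where "i1 \<in> I" "c i1 > 0" "i2 \<in> I" "c i2 > 0" "i1 \<noteq> i2"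
        using two[OF C(2)[OF \<open>C < 0\<close>]] by blast
      with \<open>C < 0\<close> show ?thesis by (intro exI[of _ i1] exI[of _ i2]) simp
    qed
  qed
  then obtain i1 i2 where i12: "i1 \<in> I" "i2 \<in> I" "i1 \<noteq> i2"
    "C > 0 \<Longrightarrow> c i1 < 0 \<and> c i2 < 0" "C < 0 \<Longrightarrow> c i1 > 0 \<and> c i2 > 0" by blast
  have more: "\<exists>i. i \<in> I \<and> i \<notin> set xs" if "length xs \<le> 5" for xs
  proof (rule ccontr)
    assume "\<not> ?thesis"
    then have "card I \<le> card (set xs)" by (intro card_mono) auto
    then show False using that I(2) card_length[of xs] by linarith
  qed
  obtain i3 where i3: "i3 \<in> I" "i3 \<notin> {i1, i2}" using more[of "[i1, i2]"] by auto
  obtain i4 where i4: "i4 \<in> I" "i4 \<notin> {i1, i2, i3}" using more[of "[i1, i2, i3]"] by auto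
  obtain i5 where i5: "i5 \<in> I" "i5 \<notin> {i1, i2, i3, i4}" using more[of "[i1, i2, i3, i4]"] by auto
  \<comment> \<open>The sixth index makes the five others a proper subset, so that their sum
    \<open>s5\<close> is nonzero as well.\<close>
  obtain i6 where i6: "i6 \<in> I" "i6 \<notin> {i1, i2, i3, i4, i5}" using more[of "[i1, i2, i3, i4, i5]"] by auto
  have part: "(\<Sum>i\<in>X. c i) \<noteq> 0" if "X \<noteq> {}" "X \<subseteq> {i1, i2, i3, i4, i5}" for X
  proof -
    have "X \<subset> I" using that i12 i3 i4 i5 i6 by blast
    then show ?thesis using False that(1) by blast
  qed
  define s2 s3 s4 s5 where "s2 = c i1 + c i2" and "s3 = s2 + c i3" and "s4 = s3 + c i4" and "s5 = s4 + c i5"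
  note s_defs = s2_def s3_def s4_def s5_def
  have snz: "c i1 \<noteq> 0" "s2 \<noteq> 0" "s3 \<noteq> 0" "s4 \<noteq> 0" "s5 \<noteq> 0"
    using part[of "{i1}"] part[of "{i1, i2}"] part[of "{i1, i2, i3}"] part[of "{i1, i2, i3, i4}"]
      part[of "{i1, i2, i3, i4, i5}"] i12 i3 i4 i5 by (auto simp: s_defs algebra_simps)
  have sgn: "c i1 * s2 * c i2 < 0" if "C > 0"
    using i12(4)[OF that] by (simp add: s2_def mult_neg_neg mult_pos_neg)
  have sgn': "c i1 * s2 * c i2 > 0" if "C < 0"
    using i12(5)[OF that] by (simp add: s2_def)
  obtain y1 y2 y3 y4 m where m: "m \<noteq> 0" and
    eq: "(c i1 * s2 * c i2) * y1\<^sup>2 + (s2 * s3 * c i3) * y2\<^sup>2 + (s3 * s4 * c i4) * y3\<^sup>2 + (s4 * s5 * c i5) * y4\<^sup>2 + C * m\<^sup>2 = 0"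
    using meyer_last_nonzero[of "c i1 * s2 * c i2" "s2 * s3 * c i3" "s3 * s4 * c i4" "s4 * s5 * c i5" C]
      snz nz i12 i3 i4 i5 False sgn sgn' by (metis less_asym mult_eq_0_iff)
  \<comment> \<open>Coordinates of the combination of the four orthogonal vectors with coefficients
    y1 to y4. The leading entries of each vector are equal, so they are accumulated from the last
    vector backwards.\<close>
  define x4 x3 x2 x1 where "x4 = y4 * c i5" and "x3 = x4 + y3 * c i4" and "x2 = x3 + y2 * c i3" and "x1 = x2 + y1 * c i2"
  define b where "b = (\<lambda>_ :: nat. 0)(i1 := x1, i2 := x2 - y1 * c i1, i3 := x3 - y2 * s2, i4 := x4 - y3 * s3, i5 := - y4 * s4)"
  let ?J = "{i1, i2, i3, i4, i5}"
  have J: "?J \<subseteq> I" using i12 i3 i4 i5 by auto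
  have dist: "i1 \<notin> {i2, i3, i4, i5}" "i2 \<notin> {i3, i4, i5}" "i3 \<notin> {i4, i5}" "i4 \<noteq> i5"
    using i12(3) i3(2) i4(2) i5(2) by auto
  then have bs: "b i1 = x1" "b i2 = x2 - y1 * c i1" "b i3 = x3 - y2 * s2" "b i4 = x4 - y3 * s3" "b i5 = 0 - y4 * s4"
    by (auto simp: b_def)
  have "(\<Sum>i\<in>I. c i * b i) = (\<Sum>i\<in>?J. c i * b i)" "(\<Sum>i\<in>I. c i * (b i)\<^sup>2) = (\<Sum>i\<in>?J. c i * (b i)\<^sup>2)"
    using I(1) J by (intro sum.mono_neutral_right; auto simp: b_def)+
  then have sums: "(\<Sum>i\<in>I. c i * b i) = c i1 * x1 + c i2 * (x2 - y1 * c i1) + c i3 * (x3 - y2 * s2) + c i4 * (x4 - y3 * s3) + c i5 * (0 - y4 * s4)"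
    "(\<Sum>i\<in>I. c i * (b i)\<^sup>2) = c i1 * x1\<^sup>2 + c i2 * (x2 - y1 * c i1)\<^sup>2 + c i3 * (x3 - y2 * s2)\<^sup>2 + c i4 * (x4 - y3 * s3)\<^sup>2 + c i5 * (0 - y4 * s4)\<^sup>2"
    using dist by (simp_all add: bs)
  note steps = orthogonal_step[of "c i1" x2 y1 "c i2", folded x1_def s2_def]
    orthogonal_step[of s2 x3 y2 "c i3", folded x2_def s3_def]
    orthogonal_step[of s3 x4 y3 "c i4", folded x3_def s4_def]
    orthogonal_step[of s4 0 y4 "c i5", simplified add_0, folded x4_def s5_def]
  have "(\<Sum>i\<in>I. c i * b i) = 0"
    unfolding sums(1) using steps(1,3,5,7) by linarith
  moreover have "(\<Sum>i\<in>I. c i * (b i)\<^sup>2) + C * \<bar>m\<bar>\<^sup>2 = 0"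
    unfolding sums(2) power2_abs using steps(2,4,6,8) eq by simp
  moreover have "\<bar>m\<bar> > 0" using m by simp
  ultimately show ?thesis by blast
qed

section \<open>Partition regularity\<close>

text \<open>Scaling \<open>b\<close> by k replaces m by k m, so the values of m can be multiplied
  up. One m is required because the dilates involve it before \<open>C\<close> is known.\<close>

lemma common_denominator:
  fixes c :: "nat \<Rightarrow> int" and X :: "int set"
  assumes "finite X"
    and "\<And>C. C \<in> X \<Longrightarrow> \<exists>b m. m > 0 \<and> (\<Sum>i\<in>I. c i * b i) = 0 \<and> (\<Sum>i\<in>I. c i * (b i)\<^sup>2) + C * m\<^sup>2 = 0"
  shows "\<exists>m>0. \<exists>b. \<forall>C\<in>X. (\<Sum>i\<in>I. c i * b C i) = 0 \<and> (\<Sum>i\<in>I. c i * (b C i)\<^sup>2) + C * m\<^sup>2 = 0"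
  using assms
proof (induction X rule: finite_induct)
  case empty
  then show ?case by (intro exI[of _ 1]) simp
next
  case (insert C X)
  have scale: "(\<Sum>i\<in>I. c i * (k * b i)) = 0 \<and> (\<Sum>i\<in>I. c i * (k * b i)\<^sup>2) + C * (k * m)\<^sup>2 = 0"
    if "(\<Sum>i\<in>I. c i * b i) = 0 \<and> (\<Sum>i\<in>I. c i * (b i)\<^sup>2) + C * m\<^sup>2 = 0" for k b C m
  proof -
    have "(\<Sum>i\<in>I. c i * (k * b i)) = k * (\<Sum>i\<in>I. c i * b i)"
      "(\<Sum>i\<in>I. c i * (k * b i)\<^sup>2) = k\<^sup>2 * (\<Sum>i\<in>I. c i * (b i)\<^sup>2)"
      by (simp_all add: sum_distrib_left power_mult_distrib mult_ac)
    moreover have "k\<^sup>2 * (\<Sum>i\<in>I. c i * (b i)\<^sup>2) + C * (k * m)\<^sup>2 = k\<^sup>2 * ((\<Sum>i\<in>I. c i * (b i)\<^sup>2) + C * m\<^sup>2)"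
      by (simp add: power_mult_distrib algebra_simps)
    ultimately show ?thesis using that by simp
  qed
  obtain m b where m: "m > 0" "\<And>C. C \<in> X \<Longrightarrow> (\<Sum>i\<in>I. c i * b C i) = 0 \<and> (\<Sum>i\<in>I. c i * (b C i)\<^sup>2) + C * m\<^sup>2 = 0"
    using insert.IH insert.prems by blast
  obtain b' m' where m': "m' > 0" "(\<Sum>i\<in>I. c i * b' i) = 0 \<and> (\<Sum>i\<in>I. c i * (b' i)\<^sup>2) + C * m'\<^sup>2 = 0"
    using insert.prems[of C] by blast
  show ?case
  proof (intro exI[of _ "m' * m"] exI[of _ "\<lambda>D i. if D = C then m * b' i else m' * b D i"] conjI ballI)
    show "m' * m > 0" using m(1) m'(1) by simp
  next
    fix D assume "D \<in> insert C X"
    then have "(\<Sum>i\<in>I. c i * (if D = C then m * b' i else m' * b D i)) = 0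
      \<and> (\<Sum>i\<in>I. c i * (if D = C then m * b' i else m' * b D i)\<^sup>2) + D * (m' * m)\<^sup>2 = 0"
      using scale[OF m'(2), of m] scale[OF m(2)[of D], of m'] by (cases "D = C") (auto simp: mult.commute)
    then show "(\<Sum>i\<in>I. c i * (if D = C then m * b' i else m' * b D i)) = 0"
      "(\<Sum>i\<in>I. c i * (if D = C then m * b' i else m' * b D i)\<^sup>2) + D * (m' * m)\<^sup>2 = 0" by auto
  qed
qed

text \<open>A single negative coefficient gets a weight \<open>K\<close> exceeding all that the
  other terms can add up to while t <= N; the rest keep weight 1.\<close>

lemma weights_nonpositive:
  fixes c :: "nat \<Rightarrow> int"
  assumes "finite J" "j0 \<in> J" "c j0 < 0"
  shows "\<exists>D :: nat \<Rightarrow> nat. (\<forall>j. D j > 0) \<and>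
     (\<forall>t :: nat \<Rightarrow> nat. (\<forall>j\<in>J. t j \<in> {1..N}) \<longrightarrow> (\<Sum>j\<in>J. c j * (int (t j * D j))\<^sup>2) \<le> 0)"
proof -
  define K where "K = 1 + nat (\<Sum>j\<in>J. \<bar>c j\<bar> * (int N)\<^sup>2)"
  define D where "D j = (if j = j0 then K else 1)" for j
  have "(\<Sum>j\<in>J. c j * (int (t j * D j))\<^sup>2) \<le> 0" if t: "\<forall>j\<in>J. t j \<in> {1..N}" for t
  proof -
    have "(\<Sum>j\<in>J - {j0}. c j * (int (t j * D j))\<^sup>2) \<le> (\<Sum>j\<in>J - {j0}. \<bar>c j\<bar> * (int N)\<^sup>2)"
    proof (rule sum_mono)
      fix j assume j: "j \<in> J - {j0}"
      then have "(int (t j * D j))\<^sup>2 \<le> (int N)\<^sup>2" using t by (intro power_mono) (auto simp: D_def)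
      then show "c j * (int (t j * D j))\<^sup>2 \<le> \<bar>c j\<bar> * (int N)\<^sup>2"
        by (intro mult_mono) auto
    qed
    also have "\<dots> \<le> (\<Sum>j\<in>J. \<bar>c j\<bar> * (int N)\<^sup>2)" using assms(1) by (intro sum_mono2) auto
    also have "\<dots> \<le> int K" by (simp add: K_def)
    also have "int K \<le> (int (t j0 * D j0))\<^sup>2"
    proof -
      have "K * 1 \<le> K * (t j0 * (t j0 * K))"
        using t assms(2) by (intro mult_le_mono2) (auto simp: K_def Suc_le_eq)
      then have "K \<le> (t j0 * D j0)\<^sup>2" by (simp add: D_def power2_eq_square mult_ac)
      then show ?thesis by (metis of_nat_le_iff of_nat_power)
    qed
    also have "\<dots> \<le> - c j0 * (int (t j0 * D j0))\<^sup>2"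
      using mult_right_mono[of 1 "- c j0" "(int (t j0 * D j0))\<^sup>2"] assms(3) by simp
    finally show ?thesis using assms(1,2) by (subst sum.remove[of _ j0]) auto
  qed
  moreover have "D j > 0" for j by (simp add: D_def K_def)
  ultimately show ?thesis by blast
qed

text \<open>As |I| >= 6, at most one sign occurs fewer than twice in \<open>I\<close>. That sign
  then occurs outside \<open>I\<close>, and weighting such a coefficient excludes the bad sign of
  the sum.\<close>

lemma weights_exist:
  fixes c :: "nat \<Rightarrow> int"
  assumes I: "I \<subseteq> {1..s}" "card I \<ge> 6" and nz: "\<And>i. i \<in> {1..s} \<Longrightarrow> c i \<noteq> 0"
    and two: "card {i \<in> {1..s}. c i > 0} \<ge> 2" "card {i \<in> {1..s}. c i < 0} \<ge> 2"
  shows "\<exists>D :: nat \<Rightarrow> nat. (\<forall>j. D j > 0) \<and>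
     (\<forall>t :: nat \<Rightarrow> nat. (\<forall>j\<in>{1..s} - I. t j \<in> {1..N}) \<longrightarrow> 
        ((\<Sum>j\<in>{1..s} - I. c j * (int (t j * D j))\<^sup>2) > 0 \<longrightarrow> card {i \<in> I. c i < 0} \<ge> 2)
      \<and> ((\<Sum>j\<in>{1..s} - I. c j * (int (t j * D j))\<^sup>2) < 0 \<longrightarrow> card {i \<in> I. c i > 0} \<ge> 2))"
proof -
  have fin: "finite I" using I(1) finite_subset by blast
  have "I = {i \<in> I. c i > 0} \<union> {i \<in> I. c i < 0}" using nz I(1) by force
  then have "card I \<le> card {i \<in> I. c i > 0} + card {i \<in> I. c i < 0}" by (metis card_Un_le)
  then consider "card {i \<in> I. c i > 0} \<ge> 2" "card {i \<in> I. c i < 0} \<ge> 2"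
    | "card {i \<in> I. c i > 0} \<ge> 2" "card {i \<in> I. c i < 0} < 2"
    | "card {i \<in> I. c i > 0} < 2" "card {i \<in> I. c i < 0} \<ge> 2" using I(2) by linarith
  then show ?thesis
  proof cases
    case 1
    then show ?thesis by (intro exI[of _ "\<lambda>_. 1"]) simp
  next
    case 2
    have "\<not> {i \<in> {1..s}. c i < 0} \<subseteq> {i \<in> I. c i < 0}"
      using card_mono[of "{i \<in> I. c i < 0}" "{i \<in> {1..s}. c i < 0}"] 2 two fin by auto
    then obtain j0 where "j0 \<in> {1..s} - I" "c j0 < 0" by blast
    then obtain D where D: "\<forall>j. D j > 0" "\<And>t. \<forall>j\<in>{1..s} - I. t j \<in> {1..N} \<Longrightarrow> (\<Sum>j\<in>{1..s} - I. c j * (int (t j * D j))\<^sup>2) \<le> 0"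
      using weights_nonpositive[of "{1..s} - I" j0 c N] by (meson finite_Diff finite_atLeastAtMost)
    show ?thesis
    proof (intro exI[of _ D] conjI allI impI)
      fix t assume "\<forall>j\<in>{1..s} - I. t j \<in> {1..N}" "0 < (\<Sum>j\<in>{1..s} - I. c j * (int (t j * D j))\<^sup>2)"
      then show "2 \<le> card {i \<in> I. c i < 0}" using D(2)[of t] by linarith
    qed (use D(1) 2 in auto)
  next
    case 3
    have "\<not> {i \<in> {1..s}. c i > 0} \<subseteq> {i \<in> I. c i > 0}"
      using card_mono[of "{i \<in> I. c i > 0}" "{i \<in> {1..s}. c i > 0}"] 3 two fin by auto
    then obtain j0 where j0: "j0 \<in> {1..s} - I" "- c j0 < 0" by auto
    then obtain D where D: "\<forall>j. D j > 0" "\<And>t. \<forall>j\<in>{1..s} - I. t j \<in> {1..N} \<Longrightarrow> (\<Sum>j\<in>{1..s} - I. - c j * (int (t j * D j))\<^sup>2) \<le> 0"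
      using weights_nonpositive[of "{1..s} - I" j0 "\<lambda>j. - c j" N] by (meson finite_Diff finite_atLeastAtMost)
    show ?thesis
    proof (intro exI[of _ D] conjI allI impI)
      fix t assume "\<forall>j\<in>{1..s} - I. t j \<in> {1..N}" "(\<Sum>j\<in>{1..s} - I. c j * (int (t j * D j))\<^sup>2) < 0"
      then show "2 \<le> card {i \<in> I. c i > 0}"
        using D(2)[of t] by (simp only: mult_minus_left sum_negf) linarith
    qed (use D(1) 3 in auto)
  qed
qed

definition monochromatic_solution :: "nat \<Rightarrow> (nat \<Rightarrow> int) \<Rightarrow> (nat \<Rightarrow> nat) \<Rightarrow> nat \<Rightarrow> bool" where
  "monochromatic_solution s c f N \<longleftrightarrow>
     (\<exists>x k. (\<forall>i\<in>{1..s}. x i \<in> {1..N} \<and> f (x i) = k) \<and> (\<Sum>i=1..s. c i * (int (x i))\<^sup>2) = 0)"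

lemma monochromatic_solution_dilate:
  assumes "monochromatic_solution s c (\<lambda>x. f (x * q)) N" "q > 0" "N * q \<le> N'"
  shows "monochromatic_solution s c f N'"
proof -
  obtain x k where x: "\<And>i. i \<in> {1..s} \<Longrightarrow> x i \<in> {1..N} \<and> f (x i * q) = k" "(\<Sum>i=1..s. c i * (int (x i))\<^sup>2) = 0"
    using assms(1) unfolding monochromatic_solution_def by blast
  have "(\<Sum>i=1..s. c i * (int (x i * q))\<^sup>2) = (int q)\<^sup>2 * (\<Sum>i=1..s. c i * (int (x i))\<^sup>2)"
    by (simp add: sum_distrib_left power_mult_distrib mult_ac)
  moreover have "x i * q \<in> {1..N'}" if "i \<in> {1..s}" for i
  proof -
    have "x i * q \<le> N * q" using x(1)[OF that] by (intro mult_le_mono1) auto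
    then have "x i * q \<le> N'" using assms(3) by linarith
    then show ?thesis using x(1)[OF that] assms(2) by (simp add: Suc_le_eq)
  qed
  ultimately show ?thesis
    unfolding monochromatic_solution_def using x by (intro exI[of _ "\<lambda>i. x i * q"] exI[of _ k]) auto
qed

lemma progression_solution:
  fixes c :: "nat \<Rightarrow> int"
  assumes "finite S" "I \<subseteq> S" and I0: "(\<Sum>i\<in>I. c i) = 0" and b: "(\<Sum>i\<in>I. c i * b i) = 0"
    "(\<Sum>i\<in>I. c i * (b i)\<^sup>2) + (\<Sum>j\<in>S - I. c j * (y j)\<^sup>2) * m\<^sup>2 = 0"
  shows "(\<Sum>i\<in>S. c i * (if i \<in> I then a + b i * d else y i * m * d)\<^sup>2) = 0"
proof -
  have "(\<Sum>i\<in>S. c i * (if i \<in> I then a + b i * d else y i * m * d)\<^sup>2)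
     = (\<Sum>i\<in>S - I. c i * (y i * m * d)\<^sup>2) + (\<Sum>i\<in>I. c i * (a + b i * d)\<^sup>2)"
    using sum.subset_diff[OF assms(2,1), of "\<lambda>i. c i * (if i \<in> I then a + b i * d else y i * m * d)\<^sup>2"] by simp
  also have "(\<Sum>i\<in>S - I. c i * (y i * m * d)\<^sup>2) = (\<Sum>j\<in>S - I. c j * (y j)\<^sup>2) * m\<^sup>2 * d\<^sup>2"
    unfolding sum_distrib_right by (intro sum.cong) (simp_all add: power_mult_distrib)
  also have "(\<Sum>i\<in>I. c i * (a + b i * d)\<^sup>2) = (\<Sum>i\<in>I. c i * a\<^sup>2 + (c i * b i) * (2 * a * d) + (c i * (b i)\<^sup>2) * d\<^sup>2)"
    by (intro sum.cong) (auto simp: power2_eq_square algebra_simps)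
  also have "\<dots> = (\<Sum>i\<in>I. c i * (b i)\<^sup>2) * d\<^sup>2"
    by (simp add: sum.distrib sum_distrib_right[symmetric] I0 b(1))
  also have "(\<Sum>j\<in>S - I. c j * (y j)\<^sup>2) * m\<^sup>2 * d\<^sup>2 + (\<Sum>i\<in>I. c i * (b i)\<^sup>2) * d\<^sup>2
     = ((\<Sum>i\<in>I. c i * (b i)\<^sup>2) + (\<Sum>j\<in>S - I. c j * (y j)\<^sup>2) * m\<^sup>2) * d\<^sup>2"
    by (simp add: algebra_simps)
  finally show ?thesis using b(2) by simp
qed

lemma finite_partition_regularity:
  fixes s :: nat and c :: "nat \<Rightarrow> int"
  assumes nz: "\<And>i. i \<in> {1..s} \<Longrightarrow> c i \<noteq> 0"
    and I: "I \<subseteq> {1..s}" "card I \<ge> 6" "(\<Sum>i\<in>I. c i) = 0"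
    and two: "card {i \<in> {1..s}. c i > 0} \<ge> 2" "card {i \<in> {1..s}. c i < 0} \<ge> 2"
  shows "\<exists>N>0. \<forall>f. card (f ` {1..N}) \<le> r \<longrightarrow> monochromatic_solution s c f N"
proof (induction r)
  case 0
  show ?case by (intro exI[of _ 1]) simp
next
  case (Suc r)
  then obtain N where N: "N > 0" "\<And>f. card (f ` {1..N}) \<le> r \<Longrightarrow> monochromatic_solution s c f N" by blast
  have fin: "finite I" using I(1) finite_subset by blast
  let ?J = "{1..s} - I"
  obtain D :: "nat \<Rightarrow> nat" where D: "\<And>j. D j > 0" and sgn: "\<And>t :: nat \<Rightarrow> nat. \<forall>j\<in>?J. t j \<in> {1..N} \<Longrightarrow>
        ((\<Sum>j\<in>?J. c j * (int (t j * D j))\<^sup>2) > 0 \<longrightarrow> card {i \<in> I. c i < 0} \<ge> 2)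
      \<and> ((\<Sum>j\<in>?J. c j * (int (t j * D j))\<^sup>2) < 0 \<longrightarrow> card {i \<in> I. c i > 0} \<ge> 2)"
    using weights_exist[OF I(1,2) nz two, of N] by blast
  define K where "K = (\<Sum>j\<in>?J. \<bar>c j\<bar> * (int (N * D j))\<^sup>2)"
  \<comment> \<open>A finite set, fixed before the colouring, that contains every sum the
    multipliers t <= N can produce and whose elements all satisfy the sign conditions of
    \<open>balanced_vector\<close>.\<close>
  define X where "X = {C \<in> {-K..K}. (C > 0 \<longrightarrow> card {i \<in> I. c i < 0} \<ge> 2) \<and> (C < 0 \<longrightarrow> card {i \<in> I. c i > 0} \<ge> 2)}"
  have X: "(\<Sum>j\<in>?J. c j * (int (t j * D j))\<^sup>2) \<in> X" if t: "\<forall>j\<in>?J. t j \<in> {1..N}" for t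
  proof -
    have "\<bar>\<Sum>j\<in>?J. c j * (int (t j * D j))\<^sup>2\<bar> \<le> K"
      unfolding K_def
    proof (rule order_trans[OF sum_abs sum_mono])
      fix j assume "j \<in> ?J"
      then have "t j * D j \<le> N * D j" using t by (intro mult_le_mono1) auto
      then have "(int (t j * D j))\<^sup>2 \<le> (int (N * D j))\<^sup>2" by (intro power_mono) (simp_all only: of_nat_le_iff of_nat_0_le_iff)
      then show "\<bar>c j * (int (t j * D j))\<^sup>2\<bar> \<le> \<bar>c j\<bar> * (int (N * D j))\<^sup>2"
        by (simp only: abs_mult abs_power2 mult_left_mono abs_ge_zero)
    qed
    then show ?thesis using sgn[OF t] by (auto simp: X_def)
  qed
  have "finite X" unfolding X_def by (rule finite_subset[of _ "{-K..K}"]) auto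
  moreover have "\<exists>b m. m > 0 \<and> (\<Sum>i\<in>I. c i * b i) = 0 \<and> (\<Sum>i\<in>I. c i * (b i)\<^sup>2) + C * m\<^sup>2 = 0" if "C \<in> X" for C
  proof (rule balanced_vector[OF fin I(2) _ I(3)])
    show "c i \<noteq> 0" if "i \<in> I" for i using nz I(1) that by blast
  qed (use that in \<open>auto simp: X_def\<close>)
  ultimately obtain m' b where m': "m' > 0" and b: "\<And>C. C \<in> X \<Longrightarrow> (\<Sum>i\<in>I. c i * b C i) = 0 \<and> (\<Sum>i\<in>I. c i * (b C i)\<^sup>2) + C * m'\<^sup>2 = 0"
    using common_denominator[of X c I] by blast
  define m where "m = nat m'"
  have m: "m > 0" "int m = m'" using m' by (simp_all add: m_def)
  define B where "B = nat (\<Sum>C\<in>X. \<Sum>i\<in>I. \<bar>b C i\<bar>)"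
  have B: "\<bar>b C i\<bar> \<le> int B" if "C \<in> X" "i \<in> I" for C i
  proof -
    have "\<bar>b C i\<bar> \<le> (\<Sum>i\<in>I. \<bar>b C i\<bar>)" using member_le_sum[OF that(2), of "\<lambda>i. \<bar>b C i\<bar>"] fin by simp
    also have "\<dots> \<le> (\<Sum>C\<in>X. \<Sum>i\<in>I. \<bar>b C i\<bar>)"
      using member_le_sum[OF that(1), of "\<lambda>C. \<Sum>i\<in>I. \<bar>b C i\<bar>"] \<open>finite X\<close> by (simp add: sum_nonneg)
    also have "\<dots> \<le> int B" unfolding B_def by linarith
    finally show ?thesis .
  qed
  obtain W where W: "van_der_waerden (2 * B) (Suc r) W" using van_der_waerden by blast
  define N' where "N' = 1 + W + N * ((\<Sum>j\<in>?J. D j) * m * W)"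
  show ?case
  proof (intro exI[of _ N'] conjI allI impI)
    show "N' > 0" by (simp add: N'_def)
  next
    fix f :: "nat \<Rightarrow> nat" assume f: "card (f ` {1..N'}) \<le> Suc r"
    \<comment> \<open>Van der Waerden's theorem starts at 0, the colouring at 1; hence the
      shift.\<close>
    have "(\<lambda>x. f (Suc x)) ` {..<W} \<subseteq> f ` {1..N'}" by (auto simp: N'_def)
    then have "card ((\<lambda>x. f (Suc x)) ` {..<W}) \<le> Suc r" using f card_mono[of "f ` {1..N'}"] by (meson finite_atLeastAtMost finite_imageI le_trans)
    then obtain a d where ad: "0 < d" "d \<le> W" "a + 2 * B * d < W" "\<And>i. i \<le> 2 * B \<Longrightarrow> f (Suc (a + i * d)) = f (Suc a)"
      using W unfolding van_der_waerden_def by blast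
    define k where "k = f (Suc a)"
    have bound: "N * (D j * m * d) \<le> N'" if "j \<in> ?J" for j
    proof -
      have "D j \<le> (\<Sum>j\<in>?J. D j)" using that by (intro member_le_sum) auto
      then have "N * (D j * m * d) \<le> N * ((\<Sum>j\<in>?J. D j) * m * W)"
        using ad(2) by (intro mult_le_mono le_refl)
      then show ?thesis unfolding N'_def by linarith
    qed
    show "monochromatic_solution s c f N'"
    proof (cases "\<forall>j\<in>?J. \<exists>t\<in>{1..N}. f (t * (D j * m * d)) = k")
      case False
      then obtain j where j: "j \<in> ?J" "\<And>t. t \<in> {1..N} \<Longrightarrow> f (t * (D j * m * d)) \<noteq> k" by blast
      let ?q = "D j * m * d"
      have q: "?q > 0" using D m ad by simp
      have "t * ?q \<in> {1..N'}" if "t \<in> {1..N}" for t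
      proof -
        have "t * ?q \<le> N * ?q" using that by (intro mult_le_mono1) auto
        then have "t * ?q \<le> N'" using bound[OF j(1)] by linarith
        then show ?thesis using that q by (simp add: Suc_le_eq)
      qed
      then have "(\<lambda>t. f (t * ?q)) ` {1..N} \<subseteq> f ` {1..N'} - {k}" using j(2) by blast
      then have "card ((\<lambda>t. f (t * ?q)) ` {1..N}) \<le> card (f ` {1..N'} - {k})" by (intro card_mono) auto
      moreover have "k \<in> f ` {1..N'}" using ad(3) by (auto simp: k_def N'_def)
      then have "card (f ` {1..N'} - {k}) \<le> r" using f by (simp add: card_Diff_singleton)
      ultimately have "card ((\<lambda>t. f (t * ?q)) ` {1..N}) \<le> r" by linarith
      then have "monochromatic_solution s c (\<lambda>t. f (t * ?q)) N" by (rule N(2))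
      then show ?thesis using monochromatic_solution_dilate[OF _ q bound[OF j(1)]] by blast
    next
      case True
      then obtain t where t: "\<And>j. j \<in> ?J \<Longrightarrow> t j \<in> {1..N} \<and> f (t j * (D j * m * d)) = k" by metis
      define C where "C = (\<Sum>j\<in>?J. c j * (int (t j * D j))\<^sup>2)"
      have CX: "C \<in> X" unfolding C_def using t by (intro X) blast
      \<comment> \<open>Offsets are counted from the middle term of the progression, so they may be
        negative: \<open>b C i\<close> lies between -B and B.\<close>
      define x where "x i = (if i \<in> I then Suc (a + nat (int B + b C i) * d) else t i * (D i * m * d))" for i
      have x_I: "int (x i) = int (Suc a + B * d) + b C i * int d" if "i \<in> I" for i
        using B[OF CX that] that by (simp add: x_def algebra_simps)
      have x_int: "int (x i) = (if i \<in> I then int (Suc a + B * d) + b C i * int d else int (t i * D i) * m' * int d)" for i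
        using x_I[of i] by (simp add: x_def m(2)[symmetric])
      have "(\<Sum>i=1..s. c i * (int (x i))\<^sup>2) = 0"
        unfolding x_int
        by (rule progression_solution) (use I b[OF CX] in \<open>simp_all only: C_def[symmetric] finite_atLeastAtMost\<close>)
      moreover have "x i \<in> {1..N'} \<and> f (x i) = k" if i: "i \<in> {1..s}" for i
      proof (cases "i \<in> I")
        case True
        have le: "nat (int B + b C i) \<le> 2 * B" using B[OF CX True] by linarith
        then have "nat (int B + b C i) * d \<le> 2 * B * d" by (rule mult_le_mono1)
        then have "Suc (a + nat (int B + b C i) * d) \<le> W" using ad(3) by linarith
        then have "x i \<le> W" using True by (simp add: x_def)
        then show ?thesis using True ad(4)[OF le] by (simp add: x_def k_def N'_def)
      next
        case False
        then have iJ: "i \<in> ?J" using i by simp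
        have "t i * (D i * m * d) \<le> N * (D i * m * d)" using t[OF iJ] by (intro mult_le_mono1) auto
        then have "t i * (D i * m * d) \<le> N'" using bound[OF iJ] by linarith
        then show ?thesis using False t[OF iJ] D[of i] m(1) ad(1) by (simp add: x_def Suc_le_eq)
      qed
      ultimately show ?thesis unfolding monochromatic_solution_def by blast
    qed
  qed
qed

theorem theorem1p8:
  fixes s :: nat and c :: "nat \<Rightarrow> int"
  assumes "\<And>i. i \<in> {1..s} \<Longrightarrow> c i \<noteq> 0"
    and "\<exists>I. I \<noteq> {} \<and> I \<subseteq> {1..s} \<and> card I \<ge> 6 \<and> (\<Sum>i\<in>I. c i) = 0"
    and "card {i \<in> {1..s}. c i > 0} \<ge> 2"
    and "card {i \<in> {1..s}. c i < 0} \<ge> 2"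
  shows "partition_regular s (\<lambda>x. (\<Sum>i=1..s. c i * (int (x i))\<^sup>2) = 0)"
  unfolding partition_regular_def
proof (intro allI impI)
  fix \<chi> :: "nat \<Rightarrow> nat"
  assume fin: "finite (\<chi> ` {0<..})"
  obtain I where "I \<subseteq> {1..s}" "card I \<ge> 6" "(\<Sum>i\<in>I. c i) = 0" using assms(2) by blast
  then obtain N where N: "\<And>f. card (f ` {1..N}) \<le> card (\<chi> ` {0<..}) \<Longrightarrow> monochromatic_solution s c f N"
    using finite_partition_regularity[OF assms(1) _ _ _ assms(3,4), of I] by blast
  have "card (\<chi> ` {1..N}) \<le> card (\<chi> ` {0<..})" using fin by (intro card_mono) auto
  from N[OF this] show "\<exists>x k. (\<forall>i\<in>{1..s}. x i > 0 \<and> \<chi> (x i) = k) \<and> (\<Sum>i=1..s. c i * (int (x i))\<^sup>2) = 0"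
    unfolding monochromatic_solution_def by (metis atLeastAtMost_iff less_eq_Suc_le One_nat_def)
qed

end
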